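(* Let $x$ be an abstract vector variable, $Y=\{y_1,\dots,y_N\}$ a finite set of further abstract vector variables, and $k\ge0$. The operator $\mathcal K^Y_k$ preserves every $\mathcal F^J_k(Y)$, $J\subseteq\{1,\dots,N\}$. It therefore induces an endomorphism $\operatorname{gr}^J\mathcal K^Y_k$ on $$\operatorname{gr}^JH^Y_k:=\mathcal F^J_k(Y)\Big/\sum_{J'\subsetneq J}\mathcal F^{J'}_k(Y).$$ If $D^Y_{k,J}:=\det(\operatorname{gr}^J\mathcal K^Y_k)$, then $$D^Y_k=\prod_{J\subseteq\{1,\dots,N\}}D^Y_{k,J}.$$ Furthermore, $D^Y_{k,J}$ is obtained by coefficient extension from the exact-support determinant for the smaller radial algebra generated by $x$ and $Y_J:=\{y_j:j\in J\}$; that is, $D^Y_{k,J}$ is the image, under the inclusion $\mathbb T_{Y_J}\hookrightarrow\mathbb T_Y$, of the determinant $D^{Y_J}_{k,J}$ of the exact-support-$J$ quotient operator formed in $R_{\mathbb B}(\{x\}\cup Y_J)$.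
   Context: **Radial algebra.** For a set $S$ of abstract vector variables, $R(S)$ is the associative unital $\mathbb R$-algebra generated by $S$ subject to $[\{u,v\},w]=0$ for all $u,v,w\in S$, where $\{a,b\}=ab+ba$, $[a,b]=ab-ba$. The wedge is the antisymmetrized product $u_1\wedge\cdots\wedge u_p=\frac1{p!}\sum_{\pi}\operatorname{sgn}(\pi)u_{\pi(1)}\cdots u_{\pi(p)}$ (empty wedge $=1$). **Coefficients.** $q,Q$ are algebraically independent indeterminates, $\mathbb B=\mathbb R[q,q^{-1},Q,(1-q)^{-1}]$, $R_{\mathbb B}(S)=\mathbb B\otimes_{\mathbb R}R(S)$. For integers $n,a$: $[n]_q=\frac{1-q^n}{1-q}$, $q^{m+a}:=Qq^a$, $[m+a]_q:=\frac{1-Qq^a}{1-q}$ ($m$ is only a formal symbol). **Scalars.** $r=x^2$, $s_i=\{x,y_i\}$, $c_{ij}=\{y_i,y_j\}=c_{ji}$ are central and $\mathcal A_x(Y)=\mathbb B[r,s_1,\dots,s_N,c_{ij}:1\le i\le j\le N]$ is a polynomial algebra. For $I=\{i_1<\cdots<i_p\}\subset\{1,\dots,N\}$, $y_I=y_{i_1}\wedge\cdots\wedge y_{i_p}$, $y_\varnothing=1$. It is known that $R_{\mathbb B}(\{x\}\cup Y)=\bigoplus_I y_I\mathcal A_x(Y)\oplus\bigoplus_I(x\wedge y_I)\mathcal A_x(Y)$, free over $\mathcal A_x(Y)$ on the elements $y_I,\ x\wedge y_I$. **Jackson operators.** For a scalar variable $u$ and parameter $P$: $\delta^{(u)}_Pf=\frac{f(u)-f(Pu)}{(1-P)u}$,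 $T^{(u)}_Pf(u)=f(Pu)$. For $A\in\mathcal A_x(Y)$, $$\partial^{\mathrm{sc},Y}_{x,q}A=(1+q)\,x\,\delta^{(r)}_{q^2}A+2\sum_{i=1}^N y_i\,T^{(r)}_{q^2}\delta^{(s_i)}_qA.$$ **Finite relative right $q$-vector derivative.** $\partial^{Y,\mathrm R}_{x,q}$ is the $\mathbb B$-linear operator on $R_{\mathbb B}(\{x\}\cup Y)$ with, for $p=|I|$ and $A,B\in\mathcal A_x(Y)$, $$\partial^{Y,\mathrm R}_{x,q}(y_IA)=y_I\,\partial^{\mathrm{sc},Y}_{x,q}(A),\qquad \partial^{Y,\mathrm R}_{x,q}((x\wedge y_I)B)=(-1)^p[m-p]_q\,y_IB+q^{m-p}(x\wedge y_I)\,\partial^{\mathrm{sc},Y}_{x,q}(B).$$ **Homogeneous blocks.** The $x$-degree is $\deg_xr=2$, $\deg_xs_i=1$, $\deg_xc_{ij}=0$, $\deg_xy_I=0$, $\deg_x(x\wedge y_I)=1$. $\mathbb T_Y=\mathbb B[c_{ij}:1\le i\le j\le N]$. $H^Y_n$ is the degree-$n$ component, a finite free $\mathbb T_Y$-module with basis $y_Ir^as^\beta$ ($2a+|\beta|=n$) and $(x\wedge y_I)r^as^\beta$ ($1+2a+|\beta|=n$). With $R_xF=Fx$, $\mathcal K^Y_k:=\partial^{Y,\mathrm R}_{x,q}R_x|_{H^Y_k}:H^Y_k\to H^Y_k$ is $\mathbb T_Y$-linear and $D^Y_k:=\det\mathcal K^Y_k\in\mathbb T_Y$. **Support filtration.**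 The $x$-support of a basis monomial $y_Ir^as^\beta$ or $(x\wedge y_I)r^as^\beta$ is $I\cup\{i:\beta_i>0\}$ (the variables $c_{ij}$ are not counted). $\mathcal F^J_k(Y)$ is the $\mathbb T_Y$-span of the degree-$k$ basis monomials whose $x$-support is contained in $J$. The quotient $\operatorname{gr}^JH^Y_k$ is free over $\mathbb T_Y$ on the basis monomials of $x$-support exactly $J$; the determinant of the zero module is $1$. *)

theory Defs
  imports
    "HOL-Library.Poly_Mapping"
    "HOL-Library.FuncSet"
    "HOL-Computational_Algebra.Fraction_Field"
    "HOL-Computational_Algebra.Polynomial"
    "HOL-Combinatorics.Permutations"
    "HOL-Algebra.QuotRing"
    "HOL-Algebra.Module"
    "Jordan_Normal_Form.Determinant"
begin

section \<open>The coefficient ring\<close>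

text \<open>
  \<open>\<real>(q,Q)\<close> is the fraction field of \<open>\<real>[q][Q]\<close>; the ring
  \<open>\<real>[q, 1/q, Q, 1/(1-q)]\<close> is the subring of it generated by the listed elements.
\<close>

type_synonym ratfun = "real poly poly fract"

definition rf_real :: "real \<Rightarrow> ratfun" where "rf_real a = Fract [:[:a:]:] 1"
definition rf_q :: ratfun where "rf_q = Fract [:[:0, 1:]:] 1"
definition rf_Q :: ratfun where "rf_Q = Fract [:0, 1:] 1"

inductive_set coeff_set :: "ratfun set" where
  real: "rf_real a \<in> coeff_set"
| q: "rf_q \<in> coeff_set"
| q_inv: "inverse rf_q \<in> coeff_set"
| Q: "rf_Q \<in> coeff_set"
| one_minus_q_inv: "inverse (1 - rf_q) \<in> coeff_set"
| add: "a \<in> coeff_set \<Longrightarrow> b \<in> coeff_set \<Longrightarrow> a + b \<in> coeff_set"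
| mult: "a \<in> coeff_set \<Longrightarrow> b \<in> coeff_set \<Longrightarrow> a * b \<in> coeff_set"

lemma coeff_set_0: "0 \<in> coeff_set"
  using coeff_set.real[of 0] by (simp add: rf_real_def Zero_fract_def)

lemma coeff_set_1: "1 \<in> coeff_set"
  using coeff_set.real[of 1] by (simp add: rf_real_def One_fract_def flip: one_pCons)

lemma coeff_set_uminus: "a \<in> coeff_set \<Longrightarrow> - a \<in> coeff_set"
proof -
  assume a: "a \<in> coeff_set"
  have "rf_real (-1) = - 1"
    by (simp add: rf_real_def One_fract_def one_pCons)
  with coeff_set.mult[OF coeff_set.real[of "-1"] a] show ?thesis by simp
qed

lemma coeff_set_diff: "a \<in> coeff_set \<Longrightarrow> b \<in> coeff_set \<Longrightarrow> a - b \<in> coeff_set"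
  using coeff_set.add[OF _ coeff_set_uminus, of a b] by simp

lemma coeff_set_power: "a \<in> coeff_set \<Longrightarrow> a ^ n \<in> coeff_set"
  by (induction n) (auto intro: coeff_set.mult coeff_set_1)

lemma coeff_set_q_powi: "rf_q powi a \<in> coeff_set"
  by (auto simp: power_int_def intro: coeff_set_power coeff_set.q coeff_set.q_inv)

typedef coeff = coeff_set
  using coeff_set_0 by blast

setup_lifting type_definition_coeff

instantiation coeff :: comm_ring_1
begin
lift_definition zero_coeff :: coeff is 0 by (rule coeff_set_0)
lift_definition one_coeff :: coeff is 1 by (rule coeff_set_1)
lift_definition plus_coeff :: "coeff \<Rightarrow> coeff \<Rightarrow> coeff" is "(+)" by (rule coeff_set.add)
lift_definition minus_coeff :: "coeff \<Rightarrow> coeff \<Rightarrow> coeff" is "(-)" by (rule coeff_set_diff)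
lift_definition uminus_coeff :: "coeff \<Rightarrow> coeff" is uminus by (rule coeff_set_uminus)
lift_definition times_coeff :: "coeff \<Rightarrow> coeff \<Rightarrow> coeff" is "(*)" by (rule coeff_set.mult)
instance
  by standard (transfer; simp add: algebra_simps)+
end

lift_definition real_coeff :: "real \<Rightarrow> coeff" is rf_real by (rule coeff_set.real)
lift_definition q :: coeff is rf_q by (rule coeff_set.q)

text \<open>\<open>qpow_m a\<close> is \<open>q\<close> to the power \<open>m + a\<close>, that is \<open>Q q\<^sup>a\<close>; and \<open>qnum_m a\<close> is
  \<open>[m + a]\<close>, the corresponding \<open>q\<close>-number, for the formal symbol \<open>m\<close>.\<close>

lift_definition qpow_m :: "int \<Rightarrow> coeff" is "\<lambda>a. rf_Q * rf_q powi a"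
  by (intro coeff_set.mult coeff_set.Q coeff_set_q_powi)

lift_definition qnum_m :: "int \<Rightarrow> coeff" is "\<lambda>a. (1 - rf_Q * rf_q powi a) / (1 - rf_q)"
  unfolding divide_inverse
  by (intro coeff_set.mult coeff_set_diff coeff_set_1 coeff_set.Q coeff_set_q_powi
      coeff_set.one_minus_q_inv)


section \<open>The radial algebra\<close>

datatype vvar = VX | VY nat

datatype 'v word = Word (letters: "'v list")

instantiation word :: (type) monoid_add
begin
definition zero_word :: "'a word" where "zero_word = Word []"
definition plus_word :: "'a word \<Rightarrow> 'a word \<Rightarrow> 'a word"
  where "plus_word v w = Word (letters v @ letters w)"
instance by standard (simp_all add: zero_word_def plus_word_def)
end

text \<open>Free associative algebra as the monoid algebra of the free monoid of words.\<close>

type_synonym free_elt = "vvar word \<Rightarrow>\<^sub>0 coeff"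

definition gen :: "vvar \<Rightarrow> free_elt" where
  "gen v = Poly_Mapping.single (Word [v]) 1"

definition free_const :: "coeff \<Rightarrow> free_elt" where
  "free_const c = Poly_Mapping.single 0 c"

definition free_algebra :: "vvar set \<Rightarrow> free_elt ring" where
  "free_algebra S =
    \<lparr>carrier = {f. \<forall>w\<in>Poly_Mapping.keys f. set (letters w) \<subseteq> S},
     monoid.mult = (*), one = 1, zero = 0, add = (+)\<rparr>"

definition acomm :: "free_elt \<Rightarrow> free_elt \<Rightarrow> free_elt" where
  "acomm a b = a * b + b * a"

definition radial_ideal :: "vvar set \<Rightarrow> free_elt set" where
  "radial_ideal S = genideal (free_algebra S)
    {acomm (gen u) (gen v) * gen w - gen w * acomm (gen u) (gen v) | u v w.
       u \<in> S \<and> v \<in> S \<and> w \<in> S}"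

text \<open>
  The radial algebra with coefficients extended from \<open>\<real>\<close> to \<^typ>\<open>coeff\<close>. Extension of
  scalars of an algebra given by generators and relations is the algebra over the larger
  ring with the same generators and relations.
\<close>

definition radial_algebra :: "vvar set \<Rightarrow> free_elt set ring" where
  "radial_algebra S = free_algebra S Quot radial_ideal S"

definition wedge :: "free_elt list \<Rightarrow> free_elt" where
  "wedge us = free_const (real_coeff (1 / fact (length us))) *
     (\<Sum>\<pi> | \<pi> permutes {..<length us}.
        of_int (sign \<pi>) * prod_list (map (\<lambda>i. us ! \<pi> i) [0..<length us]))"

text \<open>
  From here on, a finite index set \<open>L\<close> stands for the set of variables \<open>y\<^sub>i\<close> with \<open>i \<in> L\<close>.
  Keeping it a parameter allows the same construction for \<open>Y\<close> (\<open>L = {1..N}\<close>) and for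
  its subsets \<open>Y\<^sub>J\<close> (\<open>L = J\<close>), each in its own radial algebra.
\<close>

definition RA :: "nat set \<Rightarrow> free_elt set ring" where
  "RA L = radial_algebra (insert VX (VY ` L))"

definition cls :: "nat set \<Rightarrow> free_elt \<Rightarrow> free_elt set" where
  "cls L f = radial_ideal (insert VX (VY ` L)) +>\<^bsub>free_algebra (insert VX (VY ` L))\<^esub> f"

definition y_wedge :: "nat set \<Rightarrow> nat set \<Rightarrow> free_elt set" where
  "y_wedge L I = cls L (wedge (map (\<lambda>i. gen (VY i)) (sorted_list_of_set I)))"

definition xy_wedge :: "nat set \<Rightarrow> nat set \<Rightarrow> free_elt set" where
  "xy_wedge L I = cls L (wedge (gen VX # map (\<lambda>i. gen (VY i)) (sorted_list_of_set I)))"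


section \<open>Scalars and Jackson operators\<close>

text \<open>The variables \<open>r\<close>, \<open>s\<^sub>i\<close>, \<open>c\<^sub>i\<^sub>j\<close>; only those \<open>SC i j\<close> with \<open>i \<le> j\<close> are ever used.\<close>

datatype svar = SR | SS nat | SC nat nat

type_synonym scalar = "(svar \<Rightarrow>\<^sub>0 nat) \<Rightarrow>\<^sub>0 coeff"

definition svar_list :: "nat set \<Rightarrow> svar list" where
  "svar_list L = (let ls = sorted_list_of_set L in
     SR # map SS ls @ [SC i j. i \<leftarrow> ls, j \<leftarrow> ls, i \<le> j])"

definition polys_in :: "svar set \<Rightarrow> scalar set" where
  "polys_in V = {f. \<forall>m\<in>Poly_Mapping.keys f. Poly_Mapping.keys m \<subseteq> V}"

definition A_set :: "nat set \<Rightarrow> scalar set" where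
  "A_set L = polys_in (set (svar_list L))"

definition T_ring :: "nat set \<Rightarrow> scalar ring" where
  "T_ring L = \<lparr>carrier = polys_in {SC i j | i j. i \<in> L \<and> j \<in> L \<and> i \<le> j},
     monoid.mult = (*), one = 1, zero = 0, add = (+)\<rparr>"

definition sconst :: "coeff \<Rightarrow> scalar" where
  "sconst c = Poly_Mapping.single 0 c"

definition pvar :: "svar \<Rightarrow> scalar" where
  "pvar v = Poly_Mapping.single (Poly_Mapping.single v 1) 1"

text \<open>
  The operator \<open>f(u) \<mapsto> f(P u)\<close> multiplies a monomial by \<open>P\<^sup>d\<close>, where \<open>d\<close> is its degree in \<open>u\<close>.
\<close>

definition T_op :: "coeff \<Rightarrow> svar \<Rightarrow> scalar \<Rightarrow> scalar" where
  "T_op P u f = Poly_Mapping.mapp (\<lambda>m c. c * P ^ Poly_Mapping.lookup m u) f"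

text \<open>
  The quotient of \<open>f(u) - f(P u)\<close> by \<open>(1 - P) u\<close>. It exists, and is unique if \<open>P \<noteq> 1\<close>,
  even when \<open>1 - P\<close> is not invertible in \<^typ>\<open>coeff\<close>, as for \<open>P = q\<^sup>2\<close>.
\<close>

definition jackson :: "coeff \<Rightarrow> svar \<Rightarrow> scalar \<Rightarrow> scalar" where
  "jackson P u f = (THE g. sconst (1 - P) * pvar u * g = f - T_op P u f)"

text \<open>
  The identification of polynomials with elements of the radial algebra, which sends \<open>r\<close> to
  \<open>x\<^sup>2\<close>, \<open>s\<^sub>i\<close> to \<open>{x, y\<^sub>i}\<close> and \<open>c\<^sub>i\<^sub>j\<close> to \<open>{y\<^sub>i, y\<^sub>j}\<close>. These elements are central, so the order
  of the factors chosen in the free algebra does not affect the class.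
\<close>

fun svar_rep :: "svar \<Rightarrow> free_elt" where
  "svar_rep SR = gen VX * gen VX"
| "svar_rep (SS i) = acomm (gen VX) (gen (VY i))"
| "svar_rep (SC i j) = acomm (gen (VY i)) (gen (VY j))"

definition emb :: "nat set \<Rightarrow> scalar \<Rightarrow> free_elt set" where
  "emb L f = cls L (\<Sum>m\<in>Poly_Mapping.keys f. free_const (Poly_Mapping.lookup f m) *
     prod_list (map (\<lambda>v. svar_rep v ^ Poly_Mapping.lookup m v) (svar_list L)))"

definition sc_deriv :: "nat set \<Rightarrow> scalar \<Rightarrow> free_elt set" where
  "sc_deriv L A =
     (emb L (sconst (1 + q)) \<otimes>\<^bsub>RA L\<^esub> cls L (gen VX) \<otimes>\<^bsub>RA L\<^esub> emb L (jackson (q\<^sup>2) SR A))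
     \<oplus>\<^bsub>RA L\<^esub>
     (emb L (sconst 2) \<otimes>\<^bsub>RA L\<^esub>
       finsum (RA L)
         (\<lambda>i. cls L (gen (VY i)) \<otimes>\<^bsub>RA L\<^esub> emb L (T_op (q\<^sup>2) SR (jackson q (SS i) A))) L)"


section \<open>The relative right derivative\<close>

definition combine ::
  "nat set \<Rightarrow> (nat set \<Rightarrow> free_elt set) \<Rightarrow> (nat set \<Rightarrow> free_elt set) \<Rightarrow> free_elt set" where
  "combine L f g = finsum (RA L) f (Pow L) \<oplus>\<^bsub>RA L\<^esub> finsum (RA L) g (Pow L)"

text \<open>
  The linear operator prescribed on the summands \<open>y\<^sub>I A\<close> and \<open>(x \<and> y\<^sub>I) B\<close>: an element is
  decomposed along the free basis of the radial algebra over its scalar subalgebra, and the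
  prescribed values of the summands are added.
\<close>

definition right_deriv :: "nat set \<Rightarrow> free_elt set \<Rightarrow> free_elt set" where
  "right_deriv L F = (THE G. \<exists>A B.
     A \<in> Pow L \<rightarrow> A_set L \<and> B \<in> Pow L \<rightarrow> A_set L \<and>
     F = combine L
       (\<lambda>I. y_wedge L I \<otimes>\<^bsub>RA L\<^esub> emb L (A I))
       (\<lambda>I. xy_wedge L I \<otimes>\<^bsub>RA L\<^esub> emb L (B I)) \<and>
     G = combine L
       (\<lambda>I. y_wedge L I \<otimes>\<^bsub>RA L\<^esub> sc_deriv L (A I))
       (\<lambda>I. (emb L (sconst ((-1) ^ card I * qnum_m (- int (card I))))
               \<otimes>\<^bsub>RA L\<^esub> y_wedge L I \<otimes>\<^bsub>RA L\<^esub> emb L (B I))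
            \<oplus>\<^bsub>RA L\<^esub>
            (emb L (sconst (qpow_m (- int (card I))))
               \<otimes>\<^bsub>RA L\<^esub> xy_wedge L I \<otimes>\<^bsub>RA L\<^esub> sc_deriv L (B I))))"

definition K_op :: "nat set \<Rightarrow> free_elt set \<Rightarrow> free_elt set" where
  "K_op L F = right_deriv L (F \<otimes>\<^bsub>RA L\<^esub> cls L (gen VX))"


section \<open>Modules, quotients and determinants\<close>

definition quotient_module ::
  "('r, 'm) module \<Rightarrow> 'm set \<Rightarrow> ('r, 'm set) module" where
  "quotient_module M N =
    \<lparr>carrier = a_rcosets\<^bsub>M\<^esub> N, monoid.mult = undefined, one = undefined,
     zero = N, add = set_add M,
     module.smult = (\<lambda>t C. \<Union>F\<in>C. N +>\<^bsub>M\<^esub> (t \<odot>\<^bsub>M\<^esub> F))\<rparr>"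

definition induced_map :: "('r, 'm) module \<Rightarrow> 'm set \<Rightarrow> ('m \<Rightarrow> 'm) \<Rightarrow> 'm set \<Rightarrow> 'm set" where
  "induced_map M N f C = (\<Union>F\<in>C. N +>\<^bsub>M\<^esub> f F)"

definition module_endos :: "'r ring \<Rightarrow> ('r, 'm) module \<Rightarrow> ('m \<Rightarrow> 'm) set" where
  "module_endos R M = {f \<in> carrier M \<rightarrow> carrier M.
     (\<forall>u\<in>carrier M. \<forall>v\<in>carrier M. f (u \<oplus>\<^bsub>M\<^esub> v) = f u \<oplus>\<^bsub>M\<^esub> f v) \<and>
     (\<forall>t\<in>carrier R. \<forall>u\<in>carrier M. f (t \<odot>\<^bsub>M\<^esub> u) = t \<odot>\<^bsub>M\<^esub> f u)}"

text \<open>Coordinates with respect to a finite basis \<open>e b\<close>, \<open>b \<in> Bs\<close>.\<close>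

definition coords ::
  "'r ring \<Rightarrow> ('r, 'm) module \<Rightarrow> ('b \<Rightarrow> 'm) \<Rightarrow> 'b set \<Rightarrow> 'm \<Rightarrow> 'b \<Rightarrow> 'r" where
  "coords R M e Bs v =
     (THE c. c \<in> Bs \<rightarrow>\<^sub>E carrier R \<and> v = finsum M (\<lambda>b. c b \<odot>\<^bsub>M\<^esub> e b) Bs)"

text \<open>
  Determinant of an endomorphism of a free module with finite basis \<open>e b\<close>, \<open>b \<in> Bs\<close>. The
  enumeration of the basis is immaterial. The record operations of \<open>R\<close> are assumed to
  be those of the ambient type.
\<close>

definition endo_det ::
  "'r::comm_ring_1 ring \<Rightarrow> ('r, 'm) module \<Rightarrow> ('b \<Rightarrow> 'm) \<Rightarrow> 'b set \<Rightarrow> ('m \<Rightarrow> 'm) \<Rightarrow> 'r" where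
  "endo_det R M e Bs f =
     (let bs = (SOME bs. distinct bs \<and> set bs = Bs); n = length bs
      in Determinant.det (mat n n (\<lambda>(i, j). coords R M e Bs (f (e (bs ! j))) (bs ! i))))"


section \<open>Homogeneous blocks and the support filtration\<close>

text \<open>\<open>BY I a \<beta>\<close> and \<open>BXY I a \<beta>\<close> index the basis monomials \<open>y\<^sub>I r\<^sup>a s\<^sup>\<beta>\<close> and
  \<open>(x \<and> y\<^sub>I) r\<^sup>a s\<^sup>\<beta>\<close>.\<close>

datatype bmon = BY "nat set" nat "nat \<Rightarrow>\<^sub>0 nat" | BXY "nat set" nat "nat \<Rightarrow>\<^sub>0 nat"

definition mdeg :: "(nat \<Rightarrow>\<^sub>0 nat) \<Rightarrow> nat" where
  "mdeg \<beta> = (\<Sum>i\<in>Poly_Mapping.keys \<beta>. Poly_Mapping.lookup \<beta> i)"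

fun xdeg :: "bmon \<Rightarrow> nat" where
  "xdeg (BY I a \<beta>) = 2 * a + mdeg \<beta>"
| "xdeg (BXY I a \<beta>) = 1 + 2 * a + mdeg \<beta>"

fun xsupp :: "bmon \<Rightarrow> nat set" where
  "xsupp (BY I a \<beta>) = I \<union> Poly_Mapping.keys \<beta>"
| "xsupp (BXY I a \<beta>) = I \<union> Poly_Mapping.keys \<beta>"

definition rs_monom :: "nat \<Rightarrow> (nat \<Rightarrow>\<^sub>0 nat) \<Rightarrow> scalar" where
  "rs_monom a \<beta> =
     pvar SR ^ a * (\<Prod>i\<in>Poly_Mapping.keys \<beta>. pvar (SS i) ^ Poly_Mapping.lookup \<beta> i)"

fun bas :: "nat set \<Rightarrow> bmon \<Rightarrow> free_elt set" where
  "bas L (BY I a \<beta>) = y_wedge L I \<otimes>\<^bsub>RA L\<^esub> emb L (rs_monom a \<beta>)"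
| "bas L (BXY I a \<beta>) = xy_wedge L I \<otimes>\<^bsub>RA L\<^esub> emb L (rs_monom a \<beta>)"

definition bmons_within :: "nat \<Rightarrow> nat set \<Rightarrow> bmon set" where
  "bmons_within k J = {b. xdeg b = k \<and> xsupp b \<subseteq> J}"

definition bmons_exact :: "nat \<Rightarrow> nat set \<Rightarrow> bmon set" where
  "bmons_exact k J = {b. xdeg b = k \<and> xsupp b = J}"

definition RA_module :: "nat set \<Rightarrow> (scalar, free_elt set) module" where
  "RA_module L =
    \<lparr>carrier = carrier (RA L), monoid.mult = monoid.mult (RA L),
     one = one (RA L), zero = zero (RA L), add = add (RA L), module.smult = (\<lambda>t F. F \<otimes>\<^bsub>RA L\<^esub> emb L t)\<rparr>"

definition Filt :: "nat set \<Rightarrow> nat \<Rightarrow> nat set \<Rightarrow> free_elt set set" where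
  "Filt L k J =
     {finsum (RA_module L) (\<lambda>b. t b \<odot>\<^bsub>RA_module L\<^esub> bas L b) (bmons_within k J) | t.
        t \<in> bmons_within k J \<rightarrow> carrier (T_ring L)}"

definition Filt_module :: "nat set \<Rightarrow> nat \<Rightarrow> nat set \<Rightarrow> (scalar, free_elt set) module" where
  "Filt_module L k J = (RA_module L)\<lparr>carrier := Filt L k J\<rparr>"

definition H_module :: "nat set \<Rightarrow> nat \<Rightarrow> (scalar, free_elt set) module" where
  "H_module L k = Filt_module L k L"

definition Filt_below :: "nat set \<Rightarrow> nat \<Rightarrow> nat set \<Rightarrow> free_elt set set" where
  "Filt_below L k J = {finsum (RA_module L) g {J'. J' \<subset> J} | g. g \<in> Pi {J'. J' \<subset> J} (Filt L k)}"

definition gr_module :: "nat set \<Rightarrow> nat \<Rightarrow> nat set \<Rightarrow> (scalar, free_elt set set) module" where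
  "gr_module L k J = quotient_module (Filt_module L k J) (Filt_below L k J)"

definition gr_cls :: "nat set \<Rightarrow> nat \<Rightarrow> nat set \<Rightarrow> free_elt set \<Rightarrow> free_elt set set" where
  "gr_cls L k J F = Filt_below L k J +>\<^bsub>Filt_module L k J\<^esub> F"

definition gr_K :: "nat set \<Rightarrow> nat \<Rightarrow> nat set \<Rightarrow> free_elt set set \<Rightarrow> free_elt set set" where
  "gr_K L k J = induced_map (Filt_module L k J) (Filt_below L k J) (K_op L)"

definition D_det :: "nat set \<Rightarrow> nat \<Rightarrow> scalar" where
  "D_det L k = endo_det (T_ring L) (H_module L k) (bas L) (bmons_within k L) (K_op L)"

definition D_gr :: "nat set \<Rightarrow> nat \<Rightarrow> nat set \<Rightarrow> scalar" where
  "D_gr L k J = endo_det (T_ring L) (gr_module L k J)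
     (\<lambda>b. gr_cls L k J (bas L b)) (bmons_exact k J) (gr_K L k J)"

end

theory Submission
  imports Defs "HOL-Library.Nat_Bijection" "HOL-Library.Function_Algebras"
begin

text \<open>
  The formulas for the operator only make sense because the radial algebra is free over its
  scalars, so freeness has to be proved. The radial algebra acts on the space of families of
  scalars indexed by sets of variables, the exterior algebra, where a variable acts by exterior
  multiplication plus contraction with half the anticommutator. A wedge product applied to the
  vacuum gives the corresponding basis vector, because the contractions are symmetric and cancel
  in the antisymmetrised product; this yields linear independence. Wedges span, because modulo
  shorter words the letters of a word anticommute.

  In these coordinates right multiplication by \<open>x\<close> and the derivative are explicit. They involve
  only contractions and Jackson operators in variables that are already present, so they preserve
  supports, and their matrix entries do not depend on the ambient set of variables. Ordering the
  monomials by support makes the matrix of the operator block triangular, with the exact-support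
  blocks on the diagonal.
\<close>

text \<open>The variables act from the right. The operator multiplies by x on the right and the
  scalars stand to the right of the wedges, so the coordinates of a product are found by letting its
  second factor act on the coordinates of the first. The factor one half has this origin: in the
  anticommutator of two Clifford operators the bilinear form appears twice, once for each order. The
  Jackson quotient, the right derivative and the coordinates are given by definite descriptions, so
  nothing can be computed from them before existence and uniqueness are known. For the first,
  uniqueness is cancellation in a domain; for the others it is linear independence. The model is
  built once, over a finite index set \<open>M\<close>, and every algebra with indices
  \<open>L\<close> inside \<open>M\<close> is read in it. Comparing the exact-support determinants
  of two algebras then needs no homomorphism between them: both become the determinant of one and
  the same matrix.\<close>

instance coeff :: idom
proof
  fix a b :: coeff
  show "a \<noteq> 0 \<Longrightarrow> b \<noteq> 0 \<Longrightarrow> a * b \<noteq> 0"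
    by transfer simp
qed

text \<open>A linear order on the variables makes \<^typ>\<open>scalar\<close> an integral domain, which the library
  requires for determinants of block triangular matrices.\<close>

fun svar_code :: "svar \<Rightarrow> nat" where
  "svar_code SR = 0"
| "svar_code (SS i) = Suc (prod_encode (0, i))"
| "svar_code (SC i j) = Suc (prod_encode (Suc i, j))"

lemma svar_code_eq_iff [simp]: "svar_code u = svar_code v \<longleftrightarrow> u = v"
  by (cases u; cases v) auto

instantiation svar :: linorder
begin
definition less_eq_svar :: "svar \<Rightarrow> svar \<Rightarrow> bool" where
  "u \<le> v \<longleftrightarrow> svar_code u \<le> svar_code v"
definition less_svar :: "svar \<Rightarrow> svar \<Rightarrow> bool" where
  "u < v \<longleftrightarrow> svar_code u < svar_code v"
instance
  by standard (auto simp: less_eq_svar_def less_svar_def)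
end

subsection \<open>Determinants over finite index sets\<close>

definition list_det :: "('b \<Rightarrow> 'b \<Rightarrow> 'r::comm_ring_1) \<Rightarrow> 'b list \<Rightarrow> 'r" where
  "list_det m bs = Determinant.det
     (mat (length bs) (length bs) (\<lambda>(i, j). m (bs ! i) (bs ! j)))"

text \<open>Reordering the list permutes rows and columns by the same permutation, so its sign
  enters twice and cancels.\<close>

lemma list_det_permute_list:
  assumes p: "p permutes {..<length bs}"
  shows "list_det m (permute_list p bs) = list_det m bs"
proof -
  let ?n = "length bs"
  let ?A = "mat ?n ?n (\<lambda>(i, j). m (bs ! i) (bs ! j))"
  let ?B = "mat ?n ?n (\<lambda>(i, j). ?A $$ (p i, j))"
  have p': "p permutes {0..<?n}" using p by (simp add: atLeast0LessThan)
  have lt: "p i < ?n" if "i < ?n" for i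
    using permutes_in_image[OF p, of i] that by simp
  have "transpose_mat (mat ?n ?n (\<lambda>(i, j). transpose_mat ?B $$ (p i, j)))
      = mat ?n ?n (\<lambda>(i, j). m (permute_list p bs ! i) (permute_list p bs ! j))"
    by (rule eq_matI) (auto simp: lt permute_list_nth[OF p])
  then have "list_det m (permute_list p bs)
      = Determinant.det (mat ?n ?n (\<lambda>(i, j). transpose_mat ?B $$ (p i, j)))"
    unfolding list_det_def length_permute_list
    by (metis det_transpose mat_carrier)
  also have "\<dots> = signof p * Determinant.det (transpose_mat ?B)"
    by (rule det_permute_rows[OF _ p']) simp
  also have "Determinant.det (transpose_mat ?B) = signof p * Determinant.det ?A"
    using det_permute_rows[OF mat_carrier p'] by (subst det_transpose[where n = ?n]) auto
  finally show ?thesis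
    by (simp add: list_det_def sign_def)
qed

lemma list_det_eq:
  assumes "distinct bs" "distinct cs" "set bs = set cs"
  shows "list_det m bs = list_det m cs"
proof -
  have "mset bs = mset cs"
    using assms set_eq_iff_mset_eq_distinct by blast
  then obtain p where "p permutes {..<length cs}" "permute_list p cs = bs"
    by (rule mset_eq_permutation)
  then show ?thesis using list_det_permute_list by blast
qed

text \<open>Rows are indexed by the first argument of \<open>m\<close>, so the hypothesis kills the
  lower left block: images of vectors in \<open>bs\<close> have no component along
  \<open>cs\<close>.\<close>

lemma list_det_append:
  fixes m :: "'b \<Rightarrow> 'b \<Rightarrow> 'r::idom"
  assumes "\<And>b c. b \<in> set bs \<Longrightarrow> c \<in> set cs \<Longrightarrow> m c b = 0"
  shows "list_det m (bs @ cs) = list_det m bs * list_det m cs"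
proof -
  let ?k = "length bs" and ?l = "length cs"
  let ?A = "mat ?k ?k (\<lambda>(i, j). m (bs ! i) (bs ! j))"
  let ?B = "mat ?k ?l (\<lambda>(i, j). m (bs ! i) (cs ! j))"
  let ?D = "mat ?l ?l (\<lambda>(i, j). m (cs ! i) (cs ! j))"
  have "mat (length (bs @ cs)) (length (bs @ cs)) (\<lambda>(i, j). m ((bs @ cs) ! i) ((bs @ cs) ! j))
      = four_block_mat ?A ?B (0\<^sub>m ?l ?k) ?D"
    by (rule eq_matI) (auto simp: nth_append assms)
  then show ?thesis
    unfolding list_det_def
    using det_four_block_mat_lower_left_zero[of ?A ?k ?B ?l "0\<^sub>m ?l ?k" ?D] by simp
qed

definition set_det :: "('b \<Rightarrow> 'b \<Rightarrow> 'r::comm_ring_1) \<Rightarrow> 'b set \<Rightarrow> 'r" where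
  "set_det m B = list_det m (SOME bs. distinct bs \<and> set bs = B)"

lemma set_det_set: "distinct bs \<Longrightarrow> set_det m (set bs) = list_det m bs"
  unfolding set_det_def by (rule someI2[of _ bs]) (auto intro: list_det_eq)

lemma set_det_Un:
  fixes m :: "'b \<Rightarrow> 'b \<Rightarrow> 'r::idom"
  assumes "finite B" "finite C" "B \<inter> C = {}" "\<And>b c. b \<in> B \<Longrightarrow> c \<in> C \<Longrightarrow> m c b = 0"
  shows "set_det m (B \<union> C) = set_det m B * set_det m C"
proof -
  obtain bs cs where "distinct bs" "set bs = B" "distinct cs" "set cs = C"
    using finite_distinct_list[OF assms(1)] finite_distinct_list[OF assms(2)] by blast
  then show ?thesis
    using assms set_det_set[of "bs @ cs" m] set_det_set[of bs m] set_det_set[of cs m]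
      list_det_append[of bs cs m] by auto
qed

text \<open>Induction on the size of the family, splitting off a maximal member J. If a column b
  with another label had a nonzero entry in a row labelled J, then J would be contained in the label
  of b, against maximality. Hence the block of J can be placed last.\<close>

lemma set_det_block_triangular:
  fixes m :: "'b \<Rightarrow> 'b \<Rightarrow> 'r::idom" and \<sigma> :: "'b \<Rightarrow> 'i set"
  assumes fin: "finite \<J>" "\<And>J. J \<in> \<J> \<Longrightarrow> finite J" "\<And>J. J \<in> \<J> \<Longrightarrow> finite {b \<in> B. \<sigma> b = J}"
    and tri: "\<And>b c. b \<in> B \<Longrightarrow> c \<in> B \<Longrightarrow> m c b \<noteq> 0 \<Longrightarrow> \<sigma> c \<subseteq> \<sigma> b"
  shows "set_det m {b \<in> B. \<sigma> b \<in> \<J>} = (\<Prod>J\<in>\<J>. set_det m {b \<in> B. \<sigma> b = J})"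
  using fin
proof (induction "card \<J>" arbitrary: \<J>)
  case 0
  then have "\<J> = {}" by simp
  then show ?case using set_det_set[of "[]" m] by (simp add: list_det_def)
next
  case (Suc n)
  from Suc.hyps(2) have "\<J> \<noteq> {}" by auto
  with finite_has_maximal[OF Suc.prems(1)] obtain J
    where J: "J \<in> \<J>" "\<And>J'. J' \<in> \<J> \<Longrightarrow> J \<subseteq> J' \<Longrightarrow> J = J'" by auto
  let ?\<J>' = "\<J> - {J}"
  have IH: "set_det m {b \<in> B. \<sigma> b \<in> ?\<J>'} = (\<Prod>J\<in>?\<J>'. set_det m {b \<in> B. \<sigma> b = J})"
    by (rule Suc.hyps(1)) (use Suc.prems Suc.hyps(2) J in \<open>auto simp: card_Diff_singleton\<close>)
  have "{b \<in> B. \<sigma> b \<in> ?\<J>'} = (\<Union>J\<in>?\<J>'. {b \<in> B. \<sigma> b = J})" by auto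
  then have f: "finite {b \<in> B. \<sigma> b \<in> ?\<J>'}" using Suc.prems by auto
  have "{b \<in> B. \<sigma> b \<in> \<J>} = {b \<in> B. \<sigma> b \<in> ?\<J>'} \<union> {b \<in> B. \<sigma> b = J}" using J by auto
  then have "set_det m {b \<in> B. \<sigma> b \<in> \<J>}
      = set_det m {b \<in> B. \<sigma> b \<in> ?\<J>'} * set_det m {b \<in> B. \<sigma> b = J}"
    using f Suc.prems(3)[OF J(1)] by (simp only:, intro set_det_Un) (use tri J in fastforce)+
  then show ?case
    using IH J Suc.prems(1) by (simp add: prod.remove mult.commute)
qed

subsection \<open>Linear extension\<close>

text \<open>The coefficient is passed to \<open>h\<close> instead of being multiplied with a value
  of \<open>h\<close>, because the codomain is only an additive monoid: it will be a function space,
  a free algebra or the natural numbers.\<close>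

definition linext :: "('a \<Rightarrow> 'b \<Rightarrow> 'c) \<Rightarrow> ('a \<Rightarrow>\<^sub>0 'b::zero) \<Rightarrow> 'c::comm_monoid_add" where
  "linext h f = (\<Sum>m\<in>Poly_Mapping.keys f. h m (Poly_Mapping.lookup f m))"

lemma linext_superset:
  assumes "finite K" "Poly_Mapping.keys f \<subseteq> K" "\<And>m. h m 0 = 0"
  shows "linext h f = (\<Sum>m\<in>K. h m (Poly_Mapping.lookup f m))"
  unfolding linext_def
  by (rule sum.mono_neutral_left) (use assms in \<open>auto simp: in_keys_iff\<close>)

lemma linext_0 [simp]: "linext h 0 = 0"
  by (simp add: linext_def)

lemma linext_single:
  assumes "\<And>m. h m 0 = 0"
  shows "linext h (Poly_Mapping.single m c) = h m c"
  using assms linext_superset[of "{m}" "Poly_Mapping.single m c" h] by simp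

lemma linext_add:
  assumes "\<And>m. h m 0 = 0" "\<And>m a b. h m (a + b) = h m a + h m b"
  shows "linext h (f + g) = linext h f + linext h g"
proof -
  let ?K = "Poly_Mapping.keys f \<union> Poly_Mapping.keys g"
  have "linext h (f + g) = (\<Sum>m\<in>?K. h m (Poly_Mapping.lookup (f + g) m))"
    by (rule linext_superset) (use assms keys_add[of f g] in auto)
  also have "\<dots> = (\<Sum>m\<in>?K. h m (Poly_Mapping.lookup f m)) + (\<Sum>m\<in>?K. h m (Poly_Mapping.lookup g m))"
    by (simp add: lookup_add assms sum.distrib)
  also have "\<dots> = linext h f + linext h g"
    by (intro arg_cong2[where f = "(+)"] linext_superset[symmetric]) (use assms in auto)
  finally show ?thesis .
qed

lemma poly_mapping_sum_single:
  "(\<Sum>m\<in>Poly_Mapping.keys f. Poly_Mapping.single m (Poly_Mapping.lookup f m)) = f"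
  by (rule poly_mapping_eqI)
    (simp add: lookup_sum lookup_single when_def in_keys_iff)

lemma poly_mapping_add_induct [case_names single add]:
  fixes f :: "'a \<Rightarrow>\<^sub>0 'b::comm_monoid_add"
  assumes single: "\<And>m c. P (Poly_Mapping.single m c)"
    and add: "\<And>f g. P f \<Longrightarrow> P g \<Longrightarrow> P (f + g)"
  shows "P f"
proof -
  have "P (\<Sum>m\<in>K. Poly_Mapping.single m (Poly_Mapping.lookup f m))" if "finite K" for K
    using that
  proof induction
    case empty
    show ?case using single[of undefined 0] by simp
  qed (simp add: single add)
  from this[of "Poly_Mapping.keys f"] show ?thesis
    by (simp add: poly_mapping_sum_single)
qed

subsection \<open>Jackson operators\<close>

lemma sconst_0 [simp]: "sconst 0 = 0"
  and sconst_1 [simp]: "sconst 1 = 1"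
  and sconst_add: "sconst (a + b) = sconst a + sconst b"
  and sconst_mult: "sconst (a * b) = sconst a * sconst b"
  by (simp_all add: sconst_def single_add mult_single)

lemma sconst_eq_0_iff [simp]: "sconst a = 0 \<longleftrightarrow> a = 0"
  unfolding sconst_def by (metis lookup_single_eq lookup_zero single_zero)

lemma pvar_neq_0 [simp]: "pvar u \<noteq> 0"
  unfolding pvar_def by (metis lookup_single_eq lookup_zero zero_neq_one)

lemma lookup_T_op [simp]:
  "Poly_Mapping.lookup (T_op P u f) m = Poly_Mapping.lookup f m * P ^ Poly_Mapping.lookup m u"
  by (simp add: T_op_def lookup_mapp when_def in_keys_iff)

lemma T_op_add: "T_op P u (f + g) = T_op P u f + T_op P u g"
  by (rule poly_mapping_eqI) (simp add: lookup_add algebra_simps)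

lemma T_op_0 [simp]: "T_op P u 0 = 0"
  by (rule poly_mapping_eqI) simp

lemma T_op_single:
  "T_op P u (Poly_Mapping.single m c) = Poly_Mapping.single m (c * P ^ Poly_Mapping.lookup m u)"
  by (rule poly_mapping_eqI) (simp add: lookup_single when_def)

lemma T_op_mult: "T_op P u (f * g) = T_op P u f * T_op P u g"
proof (induction f rule: poly_mapping_add_induct)
  case (single m c)
  show ?case
    by (induction g rule: poly_mapping_add_induct)
      (simp_all add: mult_single T_op_single T_op_add lookup_add power_add algebra_simps)
qed (simp add: T_op_add algebra_simps)

lemma T_op_id:
  assumes "\<And>m. m \<in> Poly_Mapping.keys f \<Longrightarrow> Poly_Mapping.lookup m u = 0"
  shows "T_op P u f = f"
  by (rule poly_mapping_eqI) (use assms in \<open>force simp: in_keys_iff\<close>)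

lemma keys_T_op: "Poly_Mapping.keys (T_op P u f) \<subseteq> Poly_Mapping.keys f"
  by (auto simp: in_keys_iff)

text \<open>The quotient in \<^const>\<open>jackson\<close> sends \<open>u\<^sup>d\<close> to \<open>(1 + P + \<dots> + P\<^bsup>d-1\<^esup>) u\<^bsup>d-1\<^esup>\<close>; for \<open>d = 0\<close> the sum is
  empty, so the truncated exponent is harmless.\<close>

definition jack :: "coeff \<Rightarrow> svar \<Rightarrow> scalar \<Rightarrow> scalar" where
  "jack P u = linext (\<lambda>m c. Poly_Mapping.single (m - Poly_Mapping.single u 1)
     (c * (\<Sum>i<Poly_Mapping.lookup m u. P ^ i)))"

lemma jack_add: "jack P u (f + g) = jack P u f + jack P u g"
  unfolding jack_def by (rule linext_add) (simp_all add: algebra_simps flip: single_add)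

lemma jack_0: "jack P u 0 = 0"
  by (simp add: jack_def)

lemma jack_spec: "sconst (1 - P) * pvar u * jack P u f = f - T_op P u f"
proof (induction f rule: poly_mapping_add_induct)
  case (single m c)
  have j: "jack P u (Poly_Mapping.single m c) = Poly_Mapping.single (m - Poly_Mapping.single u 1)
     (c * (\<Sum>i<Poly_Mapping.lookup m u. P ^ i))"
    unfolding jack_def by (rule linext_single) simp
  show ?case
  proof (cases "Poly_Mapping.lookup m u = 0")
    case True
    then show ?thesis by (simp add: j T_op_single)
  next
    case False
    \<comment> \<open>Here u divides the monomial, so the subtraction of exponents is not
      truncated.\<close>
    have m: "Poly_Mapping.single u 1 + (m - Poly_Mapping.single u 1) = m"
      by (rule poly_mapping_eqI)
        (use False in \<open>auto simp: lookup_add lookup_minus lookup_single when_def\<close>)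
    have "sconst (1 - P) * pvar u * jack P u (Poly_Mapping.single m c)
       = Poly_Mapping.single (Poly_Mapping.single u 1 + (m - Poly_Mapping.single u 1))
           ((1 - P) * (c * (\<Sum>i<Poly_Mapping.lookup m u. P ^ i)))"
      by (simp add: j sconst_def pvar_def mult_single)
    also have "\<dots> = Poly_Mapping.single m (c * (1 - P ^ Poly_Mapping.lookup m u))"
      unfolding m by (simp only: one_diff_power_eq) (simp add: algebra_simps)
    finally show ?thesis
      by (simp add: T_op_single algebra_simps flip: single_diff)
  qed
next
  case (add f g)
  show ?case
    by (simp only: jack_add T_op_add distrib_left add) (simp add: algebra_simps)
qed

text \<open>\<open>jack\<close> satisfies the description of the quotient; any other solution agrees
  with it because (1 - P) u can be cancelled in the domain of scalars.\<close>

lemma jackson_eq_jack: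
  assumes "P \<noteq> 1"
  shows "jackson P u f = jack P u f"
  unfolding jackson_def
proof (rule the_equality)
  fix g assume "sconst (1 - P) * pvar u * g = f - T_op P u f"
  then have "(sconst (1 - P) * pvar u) * g = (sconst (1 - P) * pvar u) * jack P u f"
    by (simp add: jack_spec)
  then show "g = jack P u f" using assms by simp
qed (rule jack_spec)

text \<open>After multiplication by (1 - P) u the quotient becomes f - \<open>T_op P u f\<close>,
  and \<open>T_op\<close> is multiplicative and fixes t; then the factor is cancelled.\<close>

lemma jack_mult_const:
  assumes "P \<noteq> 1" and t: "\<And>m. m \<in> Poly_Mapping.keys t \<Longrightarrow> Poly_Mapping.lookup m u = 0"
  shows "jack P u (t * f) = t * jack P u f"
proof -
  have "(sconst (1 - P) * pvar u) * jack P u (t * f) = t * f - T_op P u (t * f)"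
    by (rule jack_spec)
  also have "\<dots> = t * (f - T_op P u f)"
    by (simp add: T_op_mult T_op_id[OF t] algebra_simps)
  also have "\<dots> = (sconst (1 - P) * pvar u) * (t * jack P u f)"
    by (simp add: algebra_simps flip: jack_spec)
  finally show ?thesis using assms by simp
qed

text \<open>A monomial of degree 0 in u receives the empty sum as coefficient, so a surviving
  monomial comes from one that contains u, and the exponent drops by exactly one.\<close>

lemma keys_jack:
  assumes "n \<in> Poly_Mapping.keys (jack P u f)"
  obtains m where "m \<in> Poly_Mapping.keys f" "m = n + Poly_Mapping.single u 1"
proof -
  have "n \<in> (\<Union>m\<in>Poly_Mapping.keys f. Poly_Mapping.keys
      (Poly_Mapping.single (m - Poly_Mapping.single u 1)
        (Poly_Mapping.lookup f m * (\<Sum>i<Poly_Mapping.lookup m u. P ^ i))))"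
    using assms[unfolded jack_def linext_def] by (rule subsetD[OF keys_sum])
  then obtain m where m: "m \<in> Poly_Mapping.keys f" "n = m - Poly_Mapping.single u 1"
    "(\<Sum>i<Poly_Mapping.lookup m u. P ^ i) \<noteq> 0"
    by (auto split: if_splits)
  from m(3) have "Poly_Mapping.lookup m u \<noteq> 0"
    by (intro notI) simp
  have "m = n + Poly_Mapping.single u 1"
    by (rule poly_mapping_eqI)
      (use m(2) \<open>Poly_Mapping.lookup m u \<noteq> 0\<close> in \<open>auto simp: lookup_add lookup_minus lookup_single when_def\<close>)
  with m(1) that show thesis by blast
qed

section \<open>Nontriviality of q and the real constants of the coefficient ring\<close>

lemma q_neq_1: "q \<noteq> 1" and q_neq_minus_1: "q \<noteq> - 1"
  by (simp_all flip: Rep_coeff_inject add: q.rep_eq one_coeff.rep_eq uminus_coeff.rep_eq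
      rf_q_def One_fract_def eq_fract one_pCons)

lemma q_sq_neq_1: "q\<^sup>2 \<noteq> 1"
  using q_neq_1 q_neq_minus_1 by (simp add: power2_eq_1_iff)

lemma real_coeff_mult: "real_coeff (a * b) = real_coeff a * real_coeff b"
  by transfer (simp add: rf_real_def)

lemma real_coeff_add: "real_coeff (a + b) = real_coeff a + real_coeff b"
  by transfer (simp add: rf_real_def)

lemma real_coeff_1 [simp]: "real_coeff 1 = 1"
  by transfer (simp add: rf_real_def One_fract_def one_pCons)

lemma real_coeff_0 [simp]: "real_coeff 0 = 0"
  by transfer (simp add: rf_real_def Zero_fract_def)

lemma real_coeff_of_nat: "real_coeff (of_nat n) = of_nat n"
  by (induction n) (simp_all add: real_coeff_add)

lemma real_coeff_half: "real_coeff (1/2) * 2 = 1"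
  using real_coeff_mult[of "1/2" 2] real_coeff_of_nat[of 2] by simp

lemma real_coeff_inv_fact: "real_coeff (1 / fact n) * of_nat (fact n) = 1"
proof -
  have "real_coeff (1 / fact n * of_nat (fact n)) = 1" by simp
  then show ?thesis by (simp only: real_coeff_mult real_coeff_of_nat)
qed

subsection \<open>Weights of monomials\<close>

text \<open>This is the x-degree: r is quadratic in x, s_i is linear, c_ij is free of x.\<close>

fun wt :: "svar \<Rightarrow> nat" where
  "wt SR = 2" | "wt (SS i) = 1" | "wt (SC i j) = 0"

definition mwt :: "(svar \<Rightarrow>\<^sub>0 nat) \<Rightarrow> nat" where
  "mwt = linext (\<lambda>v n. n * wt v)"

lemma mwt_0 [simp]: "mwt 0 = 0" by (simp add: mwt_def)

lemma mwt_add [simp]: "mwt (m + n) = mwt m + mwt n"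
  unfolding mwt_def by (rule linext_add) (simp_all add: algebra_simps)

lemma mwt_single [simp]: "mwt (Poly_Mapping.single v n) = n * wt v"
  unfolding mwt_def by (rule linext_single) simp

lemma keys_add_nat: "Poly_Mapping.keys (m + n) = Poly_Mapping.keys m \<union> Poly_Mapping.keys n"
  for m n :: "'a \<Rightarrow>\<^sub>0 nat"
  by (auto simp: in_keys_iff lookup_add)

lemma keys_mult_polys:
  assumes "m \<in> Poly_Mapping.keys (f * g)"
  obtains a b where "a \<in> Poly_Mapping.keys f" "b \<in> Poly_Mapping.keys g" "m = a + b"
  using assms keys_mult[of f g] by blast

lemma polys_in_0 [simp]: "0 \<in> polys_in V" by (simp add: polys_in_def)
lemma polys_in_1 [simp]: "1 \<in> polys_in V" by (simp add: polys_in_def)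
lemma polys_in_sconst [simp]: "sconst c \<in> polys_in V" by (simp add: polys_in_def sconst_def)
lemma polys_in_pvar: "v \<in> V \<Longrightarrow> pvar v \<in> polys_in V" by (simp add: polys_in_def pvar_def)
lemma polys_in_add: "f \<in> polys_in V \<Longrightarrow> g \<in> polys_in V \<Longrightarrow> f + g \<in> polys_in V"
  using keys_add[of f g] by (auto simp: polys_in_def)
lemma polys_in_uminus [simp]: "- f \<in> polys_in V \<longleftrightarrow> f \<in> polys_in V"
  by (simp add: polys_in_def in_keys_iff)
lemma polys_in_mult: "f \<in> polys_in V \<Longrightarrow> g \<in> polys_in V \<Longrightarrow> f * g \<in> polys_in V"
  unfolding polys_in_def by (fastforce elim!: keys_mult_polys simp: keys_add_nat)
lemma polys_in_mono: "V \<subseteq> W \<Longrightarrow> polys_in V \<subseteq> polys_in W"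
  by (auto simp: polys_in_def)
lemma polys_in_sum: "(\<And>i. i \<in> I \<Longrightarrow> f i \<in> polys_in V) \<Longrightarrow> sum f I \<in> polys_in V"
  by (induction I rule: infinite_finite_induct) (auto intro: polys_in_add)
lemma polys_in_prod: "(\<And>i. i \<in> I \<Longrightarrow> f i \<in> polys_in V) \<Longrightarrow> prod f I \<in> polys_in V"
  by (induction I rule: infinite_finite_induct) (auto intro: polys_in_mult)
lemma polys_in_det:
  assumes "\<And>i j. i < n \<Longrightarrow> j < n \<Longrightarrow> A $$ (i, j) \<in> polys_in V" "A \<in> carrier_mat n n"
  shows "Determinant.det A \<in> polys_in V"
proof -
  have s: "signof p \<in> polys_in V" for p by (simp add: sign_def)
  have lt: "p i < n" if "p permutes {0..<n}" "i < n" for p i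
    using permutes_in_image[OF that(1), of i] that(2) by simp
  show ?thesis
    unfolding det_def'[OF assms(2)]
    by (intro polys_in_sum polys_in_mult polys_in_prod s assms(1)) (auto intro: lt)
qed

subsection \<open>Alternating functions on lists\<close>

lemma permute_list_transpose:
  assumes "a < length xs" "b < length xs"
  shows "permute_list (transpose a b) xs = xs[a := xs ! b, b := xs ! a]"
  by (rule nth_equalityI)
    (use assms in \<open>auto simp: permute_list_def nth_list_update transpose_def\<close>)

lemma permute_list_transpose_compose:
  assumes "a < length xs" "b < length xs" "p permutes {..<length xs}"
  shows "permute_list (transpose a b \<circ> p) xs = permute_list p (xs[a := xs ! b, b := xs ! a])"
    and "permute_list (p \<circ> transpose a b) xs
      = (permute_list p xs)[a := permute_list p xs ! b, b := permute_list p xs ! a]"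
  using assms
  by (simp_all add: permute_list_compose permute_list_transpose permutes_swap_id)

text \<open>Alternation modulo an additive subgroup \<open>Z\<close>, for words of one fixed length
  n over U. It serves twice: with \<open>Z\<close> zero for products of creation operators, and with
  \<open>Z\<close> the span of the wedges, where the error of a swap is known to lie in
  \<open>Z\<close> only because shorter words were treated before. The latter use dictates the fixed
  length.\<close>

locale alternating_mod =
  fixes F :: "'a list \<Rightarrow> 'b::ring_1" and Z :: "'b set" and n :: nat and U :: "'a set"
  assumes zero: "0 \<in> Z" and add: "x \<in> Z \<Longrightarrow> y \<in> Z \<Longrightarrow> x + y \<in> Z" and uminus: "x \<in> Z \<Longrightarrow> - x \<in> Z"
    and swap: "\<And>as u v bs. set as \<subseteq> U \<Longrightarrow> u \<in> U \<Longrightarrow> v \<in> U \<Longrightarrow> set bs \<subseteq> U \<Longrightarrow>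
      length as + length bs + 2 = n \<Longrightarrow> F (as @ u # v # bs) + F (as @ v # u # bs) \<in> Z"
begin

lemma diff: "x \<in> Z \<Longrightarrow> y \<in> Z \<Longrightarrow> x - y \<in> Z"
  using add[of x "- y"] uminus[of y] by simp

lemma sign_mult: "x \<in> Z \<Longrightarrow> (-1) ^ k * x \<in> Z"
  by (cases "even k") (auto simp: uminus)

lemma move:
  assumes "set as \<subseteq> U" "u \<in> U" "set bs \<subseteq> U" "set cs \<subseteq> U" "length as + length bs + length cs + 1 = n"
  shows "F (as @ u # bs @ cs) - (-1) ^ length bs * F (as @ bs @ u # cs) \<in> Z"
  using assms
proof (induction bs arbitrary: as)
  case Nil
  then show ?case by (simp add: zero)
next
  case (Cons b bs)
  have "F ((as @ [b]) @ u # bs @ cs) - (-1) ^ length bs * F ((as @ [b]) @ bs @ u # cs) \<in> Z"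
    by (rule Cons.IH) (use Cons.prems in auto)
  moreover have "F (as @ u # b # bs @ cs) + F (as @ b # u # bs @ cs) \<in> Z"
    by (rule swap) (use Cons.prems in auto)
  ultimately have "(F (as @ u # b # bs @ cs) + F (as @ b # u # bs @ cs))
    - (F ((as @ [b]) @ u # bs @ cs) - (-1) ^ length bs * F ((as @ [b]) @ bs @ u # cs)) \<in> Z"
    by (rule diff[rotated])
  then show ?case by (simp add: algebra_simps)
qed

text \<open>In both words the first letter is moved across the middle block, at the cost of the same
  sign; the results differ by an adjacent swap.\<close>

lemma exchange:
  assumes "set as \<subseteq> U" "u \<in> U" "set bs \<subseteq> U" "v \<in> U" "set cs \<subseteq> U"
    "length as + length bs + length cs + 2 = n"
  shows "F (as @ u # bs @ v # cs) + F (as @ v # bs @ u # cs) \<in> Z"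
proof -
  let ?s = "(-1) ^ length bs :: 'b"
  have 1: "F (as @ u # bs @ v # cs) - ?s * F (as @ bs @ u # v # cs) \<in> Z"
    by (rule move) (use assms in auto)
  have 2: "F (as @ v # bs @ u # cs) - ?s * F (as @ bs @ v # u # cs) \<in> Z"
    by (rule move) (use assms in auto)
  have 3: "F ((as @ bs) @ u # v # cs) + F ((as @ bs) @ v # u # cs) \<in> Z"
    by (rule swap) (use assms in auto)
  from add[OF add[OF 1 2] sign_mult[OF 3, of "length bs"]] show ?thesis
    by (simp add: algebra_simps)
qed

lemma exchange_nth:
  assumes "length xs = n" "set xs \<subseteq> U" "a < n" "b < n" "a \<noteq> b"
  shows "F xs + F (xs[a := xs ! b, b := xs ! a]) \<in> Z"
  using assms(3-5)
proof (induction a b rule: linorder_wlog)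
  case (le a b)
  obtain d where d: "b = Suc (a + d)" using le less_imp_Suc_add[of a b] by auto
  let ?bs = "take d (drop (Suc a) xs)"
  have "xs = take a xs @ xs ! a # drop (Suc a) xs"
    using le assms by (simp add: id_take_nth_drop)
  also have "drop (Suc a) xs = ?bs @ xs ! b # drop (Suc b) xs"
    using id_take_nth_drop[of d "drop (Suc a) xs"] le assms d by (simp add: add.commute)
  finally have xs: "xs = take a xs @ xs ! a # ?bs @ xs ! b # drop (Suc b) xs" .
  have "(take a xs @ u # ?bs @ v # cs)[a := u', b := v'] = take a xs @ u' # ?bs @ v' # cs" for u v u' v' cs
    using le assms d by (simp add: list_update_append)
  from this[of "xs ! a" "xs ! b" "drop (Suc b) xs"] xs
  have eq: "xs[a := xs ! b, b := xs ! a] = take a xs @ xs ! b # ?bs @ xs ! a # drop (Suc b) xs"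
    by simp
  have "set ?bs \<subseteq> U" "set (take a xs) \<subseteq> U" "set (drop (Suc b) xs) \<subseteq> U"
    using assms(2) set_take_subset set_drop_subset by fastforce+
  moreover have "xs ! a \<in> U" "xs ! b \<in> U" using le assms by auto
  ultimately have "F (take a xs @ xs ! a # ?bs @ xs ! b # drop (Suc b) xs)
      + F (take a xs @ xs ! b # ?bs @ xs ! a # drop (Suc b) xs) \<in> Z"
    by (intro exchange) (use le assms d in auto)
  then show ?case unfolding eq using xs by simp
next
  case (sym a b)
  then show ?case by (simp add: list_update_swap)
qed

lemma permute:
  assumes "p permutes {..<n}" "length xs = n" "set xs \<subseteq> U"
  shows "F (permute_list p xs) - of_int (sign p) * F xs \<in> Z"
  using assms(1) finite_lessThan assms(2,3)
proof (induction p arbitrary: xs rule: permutes_induct)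
  case id
  then show ?case by (simp add: zero permute_list_id[unfolded id_def])
next
  case (swap a b p)
  let ?ys = "xs[a := xs ! b, b := xs ! a]"
  have ys: "length ?ys = n" "set ?ys \<subseteq> U"
    using swap.prems swap.hyps by (auto dest!: subsetD[OF set_update_subset_insert])
  have s: "sign (transpose a b \<circ> p) = - sign p"
    using swap.hyps by (simp add: sign_compose sign_swap_id permutation_swap_id
        permutation_permutes[of p] exI[of _ "{..<n}"])
  have t: "permute_list (transpose a b \<circ> p) xs = permute_list p ?ys"
    using swap.hyps swap.prems by (intro permute_list_transpose_compose) auto
  have e: "F xs + F ?ys \<in> Z"
    by (rule exchange_nth) (use swap in auto)
  have "of_int (sign p) * (F xs + F ?ys) \<in> Z"
    using e uminus[OF e] by (simp add: sign_def)
  from add[OF swap.IH[OF ys] this] show ?case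
    unfolding s t by (simp add: algebra_simps)
qed

end

text \<open>Composing with the transposition of a and b reverses the sign and leaves g unchanged, so
  the sum equals its own negative; doubling is injective.\<close>

lemma alternating_sum_symmetric:
  fixes g :: "'a list \<Rightarrow> 'b::ring_1"
  assumes two: "\<And>x::'b. x + x = 0 \<Longrightarrow> x = 0"
    and g: "\<And>xs. length xs = n \<Longrightarrow> set xs \<subseteq> U \<Longrightarrow> g (xs[a := xs ! b, b := xs ! a]) = g xs"
    and ab: "a < n" "b < n" "a \<noteq> b" and xs: "length xs = n" "set xs \<subseteq> U"
  shows "(\<Sum>p | p permutes {..<n}. of_int (sign p) * g (permute_list p xs)) = 0"
proof -
  let ?t = "transpose a b"
  let ?S = "\<Sum>p | p permutes {..<n}. of_int (sign p) * g (permute_list p xs)"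
  have "?S = (\<Sum>p | p permutes {..<n}. of_int (sign (p \<circ> ?t)) * g (permute_list (p \<circ> ?t) xs))"
    by (rule sum_permutations_compose_right) (use ab in \<open>auto intro: permutes_swap_id\<close>)
  also have "\<dots> = (\<Sum>p | p permutes {..<n}. - (of_int (sign p) * g (permute_list p xs)))"
  proof (rule sum.cong, simp)
    fix p assume "p \<in> {p. p permutes {..<n}}"
    then have p: "p permutes {..<n}" by simp
    have "sign (p \<circ> ?t) = - sign p"
      using p ab by (simp add: sign_compose sign_swap_id permutation_swap_id
          permutation_permutes[of p] exI[of _ "{..<n}"])
    moreover have "g (permute_list (p \<circ> ?t) xs) = g (permute_list p xs)"
      using g[of "permute_list p xs"] p ab xs by (simp add: permute_list_transpose_compose(2))
    ultimately show "of_int (sign (p \<circ> ?t)) * g (permute_list (p \<circ> ?t) xs)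
        = - (of_int (sign p) * g (permute_list p xs))" by simp
  qed
  finally have "?S + ?S = 0" by (simp only: sum_negf eq_neg_iff_add_eq_0)
  then show ?thesis by (rule two)
qed

subsection \<open>The Clifford model\<close>

lemma additive_sum:
  assumes "h 0 = 0" "\<And>x y. h (x + y) = h x + h y"
  shows "h (\<Sum>i\<in>I. f i) = (\<Sum>i\<in>I. h (f i))"
  by (induction I rule: infinite_finite_induct) (simp_all add: assms)

lemma sum_fun_apply: "(\<Sum>i\<in>I. f i) S = (\<Sum>i\<in>I. f i S)"
  by (rule additive_sum[of "\<lambda>\<phi>. \<phi> S"]) simp_all

text \<open>x comes before all y_i, as in the factors of \<open>xy_wedge\<close>; the letters of
  each wedge used below are then increasing.\<close>

fun vord :: "vvar \<Rightarrow> nat" where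
  "vord VX = 0" | "vord (VY i) = Suc i"

lemma vord_eq_iff [simp]: "vord u = vord v \<longleftrightarrow> u = v"
  by (cases u; cases v) auto

text \<open>The sign of moving \<open>v\<close> past the larger elements of \<open>S\<close>; \<open>U\<close> is finite,
  so that the cardinality is meaningful.\<close>

definition sg :: "vvar set \<Rightarrow> vvar \<Rightarrow> vvar set \<Rightarrow> scalar" where
  "sg U v S = (-1) ^ card {w \<in> S \<inter> U. vord v < vord w}"

text \<open>The factor by which \<open>sg U v\<close> changes when u enters or leaves the
  set.\<close>

definition eps :: "vvar \<Rightarrow> vvar \<Rightarrow> scalar" where
  "eps u v = (if vord v < vord u then -1 else 1)"

lemma sg_sq [simp]: "sg U v S * sg U v S = 1"
  by (simp add: sg_def flip: power_add mult_2)

lemma sg_sq' [simp]: "sg U v S * (sg U v S * x) = x"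
  by (simp flip: mult.assoc)

lemma eps_sq [simp]: "eps u v * eps u v = 1" "eps u v * (eps u v * x) = x"
  by (simp_all add: eps_def)

lemma eps_swap: "u \<noteq> v \<Longrightarrow> eps u v = - eps v u"
  using vord_eq_iff[of u v] by (auto simp: eps_def)

lemma sg_insert:
  assumes "finite U" "u \<in> U" "u \<notin> S"
  shows "sg U v (insert u S) = eps u v * sg U v S"
proof (cases "vord v < vord u")
  case True
  then have "{w \<in> insert u S \<inter> U. vord v < vord w} = insert u {w \<in> S \<inter> U. vord v < vord w}"
    using assms by auto
  then show ?thesis using assms True by (simp add: sg_def eps_def)
next
  case False
  then have "{w \<in> insert u S \<inter> U. vord v < vord w} = {w \<in> S \<inter> U. vord v < vord w}"
    using assms by auto
  then show ?thesis using False by (simp add: sg_def eps_def)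
qed

lemma sg_remove:
  assumes "finite U" "u \<in> U" "u \<in> S"
  shows "sg U v (S - {u}) = eps u v * sg U v S"
  using sg_insert[of U u "S - {u}" v] assms by (simp add: insert_absorb)

lemma sg_self [simp]: "sg U v (insert v S) = sg U v S" "sg U v (S - {v}) = sg U v S"
proof -
  have "{w \<in> insert v S \<inter> U. vord v < vord w} = {w \<in> S \<inter> U. vord v < vord w}"
    "{w \<in> (S - {v}) \<inter> U. vord v < vord w} = {w \<in> S \<inter> U. vord v < vord w}"
    by auto
  then show "sg U v (insert v S) = sg U v S" "sg U v (S - {v}) = sg U v S"
    by (simp_all add: sg_def)
qed

text \<open>Exterior multiplication by v from the right. A family lists the coefficients of the
  exterior basis vectors with increasing factors, so v, appended at the end, has to pass the larger
  elements of S.\<close>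

definition create :: "vvar set \<Rightarrow> vvar \<Rightarrow> (vvar set \<Rightarrow> scalar) \<Rightarrow> vvar set \<Rightarrow> scalar" where
  "create U v \<phi> = (\<lambda>S. if v \<in> S then sg U v S * \<phi> (S - {v}) else 0)"

text \<open>The transpose of \<open>create U v\<close>: it deletes v from the basis vectors that
  contain it, with the same sign.\<close>

definition annih :: "vvar set \<Rightarrow> vvar \<Rightarrow> (vvar set \<Rightarrow> scalar) \<Rightarrow> vvar set \<Rightarrow> scalar" where
  "annih U v \<phi> = (\<lambda>S. if v \<in> S then 0 else sg U v S * \<phi> (insert v S))"

text \<open>The scalar by which {u, v} has to act. For x with itself it is 2 r because {x, x} is
  twice the square of x; the indices of c are sorted since only \<open>SC i j\<close> with i \<le> j
  is used.\<close>

fun ac_var :: "vvar \<Rightarrow> vvar \<Rightarrow> scalar" where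
  "ac_var VX VX = sconst 2 * pvar SR"
| "ac_var VX (VY i) = pvar (SS i)"
| "ac_var (VY i) VX = pvar (SS i)"
| "ac_var (VY i) (VY j) = pvar (SC (min i j) (max i j))"

definition bform :: "vvar \<Rightarrow> vvar \<Rightarrow> scalar" where
  "bform u v = sconst (real_coeff (1/2)) * ac_var u v"

lemma ac_var_commute: "ac_var u v = ac_var v u"
  by (cases u; cases v) (simp_all add: min.commute max.commute)

lemma bform_commute: "bform u v = bform v u"
  by (simp add: bform_def ac_var_commute)

lemma sconst_half: "sconst (real_coeff (1/2)) + sconst (real_coeff (1/2)) = 1"
  using real_coeff_half by (metis mult_2 mult.commute sconst_add sconst_1)

lemma bform_add: "bform u v + bform v u = ac_var u v"
  unfolding bform_commute[of v u] unfolding bform_def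
  by (metis distrib_right mult_1 sconst_half)

lemma scalar_two_torsion:
  fixes x :: scalar
  assumes "x + x = 0"
  shows "x = 0"
proof -
  have "x = (sconst (real_coeff (1/2)) + sconst (real_coeff (1/2))) * x"
    by (simp only: sconst_half mult_1)
  also have "\<dots> = sconst (real_coeff (1/2)) * (x + x)" by (simp only: algebra_simps)
  finally show ?thesis using assms by simp
qed

text \<open>Contraction with the linear form that sends u to \<open>bform u v\<close>, expanded in
  the annihilation operators.\<close>

definition contract :: "vvar set \<Rightarrow> vvar \<Rightarrow> (vvar set \<Rightarrow> scalar) \<Rightarrow> vvar set \<Rightarrow> scalar" where
  "contract U v \<phi> = (\<lambda>S. \<Sum>u\<in>U. bform u v * annih U u \<phi> S)"

definition rho :: "vvar set \<Rightarrow> vvar \<Rightarrow> (vvar set \<Rightarrow> scalar) \<Rightarrow> vvar set \<Rightarrow> scalar" where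
  "rho U v \<phi> = create U v \<phi> + contract U v \<phi>"

lemma create_add: "create U v (\<phi> + \<psi>) = create U v \<phi> + create U v \<psi>"
  by (auto simp: create_def algebra_simps)

lemma annih_add: "annih U v (\<phi> + \<psi>) = annih U v \<phi> + annih U v \<psi>"
  by (auto simp: annih_def algebra_simps)

lemma contract_add: "contract U v (\<phi> + \<psi>) = contract U v \<phi> + contract U v \<psi>"
  by (auto simp: contract_def annih_add algebra_simps sum.distrib)

lemma rho_add: "rho U v (\<phi> + \<psi>) = rho U v \<phi> + rho U v \<psi>"
  by (simp add: rho_def create_add contract_add algebra_simps)

definition scale :: "scalar \<Rightarrow> (vvar set \<Rightarrow> scalar) \<Rightarrow> vvar set \<Rightarrow> scalar" where
  "scale c \<phi> = (\<lambda>S. c * \<phi> S)"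

lemma scale_simps [simp]:
  "scale c 0 = 0" "scale 0 \<phi> = 0" "scale 1 \<phi> = \<phi>" "scale a (scale b \<phi>) = scale (a * b) \<phi>"
  by (auto simp: scale_def mult.assoc)

lemma scale_add: "scale c (\<phi> + \<psi>) = scale c \<phi> + scale c \<psi>"
  by (auto simp: scale_def algebra_simps)

lemma scale_add_left: "scale (a + b) \<phi> = scale a \<phi> + scale b \<phi>"
  by (auto simp: scale_def algebra_simps)

lemma scale_sum: "scale c (\<Sum>i\<in>I. f i) = (\<Sum>i\<in>I. scale c (f i))"
  by (rule additive_sum[of "scale c"]) (simp_all add: scale_add)

lemma create_scale: "create U v (scale c \<phi>) = scale c (create U v \<phi>)"
  by (auto simp: create_def scale_def algebra_simps)

lemma annih_scale: "annih U v (scale c \<phi>) = scale c (annih U v \<phi>)"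
  by (auto simp: annih_def scale_def algebra_simps)

lemma contract_eq: "contract U v \<phi> = (\<Sum>u\<in>U. scale (bform u v) (annih U u \<phi>))"
  by (auto simp: contract_def sum_fun_apply scale_def)

lemma contract_scale: "contract U v (scale c \<phi>) = scale c (contract U v \<phi>)"
  by (simp add: contract_eq annih_scale scale_sum mult.commute)

lemma rho_scale: "rho U v (scale c \<phi>) = scale c (rho U v \<phi>)"
  by (simp add: rho_def create_scale contract_scale scale_add)

lemma create_0 [simp]: "create U v 0 = 0" using create_add[of U v 0 0] by simp
lemma annih_0 [simp]: "annih U v 0 = 0" using annih_add[of U v 0 0] by simp
lemma rho_0 [simp]: "rho U v 0 = 0" using rho_add[of U v 0 0] by simp

lemma create_sum: "create U v (\<Sum>i\<in>I. f i) = (\<Sum>i\<in>I. create U v (f i))"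
  by (rule additive_sum[of "create U v"]) (simp_all add: create_add)

lemma annih_sum: "annih U v (\<Sum>i\<in>I. f i) = (\<Sum>i\<in>I. annih U v (f i))"
  by (rule additive_sum[of "annih U v"]) (simp_all add: annih_add)

section \<open>Canonical anticommutation relations and the Clifford relation\<close>

context
  fixes U :: "vvar set"
  assumes fin: "finite U"
begin

text \<open>For distinct u and v exactly one of the two passes the other, so the two orders differ
  by the sign in \<open>eps_swap\<close>; for u = v both terms vanish. The same sign governs the two
  relations that follow.\<close>

lemma create_create:
  assumes "u \<in> U" "v \<in> U"
  shows "create U u (create U v \<phi>) + create U v (create U u \<phi>) = 0"
proof
  fix S
  have "S - {u} - {v} = S - {v} - {u}" by auto
  then show "(create U u (create U v \<phi>) + create U v (create U u \<phi>)) S = 0 S"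
    using assms eps_swap[of u v]
    by (auto simp: create_def sg_remove[OF fin])
qed

lemma annih_annih:
  assumes "u \<in> U" "v \<in> U"
  shows "annih U u (annih U v \<phi>) + annih U v (annih U u \<phi>) = 0"
proof
  fix S
  show "(annih U u (annih U v \<phi>) + annih U v (annih U u \<phi>)) S = 0 S"
    using assms eps_swap[of u v]
    by (auto simp: annih_def sg_insert[OF fin] insert_commute)
qed

lemma create_annih:
  assumes "u \<in> U" "v \<in> U"
  shows "create U u (annih U v \<phi>) + annih U v (create U u \<phi>) = (if u = v then \<phi> else 0)"
proof
  fix S
  show "(create U u (annih U v \<phi>) + annih U v (create U u \<phi>)) S = (if u = v then \<phi> else 0) S"
  proof (cases "u = v")
    case True
    then show ?thesis by (auto simp: create_def annih_def insert_absorb)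
  next
    case False
    then have "insert v (S - {u}) = insert v S - {u}" by auto
    then show ?thesis
      using False assms eps_swap[of u v]
      by (auto simp: create_def annih_def sg_insert[OF fin] sg_remove[OF fin])
  qed
qed

text \<open>Contraction is an antiderivation: the creation operator of u anticommutes with all
  annihilation operators except its own, and that one contributes the value of the form at u and
  v.\<close>

lemma contract_create:
  assumes "u \<in> U" "v \<in> U"
  shows "contract U v (create U u \<phi>) = scale (bform u v) \<phi> - create U u (contract U v \<phi>)"
proof -
  have "create U u (contract U v \<phi>) + contract U v (create U u \<phi>)
      = (\<Sum>w\<in>U. scale (bform w v) (create U u (annih U w \<phi>) + annih U w (create U u \<phi>)))"
    by (simp add: contract_eq create_sum create_scale scale_add sum.distrib)
  also have "\<dots> = (\<Sum>w\<in>U. if u = w then scale (bform u v) \<phi> else 0)"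
    by (rule sum.cong) (auto simp: create_annih assms)
  also have "\<dots> = scale (bform u v) \<phi>"
    using fin assms by simp
  finally show ?thesis by (simp add: algebra_simps)
qed

lemma contract_contract:
  "contract U u (contract U v \<phi>) + contract U v (contract U u \<phi>) = 0"
proof -
  have "contract U u (contract U v \<phi>)
      = (\<Sum>w\<in>U. \<Sum>z\<in>U. scale (bform w u * bform z v) (annih U w (annih U z \<phi>)))"
    by (simp add: contract_eq annih_sum annih_scale scale_sum)
  moreover have "contract U v (contract U u \<phi>)
      = (\<Sum>w\<in>U. \<Sum>z\<in>U. scale (bform w u * bform z v) (annih U z (annih U w \<phi>)))"
    by (subst sum.swap) (simp add: contract_eq annih_sum annih_scale scale_sum mult.commute)
  ultimately have "contract U u (contract U v \<phi>) + contract U v (contract U u \<phi>)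
      = (\<Sum>w\<in>U. \<Sum>z\<in>U. scale (bform w u * bform z v)
          (annih U w (annih U z \<phi>) + annih U z (annih U w \<phi>)))"
    by (simp add: scale_add sum.distrib)
  also have "\<dots> = 0"
    by (simp add: annih_annih)
  finally show ?thesis .
qed

text \<open>The two pure parts, creation with creation and contraction with contraction, cancel.
  Each of the two mixed pairs leaves one copy of \<open>bform\<close>, and the two copies add up to
  the anticommutator.\<close>

lemma rho_acomm:
  assumes "u \<in> U" "v \<in> U"
  shows "rho U u (rho U v \<phi>) + rho U v (rho U u \<phi>) = scale (ac_var u v) \<phi>"
proof -
  have "rho U u (rho U v \<phi>) + rho U v (rho U u \<phi>)
    = (create U u (create U v \<phi>) + create U v (create U u \<phi>))
    + (contract U u (contract U v \<phi>) + contract U v (contract U u \<phi>))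
    + (create U u (contract U v \<phi>) + contract U v (create U u \<phi>))
    + (create U v (contract U u \<phi>) + contract U u (create U v \<phi>))"
    by (simp add: rho_def create_add contract_add)
  also have "\<dots> = scale (bform u v) \<phi> + scale (bform v u) \<phi>"
    using create_create[OF assms, of \<phi>] contract_contract[of u v \<phi>] assms
    by (simp add: contract_create)
  also have "\<dots> = scale (ac_var u v) \<phi>"
    by (simp only: bform_add flip: scale_add_left)
  finally show ?thesis .
qed

end

text \<open>\<open>foldl\<close> lets the first letter act first, which makes the space of families
  a right module over words.\<close>

definition wact :: "vvar set \<Rightarrow> (vvar set \<Rightarrow> scalar) \<Rightarrow> vvar list \<Rightarrow> vvar set \<Rightarrow> scalar" where
  "wact U = foldl (\<lambda>\<phi> v. rho U v \<phi>)"

definition cact :: "vvar set \<Rightarrow> (vvar set \<Rightarrow> scalar) \<Rightarrow> vvar list \<Rightarrow> vvar set \<Rightarrow> scalar" where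
  "cact U = foldl (\<lambda>\<phi> v. create U v \<phi>)"

text \<open>An exterior basis vector; \<open>ev {}\<close> is the vacuum.\<close>

definition ev :: "vvar set \<Rightarrow> vvar set \<Rightarrow> scalar" where
  "ev S0 = (\<lambda>S. if S = S0 then 1 else 0)"

lemma wact_simps [simp]:
  "wact U \<phi> [] = \<phi>" "wact U \<phi> (v # w) = wact U (rho U v \<phi>) w"
  "wact U \<phi> (w @ w') = wact U (wact U \<phi> w) w'"
  by (simp_all add: wact_def)

lemma cact_simps [simp]:
  "cact U \<phi> [] = \<phi>" "cact U \<phi> (v # w) = cact U (create U v \<phi>) w"
  "cact U \<phi> (w @ w') = cact U (cact U \<phi> w) w'"
  by (simp_all add: cact_def)

lemma wact_add: "wact U (\<phi> + \<psi>) w = wact U \<phi> w + wact U \<psi> w"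
  by (induction w arbitrary: \<phi> \<psi>) (simp_all add: rho_add)

lemma wact_scale: "wact U (scale c \<phi>) w = scale c (wact U \<phi> w)"
  by (induction w arbitrary: \<phi>) (simp_all add: rho_scale)

lemma wact_0 [simp]: "wact U 0 w = 0"
  using wact_add[of U 0 0 w] by simp

lemma wact_sum: "wact U (\<Sum>i\<in>I. f i) w = (\<Sum>i\<in>I. wact U (f i) w)"
  by (rule additive_sum[of "\<lambda>\<phi>. wact U \<phi> w"]) (simp_all add: wact_add)

lemma cact_scale: "cact U (scale c \<phi>) w = scale c (cact U \<phi> w)"
  by (induction w arbitrary: \<phi>) (simp_all add: create_scale)

lemma contract_vac [simp]: "contract U v (ev {}) = 0"
proof -
  have "annih U u (ev {}) = 0" for u by (auto simp: annih_def ev_def)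
  then show ?thesis by (auto simp: contract_eq)
qed

text \<open>Iterated \<open>contract_create\<close>: to delete letter k the contraction passes the
  \<open>length ys - Suc k\<close> letters behind it, each with a sign, and at the end the vacuum
  kills it.\<close>

lemma contract_cact:
  assumes fin: "finite U" and "v \<in> U" "set ys \<subseteq> U"
  shows "contract U v (cact U (ev {}) ys) = (\<Sum>k<length ys.
     scale ((-1) ^ (length ys - Suc k) * bform (ys ! k) v)
       (cact U (ev {}) (take k ys @ drop (Suc k) ys)))"
  using assms(3)
proof (induction ys rule: rev_induct)
  case (snoc w ys)
  let ?E = "cact U (ev {})"
  have 1: "contract U v (?E (ys @ [w])) = scale (bform w v) (?E ys) - create U w (contract U v (?E ys))"
    using snoc.prems assms by (simp add: contract_create)
  have 2: "create U w (contract U v (?E ys)) = (\<Sum>k<length ys.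
     scale ((-1) ^ (length ys - Suc k) * bform (ys ! k) v)
       (?E (take k ys @ drop (Suc k) ys @ [w])))"
    using snoc by (simp add: create_sum create_scale)
  have 3: "- (\<Sum>k<length ys.
     scale ((-1) ^ (length ys - Suc k) * bform (ys ! k) v)
       (?E (take k ys @ drop (Suc k) ys @ [w]))) = (\<Sum>k<length ys.
     scale ((-1) ^ (length (ys @ [w]) - Suc k) * bform ((ys @ [w]) ! k) v)
       (?E (take k (ys @ [w]) @ drop (Suc k) (ys @ [w]))))"
    unfolding sum_negf[symmetric]
  proof (rule sum.cong)
    fix k assume "k \<in> {..<length ys}"
    then have k: "k < length ys" by simp
    then have "length (ys @ [w]) - Suc k = Suc (length ys - Suc k)" by simp
    then show "- scale ((-1) ^ (length ys - Suc k) * bform (ys ! k) v)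
       (?E (take k ys @ drop (Suc k) ys @ [w]))
      = scale ((-1) ^ (length (ys @ [w]) - Suc k) * bform ((ys @ [w]) ! k) v)
       (?E (take k (ys @ [w]) @ drop (Suc k) (ys @ [w])))"
      using k by (auto simp: scale_def nth_append fun_eq_iff simp del: cact_simps)
  qed simp
  show ?case
    unfolding 1 2 diff_conv_add_uminus 3 by (simp add: add.commute)
qed simp

lemma cact_sorted:
  assumes "finite U" "set us \<subseteq> U" "sorted_wrt (\<lambda>u v. vord u < vord v) us"
  shows "cact U (ev {}) us = ev (set us)"
  using assms(2,3)
proof (induction us rule: rev_induct)
  case (snoc v us)
  have "create U v (ev (set us)) S = ev (set (us @ [v])) S" for S
  proof (cases "S = set (us @ [v])")
    case True
    have "v \<notin> set us" using snoc.prems by (auto simp: sorted_wrt_append)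
    \<comment> \<open>The new letter exceeds all earlier ones, so it passes nothing and the sign is
      1.\<close>
    have none: "{w \<in> S \<inter> U. vord v < vord w} = {}"
      using snoc.prems True by (fastforce simp: sorted_wrt_append)
    have "sg U v S = 1" unfolding sg_def none by simp
    with \<open>v \<notin> set us\<close> show ?thesis using True by (simp add: create_def ev_def)
  next
    case False
    then show ?thesis by (auto simp: create_def ev_def)
  qed
  then show ?case using snoc by (auto simp: sorted_wrt_append)
qed simp

text \<open>Replacing creation operators by Clifford generators one position at a time does not change
  the antisymmetrised product: the contraction of positions \<open>k\<close> and \<open>j\<close> is symmetric in them.\<close>

lemma wact_antisym:
  assumes fin: "finite U" and us: "set us \<subseteq> U" "length us = n"
  shows "(\<Sum>p | p permutes {..<n}. of_int (sign p) * wact U (ev {}) (permute_list p us) S)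
    = (\<Sum>p | p permutes {..<n}. of_int (sign p) * cact U (ev {}) (permute_list p us) S)"
proof -
  let ?E = "cact U (ev {})"
  \<comment> \<open>In \<open>D j\<close> the first j letters act by creation alone and the others
    by Clifford operators; the two sides of the claim are \<open>D 0\<close> and
    \<open>D n\<close>.\<close>
  define D where "D j = (\<Sum>p | p permutes {..<n}. of_int (sign p) *
      wact U (?E (take j (permute_list p us))) (drop j (permute_list p us)) S)" for j
  have step: "D j = D (Suc j)" if j: "j < n" for j
  proof -
    \<comment> \<open>The term in which letter j is contracted against letter k, so that both
      disappear from the word.\<close>
    define g where "g k xs = (-1) ^ (j - Suc k) * bform (xs ! k) (xs ! j) *
       wact U (?E (take k xs @ drop (Suc k) (take j xs))) (drop (Suc j) xs) S" for k xs
    have split: "wact U (?E (take j xs)) (drop j xs) S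
        = wact U (?E (take (Suc j) xs)) (drop (Suc j) xs) S + (\<Sum>k<j. g k xs)"
      if xs: "length xs = n" "set xs \<subseteq> U" for xs
    proof -
      have d: "drop j xs = xs ! j # drop (Suc j) xs" using j xs by (simp add: Cons_nth_drop_Suc)
      have t: "take (Suc j) xs = take j xs @ [xs ! j]" using j xs by (simp add: take_Suc_conv_app_nth)
      have "contract U (xs ! j) (?E (take j xs)) = (\<Sum>k<j.
         scale ((-1) ^ (j - Suc k) * bform (xs ! k) (xs ! j))
           (?E (take k xs @ drop (Suc k) (take j xs))))"
        using j xs set_take_subset[of j xs]
        by (subst contract_cact[OF fin]) (auto intro!: sum.cong simp: min_def)
      then have "wact U (contract U (xs ! j) (?E (take j xs))) (drop (Suc j) xs)
        = (\<Sum>k<j. scale ((-1) ^ (j - Suc k) * bform (xs ! k) (xs ! j))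
            (wact U (?E (take k xs @ drop (Suc k) (take j xs))) (drop (Suc j) xs)))"
        by (simp only: wact_sum wact_scale)
      then have "wact U (contract U (xs ! j) (?E (take j xs))) (drop (Suc j) xs) S
        = (\<Sum>k<j. g k xs)"
        by (simp only: g_def sum_fun_apply scale_def)
      then show ?thesis
        unfolding d t by (simp add: rho_def wact_add)
    qed
    \<comment> \<open>Letters k and j enter \<open>g k\<close> only through the symmetric form, so
      exchanging them leaves it unchanged and its alternating sum vanishes.\<close>
    have sym: "(\<Sum>p | p permutes {..<n}. of_int (sign p) * g k (permute_list p us)) = 0"
      if k: "k < j" for k
    proof (rule alternating_sum_symmetric[OF scalar_two_torsion, where U = U and a = k and b = j])
      fix xs :: "vvar list" assume xs: "length xs = n"
      have d: "drop (Suc k) (take j (xs[k := xs ! j])) = drop (Suc k) (take j xs)"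
        by (rule nth_equalityI) (use k j xs in auto)
      show "g k (xs[k := xs ! j, j := xs ! k]) = g k xs"
        using k j xs d by (simp add: g_def bform_commute nth_list_update drop_update_cancel)
    qed (use k j us in auto)
    have "D j = (\<Sum>p | p permutes {..<n}. of_int (sign p) *
      (wact U (?E (take (Suc j) (permute_list p us))) (drop (Suc j) (permute_list p us)) S
        + (\<Sum>k<j. g k (permute_list p us))))"
      unfolding D_def by (rule sum.cong) (use split us in auto)
    also have "\<dots> = D (Suc j) + (\<Sum>k<j. \<Sum>p | p permutes {..<n}. of_int (sign p) * g k (permute_list p us))"
      by (subst sum.swap) (simp add: D_def distrib_left sum.distrib sum_distrib_left)
    finally show ?thesis by (simp add: sym)
  qed
  have "D 0 = D j" if "j \<le> n" for j
    using that by (induction j) (use step in auto)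
  from this[of n] show ?thesis
    unfolding D_def using us by simp
qed

lemma cact_permute_list:
  assumes fin: "finite U" and us: "set us \<subseteq> U" "length us = n" and p: "p permutes {..<n}"
  shows "cact U (ev {}) (permute_list p us) S = of_int (sign p) * cact U (ev {}) us S"
proof -
  interpret alternating_mod "\<lambda>us. cact U (ev {}) us S" "{0}" n U
  proof
    fix as bs and u v :: vvar
    assume "u \<in> U" "v \<in> U"
    then have e: "create U v (create U u \<phi>) = scale (-1) (create U u (create U v \<phi>))" for \<phi>
      using create_create[OF fin, of u v \<phi>]
      by (auto simp: scale_def fun_eq_iff add_eq_0_iff)
    show "cact U (ev {}) (as @ u # v # bs) S + cact U (ev {}) (as @ v # u # bs) S \<in> {0}"
      by (simp add: e cact_scale) (simp add: scale_def)
  qed auto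
  show ?thesis using permute[OF p us(2,1)] by simp
qed

lemma wact_antisym_sorted:
  assumes "finite U" "set us \<subseteq> U" "sorted_wrt (\<lambda>u v. vord u < vord v) us"
  shows "(\<Sum>p | p permutes {..<length us}. of_int (sign p) * wact U (ev {}) (permute_list p us) S)
    = of_nat (fact (length us)) * ev (set us) S"
proof -
  have "(\<Sum>p | p permutes {..<length us}. of_int (sign p) * wact U (ev {}) (permute_list p us) S)
    = (\<Sum>p | p permutes {..<length us}. of_int (sign p) * (of_int (sign p) * ev (set us) S))"
    using assms by (simp add: wact_antisym cact_permute_list cact_sorted)
  also have "\<dots> = (\<Sum>p | p permutes {..<length us}. ev (set us) S)"
    by (rule sum.cong) (auto simp: sign_def)
  also have "\<dots> = of_nat (fact (length us)) * ev (set us) S"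
    by (simp add: card_permutations[of _ "length us"])
  finally show ?thesis .
qed

subsection \<open>Additive images of monoids\<close>

lemma sum_in_closed:
  assumes "0 \<in> W" "\<And>x y. x \<in> W \<Longrightarrow> y \<in> W \<Longrightarrow> x + y \<in> W"
  shows "(\<And>i. i \<in> I \<Longrightarrow> f i \<in> W) \<Longrightarrow> sum f I \<in> W"
  by (induction I rule: infinite_finite_induct) (auto simp: assms)

text \<open>Transport of sums along \<open>e\<close>: \<open>finsum\<close> in a record structure
  becomes an ordinary sum in a type. No injectivity is assumed, so that \<open>e\<close> may also be
  a passage to cosets.\<close>

locale add_image =
  fixes G :: "('c, 'm) ring_scheme" and e :: "'v::comm_monoid_add \<Rightarrow> 'c" and W :: "'v set"
  assumes carrier: "carrier G = e ` W"
    and W_0: "0 \<in> W" and W_add: "\<phi> \<in> W \<Longrightarrow> \<psi> \<in> W \<Longrightarrow> \<phi> + \<psi> \<in> W"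
    and add: "\<phi> \<in> W \<Longrightarrow> \<psi> \<in> W \<Longrightarrow> e \<phi> \<oplus>\<^bsub>G\<^esub> e \<psi> = e (\<phi> + \<psi>)"
    and zero: "\<zero>\<^bsub>G\<^esub> = e 0"
begin

lemma abelian_monoid: "abelian_monoid G"
proof (rule abelian_monoidI)
  fix x y z assume "x \<in> carrier G" "y \<in> carrier G" "z \<in> carrier G"
  then show "x \<oplus>\<^bsub>G\<^esub> y \<oplus>\<^bsub>G\<^esub> z = x \<oplus>\<^bsub>G\<^esub> (y \<oplus>\<^bsub>G\<^esub> z)"
    by (auto simp: carrier add W_add add.assoc)
qed (auto simp: carrier add zero W_0 W_add add.commute)

lemma finsum_image:
  assumes "\<And>i. i \<in> I \<Longrightarrow> f i = e (\<phi> i)" "\<And>i. i \<in> I \<Longrightarrow> \<phi> i \<in> W"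
  shows "finsum G f I = e (\<Sum>i\<in>I. \<phi> i)"
proof -
  interpret abelian_monoid G by (rule abelian_monoid)
  show ?thesis using assms
  proof (induction I rule: infinite_finite_induct)
    case (infinite A)
    then show ?case by (simp add: finsum_infinite zero)
  next
    case empty
    then show ?case by (simp add: zero)
  next
    case (insert i I)
    have "f \<in> I \<rightarrow> carrier G" "f i \<in> carrier G" using insert.prems by (auto simp: carrier)
    moreover have "(\<Sum>i\<in>I. \<phi> i) \<in> W"
      using insert.prems by (intro sum_in_closed W_0 W_add) auto
    ultimately show ?case
      using insert by (simp add: finsum_insert add)
  qed
qed

end

subsection \<open>The radial algebra as a quotient\<close>

lemma free_algebra_simps [simp]:
  "x \<otimes>\<^bsub>free_algebra S\<^esub> y = x * y" "x \<oplus>\<^bsub>free_algebra S\<^esub> y = x + y"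
  "\<one>\<^bsub>free_algebra S\<^esub> = 1" "\<zero>\<^bsub>free_algebra S\<^esub> = 0"
  by (simp_all add: free_algebra_def)

lemma mem_free_algebra:
  "f \<in> carrier (free_algebra S) \<longleftrightarrow> (\<forall>w\<in>Poly_Mapping.keys f. set (letters w) \<subseteq> S)"
  by (simp add: free_algebra_def)

lemma letters_simps [simp]: "letters 0 = []" "letters (v + w) = letters v @ letters w"
  by (simp_all add: zero_word_def plus_word_def)

lemma fa_0 [simp]: "0 \<in> carrier (free_algebra S)"
  and fa_1 [simp]: "1 \<in> carrier (free_algebra S)"
  and fa_const [simp]: "free_const c \<in> carrier (free_algebra S)"
  and fa_single: "set vs \<subseteq> S \<Longrightarrow> Poly_Mapping.single (Word vs) c \<in> carrier (free_algebra S)"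
  and fa_gen: "v \<in> S \<Longrightarrow> gen v \<in> carrier (free_algebra S)"
  by (simp_all add: mem_free_algebra free_const_def gen_def)

lemma fa_add: "f \<in> carrier (free_algebra S) \<Longrightarrow> g \<in> carrier (free_algebra S) \<Longrightarrow> f + g \<in> carrier (free_algebra S)"
  unfolding mem_free_algebra using keys_add[of f g] by auto

lemma fa_uminus [simp]: "- f \<in> carrier (free_algebra S) \<longleftrightarrow> f \<in> carrier (free_algebra S)"
  unfolding mem_free_algebra by (simp add: in_keys_iff)

lemma fa_diff: "f \<in> carrier (free_algebra S) \<Longrightarrow> g \<in> carrier (free_algebra S) \<Longrightarrow> f - g \<in> carrier (free_algebra S)"
  using fa_add[of f S "- g"] by simp

lemma fa_mult: "f \<in> carrier (free_algebra S) \<Longrightarrow> g \<in> carrier (free_algebra S) \<Longrightarrow> f * g \<in> carrier (free_algebra S)"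
  unfolding mem_free_algebra using keys_mult[of f g] by fastforce

lemma fa_power: "f \<in> carrier (free_algebra S) \<Longrightarrow> f ^ n \<in> carrier (free_algebra S)"
  by (induction n) (auto intro: fa_mult)

lemma fa_sum: "(\<And>i. i \<in> I \<Longrightarrow> f i \<in> carrier (free_algebra S)) \<Longrightarrow> sum f I \<in> carrier (free_algebra S)"
  by (induction I rule: infinite_finite_induct) (auto intro: fa_add)

lemma fa_prod_list:
  "(\<And>i. i \<in> set vs \<Longrightarrow> f i \<in> carrier (free_algebra S)) \<Longrightarrow> prod_list (map f vs) \<in> carrier (free_algebra S)"
  by (induction vs) (auto intro: fa_mult)

lemma ring_free_algebra: "ring (free_algebra S)"
proof (rule ringI)
  show "abelian_group (free_algebra S)"
  proof (rule abelian_groupI)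
    fix x assume "x \<in> carrier (free_algebra S)"
    then show "\<exists>y\<in>carrier (free_algebra S). y \<oplus>\<^bsub>free_algebra S\<^esub> x = \<zero>\<^bsub>free_algebra S\<^esub>"
      by (intro bexI[of _ "- x"]) auto
  qed (auto simp: algebra_simps intro: fa_add)
  show "Group.monoid (free_algebra S)"
    by (rule monoidI) (auto simp: algebra_simps intro: fa_mult)
qed (auto simp: algebra_simps)

interpretation fa: ring "free_algebra S" for S
  by (rule ring_free_algebra)

lemma radial_relators_subset:
  "{acomm (gen u) (gen v) * gen w - gen w * acomm (gen u) (gen v) | u v w.
       u \<in> S \<and> v \<in> S \<and> w \<in> S} \<subseteq> carrier (free_algebra S)"
  by (auto simp: acomm_def intro!: fa_diff fa_mult fa_add fa_gen)

lemma ideal_radial_ideal: "ideal (radial_ideal S) (free_algebra S)"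
  unfolding radial_ideal_def by (rule fa.genideal_ideal[OF radial_relators_subset])

lemmas additive_radial_ideal = ideal.axioms(1)[OF ideal_radial_ideal]

lemma ri_0 [simp]: "0 \<in> radial_ideal S"
  using additive_subgroup.zero_closed[OF additive_radial_ideal, of S] by simp

lemma ri_carrier: "f \<in> radial_ideal S \<Longrightarrow> f \<in> carrier (free_algebra S)"
  using additive_subgroup.a_subset[OF additive_radial_ideal] by blast

lemma ri_add: "f \<in> radial_ideal S \<Longrightarrow> g \<in> radial_ideal S \<Longrightarrow> f + g \<in> radial_ideal S"
  using additive_subgroup.a_closed[OF additive_radial_ideal, of f S g] by simp

lemma ri_lmult: "f \<in> radial_ideal S \<Longrightarrow> g \<in> carrier (free_algebra S) \<Longrightarrow> g * f \<in> radial_ideal S"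
  using ideal.I_l_closed[OF ideal_radial_ideal, of f S g] by simp

lemma ri_rmult: "f \<in> radial_ideal S \<Longrightarrow> g \<in> carrier (free_algebra S) \<Longrightarrow> f * g \<in> radial_ideal S"
  using ideal.I_r_closed[OF ideal_radial_ideal, of f S g] by simp

lemma ri_uminus: "f \<in> radial_ideal S \<Longrightarrow> - f \<in> radial_ideal S"
  using ri_lmult[of f S "- 1"] by simp

lemma ri_diff: "f \<in> radial_ideal S \<Longrightarrow> g \<in> radial_ideal S \<Longrightarrow> f - g \<in> radial_ideal S"
  using ri_add[of f S "- g"] ri_uminus by simp

lemma ri_relator:
  "u \<in> S \<Longrightarrow> v \<in> S \<Longrightarrow> w \<in> S \<Longrightarrow>
    acomm (gen u) (gen v) * gen w - gen w * acomm (gen u) (gen v) \<in> radial_ideal S"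
  unfolding radial_ideal_def
  by (rule subsetD[OF fa.genideal_self[OF radial_relators_subset]]) blast

abbreviation VL :: "nat set \<Rightarrow> vvar set" where "VL L \<equiv> insert VX (VY ` L)"

lemma mem_cls: "g \<in> cls L f \<longleftrightarrow> g - f \<in> radial_ideal (VL L)"
  by (auto simp: cls_def a_r_coset_def' intro!: bexI[of _ "g - f"])

lemma cls_eq_iff: "cls L f = cls L g \<longleftrightarrow> f - g \<in> radial_ideal (VL L)"
proof
  assume "cls L f = cls L g"
  moreover have "f \<in> cls L f" by (simp add: mem_cls)
  ultimately show "f - g \<in> radial_ideal (VL L)" by (simp add: mem_cls)
next
  assume fg: "f - g \<in> radial_ideal (VL L)"
  show "cls L f = cls L g"
  proof (rule Set.set_eqI)
    fix h
    have "h - g = (h - f) + (f - g)" "h - f = (h - g) - (f - g)" by simp_all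
    then show "h \<in> cls L f \<longleftrightarrow> h \<in> cls L g"
      using fg ri_add ri_diff unfolding mem_cls by metis
  qed
qed

abbreviation FA :: "nat set \<Rightarrow> free_elt set" where "FA L \<equiv> carrier (free_algebra (VL L))"

lemma RA_eq: "RA L = free_algebra (VL L) Quot radial_ideal (VL L)"
  by (simp add: RA_def radial_algebra_def)

lemma ring_RA: "ring (RA L)"
  unfolding RA_eq by (rule ideal.quotient_is_ring[OF ideal_radial_ideal])

lemma cls_hom: "cls L \<in> Ring.ring_hom (free_algebra (VL L)) (RA L)"
  using ideal.rcos_ring_hom[OF ideal_radial_ideal, of "VL L"] by (simp add: RA_eq cls_def[abs_def])

lemma carrier_RA: "carrier (RA L) = cls L ` FA L"
  by (auto simp: RA_eq FactRing_def A_RCOSETS_def' cls_def)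

lemma cls_closed: "f \<in> FA L \<Longrightarrow> cls L f \<in> carrier (RA L)"
  by (auto simp: carrier_RA)

lemma cls_mult: "f \<in> FA L \<Longrightarrow> g \<in> FA L \<Longrightarrow> cls L f \<otimes>\<^bsub>RA L\<^esub> cls L g = cls L (f * g)"
  using ring_hom_mult[OF cls_hom, of f L g] by simp

lemma cls_add: "f \<in> FA L \<Longrightarrow> g \<in> FA L \<Longrightarrow> cls L f \<oplus>\<^bsub>RA L\<^esub> cls L g = cls L (f + g)"
  using ring_hom_add[OF cls_hom, of f L g] by simp

lemma cls_zero: "\<zero>\<^bsub>RA L\<^esub> = cls L 0"
  using ring_hom_zero[OF cls_hom ring_free_algebra ring_RA] by simp

lemma RA_cls_image: "add_image (RA L) (cls L) (FA L)"
  by standard (auto simp: carrier_RA cls_add cls_zero intro: fa_add)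

lemmas finsum_RA_cls = add_image.finsum_image[OF RA_cls_image]

subsection \<open>Action on the Clifford model\<close>

definition ract :: "vvar set \<Rightarrow> (vvar set \<Rightarrow> scalar) \<Rightarrow> free_elt \<Rightarrow> vvar set \<Rightarrow> scalar" where
  "ract U \<phi> = linext (\<lambda>w c. scale (sconst c) (wact U \<phi> (letters w)))"

lemma ract_single: "ract U \<phi> (Poly_Mapping.single w c) = scale (sconst c) (wact U \<phi> (letters w))"
  unfolding ract_def by (rule linext_single) simp

lemma ract_add: "ract U \<phi> (f + g) = ract U \<phi> f + ract U \<phi> g"
  unfolding ract_def by (rule linext_add) (simp_all add: sconst_add scale_add_left)

lemma ract_zero [simp]: "ract U \<phi> 0 = 0"
  by (simp add: ract_def)

lemma ract_uminus: "ract U \<phi> (- f) = - ract U \<phi> f"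
  using ract_add[of U \<phi> f "- f"] by (simp add: add_eq_0_iff)

lemma ract_diff: "ract U \<phi> (f - g) = ract U \<phi> f - ract U \<phi> g"
  using ract_add[of U \<phi> f "- g"] by (simp add: ract_uminus)

lemma ract_sum: "ract U \<phi> (\<Sum>i\<in>I. f i) = (\<Sum>i\<in>I. ract U \<phi> (f i))"
  by (rule additive_sum[of "ract U \<phi>"]) (simp_all add: ract_add)

lemma ract_add_left: "ract U (\<phi> + \<psi>) f = ract U \<phi> f + ract U \<psi> f"
  by (rule poly_mapping_add_induct[of "\<lambda>f. ract U (\<phi> + \<psi>) f = ract U \<phi> f + ract U \<psi> f"])
    (simp_all add: ract_single ract_add wact_add scale_add)

lemma ract_zero_left [simp]: "ract U 0 f = 0"
  using ract_add_left[of U 0 0 f] by simp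

lemma ract_scale_left: "ract U (scale c \<phi>) f = scale c (ract U \<phi> f)"
  by (rule poly_mapping_add_induct[of "\<lambda>f. ract U (scale c \<phi>) f = scale c (ract U \<phi> f)"])
    (simp_all add: ract_single ract_add wact_scale scale_add mult.commute)

lemma ract_mult: "ract U \<phi> (f * g) = ract U (ract U \<phi> f) g"
proof (rule poly_mapping_add_induct[of "\<lambda>f. ract U \<phi> (f * g) = ract U (ract U \<phi> f) g"])
  fix w c
  show "ract U \<phi> (Poly_Mapping.single w c * g) = ract U (ract U \<phi> (Poly_Mapping.single w c)) g"
    by (rule poly_mapping_add_induct[of "\<lambda>g. ract U \<phi> (Poly_Mapping.single w c * g)
          = ract U (ract U \<phi> (Poly_Mapping.single w c)) g"])
      (simp_all add: mult_single ract_single wact_scale sconst_mult ract_add algebra_simps)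
qed (simp add: algebra_simps ract_add ract_add_left)

lemma ract_one [simp]: "ract U \<phi> 1 = \<phi>"
  using ract_single[of U \<phi> 0 1] by simp

lemma ract_gen [simp]: "ract U \<phi> (gen v) = rho U v \<phi>"
  by (simp add: gen_def ract_single)

lemma ract_const [simp]: "ract U \<phi> (free_const c) = scale (sconst c) \<phi>"
  by (simp add: free_const_def ract_single)

lemma ract_acomm:
  assumes "finite U" "u \<in> U" "v \<in> U"
  shows "ract U \<phi> (acomm (gen u) (gen v)) = scale (ac_var u v) \<phi>"
  using rho_acomm[OF assms(1,3,2), of \<phi>]
  by (simp add: acomm_def ract_add ract_mult ac_var_commute)

text \<open>The elements that annihilate every vector, and not only the vacuum, form a two-sided
  ideal. It contains the relators because an anticommutator acts by a scalar and the Clifford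
  operators are linear over scalars.\<close>

lemma ract_radial_ideal:
  assumes U: "finite U" "S \<subseteq> U" and f: "f \<in> radial_ideal S"
  shows "ract U \<phi> f = 0"
proof -
  let ?K = "{f \<in> carrier (free_algebra S). \<forall>\<phi>. ract U \<phi> f = 0}"
  have "ideal ?K (free_algebra S)"
  proof (rule idealI)
    have "a_inv (free_algebra S) f = - f" if "f \<in> carrier (free_algebra S)" for f
      by (rule fa.minus_equality) (use that in auto)
    then show "subgroup ?K (add_monoid (free_algebra S))"
      by (intro fa.add.subgroupI) (auto simp: ract_add ract_uminus intro: fa_add simp flip: a_inv_def)
  qed (auto simp: ring_free_algebra ract_mult intro: fa_mult)
  moreover have "{acomm (gen u) (gen v) * gen w - gen w * acomm (gen u) (gen v) | u v w.
       u \<in> S \<and> v \<in> S \<and> w \<in> S} \<subseteq> ?K"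
  proof safe
    fix u v w assume uvw: "u \<in> S" "v \<in> S" "w \<in> S"
    then show "acomm (gen u) (gen v) * gen w - gen w * acomm (gen u) (gen v) \<in> carrier (free_algebra S)"
      using radial_relators_subset by blast
    fix \<phi>
    have "u \<in> U" "v \<in> U" using uvw U by auto
    then show "ract U \<phi> (acomm (gen u) (gen v) * gen w - gen w * acomm (gen u) (gen v)) = 0"
      using U by (simp add: ract_diff ract_mult ract_acomm rho_scale)
  qed
  ultimately have "radial_ideal S \<subseteq> ?K"
    unfolding radial_ideal_def by (rule fa.genideal_minimal)
  with f show ?thesis by blast
qed

subsection \<open>Scalars and wedges in the model\<close>

definition mrep :: "nat set \<Rightarrow> (svar \<Rightarrow>\<^sub>0 nat) \<Rightarrow> free_elt" where
  "mrep L m = prod_list (map (\<lambda>v. svar_rep v ^ Poly_Mapping.lookup m v) (svar_list L))"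

text \<open>A representative in the free algebra of the class \<open>emb L f\<close>. It is additive
  in f, while products are respected only modulo the radial ideal, through centrality.\<close>

definition arep :: "nat set \<Rightarrow> scalar \<Rightarrow> free_elt" where
  "arep L = linext (\<lambda>m c. free_const c * mrep L m)"

lemma emb_eq: "emb L f = cls L (arep L f)"
  by (simp add: emb_def arep_def linext_def mrep_def)

lemma free_const_0 [simp]: "free_const 0 = 0"
  and free_const_1 [simp]: "free_const 1 = 1"
  and free_const_add: "free_const (a + b) = free_const a + free_const b"
  and free_const_mult: "free_const (a * b) = free_const a * free_const b"
  by (simp_all add: free_const_def single_add mult_single)

lemma free_const_commute: "free_const c * f = f * free_const c"
  by (induction f rule: poly_mapping_add_induct)
    (simp_all add: free_const_def mult_single mult.commute algebra_simps)

lemma arep_add: "arep L (f + g) = arep L f + arep L g"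
  unfolding arep_def by (rule linext_add) (simp_all add: free_const_add algebra_simps)

lemma arep_0 [simp]: "arep L 0 = 0"
  by (simp add: arep_def)

lemma arep_single: "arep L (Poly_Mapping.single m c) = free_const c * mrep L m"
  unfolding arep_def by (rule linext_single) simp

definition sv :: "nat set \<Rightarrow> svar set" where
  "sv L = {SR} \<union> SS ` L \<union> {SC i j | i j. i \<in> L \<and> j \<in> L \<and> i \<le> j}"

lemma svar_list:
  assumes "finite L"
  shows "set (svar_list L) = sv L" "distinct (svar_list L)"
proof -
  let ?ls = "sorted_list_of_set L"
  show "set (svar_list L) = sv L"
    using assms by (auto simp: svar_list_def Let_def sv_def)
  have "distinct (concat (map (\<lambda>i. [SC i j. j \<leftarrow> js, i \<le> j]) ls))"
    if "distinct ls" "distinct js" for ls js :: "nat list"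
  proof -
    have "distinct [SC i j. j \<leftarrow> js, i \<le> j]" for i
      using that(2) by (induction js) auto
    with that(1) show ?thesis by (induction ls) auto
  qed
  from this[of ?ls ?ls] show "distinct (svar_list L)"
    by (auto simp: svar_list_def Let_def distinct_map inj_on_def)
qed

lemma finite_sv: "finite L \<Longrightarrow> finite (sv L)"
  by (metis svar_list(1) List.finite_set)

lemma A_set_eq: "finite L \<Longrightarrow> A_set L = polys_in (sv L)"
  by (simp add: A_set_def svar_list)

lemma ract_svar_rep:
  assumes "finite M" "v \<in> sv M"
  shows "ract (VL M) \<phi> (svar_rep v) = scale (pvar v) \<phi>"
proof (cases v)
  case SR
  have fin: "finite (VL M)" using assms by simp
  let ?h = "sconst (real_coeff (1/2))"
  have h: "?h * sconst 2 = 1"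
    using real_coeff_half by (simp flip: sconst_mult)
  \<comment> \<open>The square of x is half of {x, x}, which acts by 2 r.\<close>
  have "rho (VL M) VX (rho (VL M) VX \<phi>) = scale ?h (rho (VL M) VX (rho (VL M) VX \<phi>) + rho (VL M) VX (rho (VL M) VX \<phi>))"
    by (simp only: scale_add scale_add_left[symmetric] sconst_half scale_simps)
  also have "\<dots> = scale (pvar SR) \<phi>"
    by (subst rho_acomm[OF fin]) (simp_all add: h flip: mult.assoc)
  finally show ?thesis using SR by (simp add: ract_mult)
next
  case (SS i)
  then show ?thesis using assms by (auto simp: sv_def ract_acomm)
next
  case (SC i j)
  then show ?thesis using assms by (auto simp: sv_def ract_acomm)
qed

lemma ract_power:
  assumes "\<And>\<phi>. ract U \<phi> f = scale c \<phi>"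
  shows "ract U \<phi> (f ^ n) = scale (c ^ n) \<phi>"
  by (induction n arbitrary: \<phi>) (simp_all add: ract_mult assms mult.commute)

lemma pvar_power: "pvar v ^ n = Poly_Mapping.single (Poly_Mapping.single v n) 1"
  by (induction n) (simp_all add: pvar_def mult_single flip: single_add)

lemma prod_pvar_power:
  assumes "finite V" "Poly_Mapping.keys m \<subseteq> V"
  shows "(\<Prod>v\<in>V. pvar v ^ Poly_Mapping.lookup m v) = Poly_Mapping.single m 1"
proof -
  have "(\<Prod>v\<in>V. pvar v ^ Poly_Mapping.lookup m v)
      = Poly_Mapping.single (\<Sum>v\<in>V. Poly_Mapping.single v (Poly_Mapping.lookup m v)) 1"
    using assms(1) by induction (simp_all add: pvar_power mult_single)
  also have "(\<Sum>v\<in>V. Poly_Mapping.single v (Poly_Mapping.lookup m v)) = m"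
    using linext_superset[of V m Poly_Mapping.single] assms
    by (simp add: linext_def poly_mapping_sum_single)
  finally show ?thesis .
qed

lemma ract_mrep:
  assumes M: "finite M" "L \<subseteq> M" and m: "Poly_Mapping.keys m \<subseteq> sv L"
  shows "ract (VL M) \<phi> (mrep L m) = scale (Poly_Mapping.single m 1) \<phi>"
proof -
  have L: "finite L" using M finite_subset by blast
  have "ract (VL M) \<phi> (prod_list (map (\<lambda>v. svar_rep v ^ k v) vs))
      = scale (prod_list (map (\<lambda>v. pvar v ^ k v) vs)) \<phi>" if "set vs \<subseteq> sv M" for vs k
    using that
    by (induction vs arbitrary: \<phi>)
      (simp_all add: ract_mult ract_power[OF ract_svar_rep[OF M(1)]] mult.commute)
  moreover have "sv L \<subseteq> sv M" using M by (auto simp: sv_def)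
  ultimately have "ract (VL M) \<phi> (mrep L m)
      = scale (prod_list (map (\<lambda>v. pvar v ^ Poly_Mapping.lookup m v) (svar_list L))) \<phi>"
    unfolding mrep_def using svar_list[OF L] by blast
  also have "prod_list (map (\<lambda>v. pvar v ^ Poly_Mapping.lookup m v) (svar_list L))
      = (\<Prod>v\<in>sv L. pvar v ^ Poly_Mapping.lookup m v)"
    using svar_list[OF L] by (metis prod.distinct_set_conv_list)
  also have "\<dots> = Poly_Mapping.single m 1"
    using m by (rule prod_pvar_power[OF finite_sv[OF L]])
  finally show ?thesis .
qed

lemma ract_arep:
  assumes "finite M" "L \<subseteq> M" "f \<in> polys_in (sv L)"
  shows "ract (VL M) \<phi> (arep L f) = scale f \<phi>"
proof -
  have "ract (VL M) \<phi> (arep L f)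
      = (\<Sum>m\<in>Poly_Mapping.keys f. scale (Poly_Mapping.single m (Poly_Mapping.lookup f m)) \<phi>)"
    unfolding arep_def linext_def ract_sum
    by (rule sum.cong)
      (use assms in \<open>auto simp: polys_in_def ract_mult ract_mrep ract_scale_left sconst_def mult_single\<close>)
  also have "\<dots> = scale (\<Sum>m\<in>Poly_Mapping.keys f. Poly_Mapping.single m (Poly_Mapping.lookup f m)) \<phi>"
    by (rule additive_sum[symmetric, of "\<lambda>c. scale c \<phi>"]) (simp_all add: scale_add_left)
  finally show ?thesis by (simp add: poly_mapping_sum_single)
qed

section \<open>Words in the free algebra and their antisymmetrisations\<close>

definition wmon :: "vvar list \<Rightarrow> free_elt" where
  "wmon vs = Poly_Mapping.single (Word vs) 1"

lemma wmon_append: "wmon (vs @ ws) = wmon vs * wmon ws"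
  by (simp add: wmon_def mult_single plus_word_def)

lemma wmon_Nil [simp]: "wmon [] = 1"
  by (simp add: wmon_def flip: zero_word_def)

lemma wmon_Cons: "wmon (v # vs) = gen v * wmon vs"
  using wmon_append[of "[v]" vs] by (simp add: wmon_def gen_def)

lemma prod_list_gen: "prod_list (map gen vs) = wmon vs"
  by (induction vs) (simp_all add: wmon_Cons)

lemma wedge_gen:
  "wedge (map gen vs) = free_const (real_coeff (1 / fact (length vs))) *
     (\<Sum>p | p permutes {..<length vs}. of_int (sign p) * wmon (permute_list p vs))"
proof -
  have "map (\<lambda>i. map gen vs ! p i) [0..<length vs] = map gen (permute_list p vs)"
    if "p permutes {..<length vs}" for p
    using permutes_in_image[OF that] by (auto simp: permute_list_def)
  then show ?thesis
    by (auto simp: wedge_def prod_list_gen intro!: sum.cong arg_cong2[where f = "(*)"])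
qed

lemma fa_wmon: "set vs \<subseteq> S \<Longrightarrow> wmon vs \<in> carrier (free_algebra S)"
  by (simp add: wmon_def fa_single)

lemma fa_sign_mult: "f \<in> carrier (free_algebra S) \<Longrightarrow> of_int (sign p) * f \<in> carrier (free_algebra S)"
  by (simp add: sign_def)

lemma fa_wedge: "set vs \<subseteq> S \<Longrightarrow> wedge (map gen vs) \<in> carrier (free_algebra S)"
  unfolding wedge_gen
  by (intro fa_mult fa_const fa_sum fa_sign_mult fa_wmon) simp

lemma ract_wmon: "ract U \<phi> (wmon vs) = wact U \<phi> vs"
  by (simp add: wmon_def ract_single)

lemma ract_wedge:
  assumes "finite U" "set us \<subseteq> U" "sorted_wrt (\<lambda>u v. vord u < vord v) us"
  shows "ract U (ev {}) (wedge (map gen us)) = ev (set us)"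
proof
  fix S
  let ?n = "length us"
  have s: "ract U \<phi> (of_int (sign p) * f) = scale (of_int (sign p)) (ract U \<phi> f)"
    for p :: "nat \<Rightarrow> nat" and \<phi> f
    by (auto simp: sign_def ract_uminus scale_def)
  have "ract U (ev {}) (wedge (map gen us)) = scale (sconst (real_coeff (1 / fact ?n)))
      (\<Sum>p | p permutes {..<?n}. scale (of_int (sign p)) (wact U (ev {}) (permute_list p us)))"
    unfolding wedge_gen
    by (subst ract_mult) (simp add: ract_sum ract_scale_left s ract_wmon scale_sum mult.commute)
  then have "ract U (ev {}) (wedge (map gen us)) S = sconst (real_coeff (1 / fact ?n)) *
      (\<Sum>p | p permutes {..<?n}. of_int (sign p) * wact U (ev {}) (permute_list p us) S)"
    by (simp add: scale_def sum_fun_apply)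
  also have "\<dots> = sconst (real_coeff (1 / fact ?n)) * of_nat (fact ?n) * ev (set us) S"
    by (simp only: wact_antisym_sorted[OF assms] mult.assoc)
  also have "sconst (real_coeff (1 / fact ?n)) * of_nat (fact ?n) = sconst (real_coeff (1 / fact ?n) * of_nat (fact ?n))"
    by (simp add: sconst_mult) (simp add: sconst_def)
  finally show "ract U (ev {}) (wedge (map gen us)) S = ev (set us) S"
    by (simp only: real_coeff_inv_fact sconst_1 mult_1)
qed

subsection \<open>Spanning by wedges\<close>

lemma ri_sum: "(\<And>i. i \<in> I \<Longrightarrow> f i \<in> radial_ideal S) \<Longrightarrow> sum f I \<in> radial_ideal S"
  by (induction I rule: infinite_finite_induct) (auto intro: ri_add)

lemma free_elt_sum: "(\<Sum>w\<in>Poly_Mapping.keys f. free_const (Poly_Mapping.lookup f w) * wmon (letters w)) = f"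
proof -
  have "free_const c * wmon (letters w) = Poly_Mapping.single w c" for c w
    by (simp add: free_const_def wmon_def mult_single)
  then show ?thesis by (simp add: poly_mapping_sum_single)
qed

text \<open>The rule [c, vw] = [c, v] w + v [c, w] carries commutation from letters to words, and
  coefficients commute with everything.\<close>

lemma gen_central:
  assumes c: "c \<in> carrier (free_algebra S)"
    and gen: "\<And>v. v \<in> S \<Longrightarrow> c * gen v - gen v * c \<in> radial_ideal S"
    and g: "g \<in> carrier (free_algebra S)"
  shows "c * g - g * c \<in> radial_ideal S"
proof -
  have word: "c * wmon vs - wmon vs * c \<in> radial_ideal S" if "set vs \<subseteq> S" for vs
    using that
  proof (induction vs)
    case (Cons v vs)
    have "c * wmon (v # vs) - wmon (v # vs) * c
        = (c * gen v - gen v * c) * wmon vs + gen v * (c * wmon vs - wmon vs * c)"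
      by (simp add: wmon_Cons algebra_simps)
    also have "\<dots> \<in> radial_ideal S"
      using Cons by (intro ri_add ri_rmult ri_lmult gen) (auto intro: fa_wmon fa_gen)
    finally show ?case .
  qed simp
  have "c * g - g * c = (\<Sum>w\<in>Poly_Mapping.keys g.
      free_const (Poly_Mapping.lookup g w) * (c * wmon (letters w) - wmon (letters w) * c))"
    (is "?l = ?r")
  proof -
    have "?r = (\<Sum>w\<in>Poly_Mapping.keys g. c * (free_const (Poly_Mapping.lookup g w) * wmon (letters w))
      - free_const (Poly_Mapping.lookup g w) * wmon (letters w) * c)"
      by (rule sum.cong) (simp_all add: right_diff_distrib mult.assoc flip: free_const_commute[of _ c],
          simp add: free_const_commute mult.assoc)
    also have "\<dots> = ?l"
      by (simp add: sum_subtractf free_elt_sum flip: sum_distrib_left sum_distrib_right)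
    finally show ?thesis by simp
  qed
  also have "\<dots> \<in> radial_ideal S"
    by (intro ri_sum ri_lmult word) (use g in \<open>auto simp: mem_free_algebra[of g]\<close>)
  finally show ?thesis .
qed

lemma two_half_const: "free_const (real_coeff (1/2)) * (f + f) = f"
proof -
  have "free_const (real_coeff (1/2)) * (f + f) = free_const (real_coeff (1/2) * 2) * f"
    by (simp only: mult_2_right free_const_add distrib_right distrib_left)
  then show ?thesis by (simp only: real_coeff_half free_const_1 mult_1)
qed

lemma fa_svar_rep: "v \<in> sv L \<Longrightarrow> svar_rep v \<in> FA L"
  by (auto simp: sv_def acomm_def intro!: fa_mult fa_add fa_gen)

lemma acomm_gen_central:
  assumes "u \<in> VL L" "v \<in> VL L" "g \<in> FA L"
  shows "acomm (gen u) (gen v) * g - g * acomm (gen u) (gen v) \<in> radial_ideal (VL L)"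
  by (rule gen_central)
    (use assms in \<open>auto simp: acomm_def intro!: fa_mult fa_add fa_gen ri_relator[unfolded acomm_def]\<close>)

lemma svar_rep_central:
  assumes v: "v \<in> sv L" and g: "g \<in> FA L"
  shows "svar_rep v * g - g * svar_rep v \<in> radial_ideal (VL L)"
proof (cases v)
  case SR
  let ?x = "gen VX * gen VX"
  have "?x * g - g * ?x = free_const (real_coeff (1/2)) * (acomm (gen VX) (gen VX) * g - g * acomm (gen VX) (gen VX))"
    by (subst two_half_const[symmetric]) (simp add: acomm_def algebra_simps)
  also have "\<dots> \<in> radial_ideal (VL L)"
    by (intro ri_lmult acomm_gen_central g) auto
  finally show ?thesis using SR by simp
qed (use v g in \<open>auto simp: sv_def intro!: acomm_gen_central\<close>)

text \<open>The product follows a fixed order of the variables; a factor appended at the end moves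
  left, by centrality, to the power of the same variable.\<close>

lemma svar_prod_mult:
  assumes "distinct vs" "v \<in> set vs" "set vs \<subseteq> sv L"
  shows "prod_list (map (\<lambda>u. svar_rep u ^ k u) vs) * svar_rep v
      - prod_list (map (\<lambda>u. svar_rep u ^ (k(v := Suc (k v))) u) vs) \<in> radial_ideal (VL L)"
  using assms
proof (induction vs)
  case (Cons u vs)
  let ?P = "prod_list (map (\<lambda>u. svar_rep u ^ k u) vs)"
  have P: "?P \<in> FA L"
    using Cons.prems by (intro fa_prod_list fa_power fa_svar_rep) auto
  have u: "svar_rep u ^ n \<in> FA L" for n
    using Cons.prems by (intro fa_power fa_svar_rep) auto
  show ?case
  proof (cases "u = v")
    case True
    have "map (\<lambda>w. svar_rep w ^ (k(v := Suc (k v))) w) vs = map (\<lambda>u. svar_rep u ^ k u) vs"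
      using True Cons.prems by auto
    then have "prod_list (map (\<lambda>w. svar_rep w ^ (k(v := Suc (k v))) w) vs) = ?P" by (rule arg_cong)
    then have "prod_list (map (\<lambda>u. svar_rep u ^ k u) (u # vs)) * svar_rep v
      - prod_list (map (\<lambda>u. svar_rep u ^ (k(v := Suc (k v))) u) (u # vs))
      = - (svar_rep u ^ k u * (svar_rep v * ?P - ?P * svar_rep v))"
      using True
      by (simp add: algebra_simps del: fun_upd_apply) (simp add: power_commutes flip: mult.assoc)
    also have "\<dots> \<in> radial_ideal (VL L)"
      using Cons.prems by (intro ri_uminus ri_lmult u svar_rep_central P) auto
    finally show ?thesis .
  next
    case False
    let ?P' = "prod_list (map (\<lambda>u. svar_rep u ^ (k(v := Suc (k v))) u) vs)"
    have "prod_list (map (\<lambda>u. svar_rep u ^ k u) (u # vs)) * svar_rep v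
      - prod_list (map (\<lambda>u. svar_rep u ^ (k(v := Suc (k v))) u) (u # vs))
      = svar_rep u ^ k u * (?P * svar_rep v - ?P')"
      using False by (simp add: algebra_simps)
    also have "\<dots> \<in> radial_ideal (VL L)"
      using Cons False by (intro ri_lmult u) auto
    finally show ?thesis .
  qed
qed simp

lemma mrep_mult:
  assumes "finite L" "v \<in> sv L"
  shows "mrep L m * svar_rep v - mrep L (m + Poly_Mapping.single v 1) \<in> radial_ideal (VL L)"
proof -
  have "(Poly_Mapping.lookup m)(v := Suc (Poly_Mapping.lookup m v))
      = Poly_Mapping.lookup (m + Poly_Mapping.single v 1)"
    by (auto simp: lookup_add lookup_single when_def)
  then show ?thesis
    using svar_prod_mult[of "svar_list L" v L "Poly_Mapping.lookup m"] svar_list[OF assms(1)] assms(2)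
    by (simp add: mrep_def del: fun_upd_apply)
qed

lemma arep_mult_pvar:
  assumes "finite L" "v \<in> sv L"
  shows "arep L f * svar_rep v - arep L (f * pvar v) \<in> radial_ideal (VL L)"
proof (induction f rule: poly_mapping_add_induct)
  case (single m c)
  have "arep L (Poly_Mapping.single m c) * svar_rep v - arep L (Poly_Mapping.single m c * pvar v)
    = free_const c * (mrep L m * svar_rep v - mrep L (m + Poly_Mapping.single v 1))"
    by (simp add: arep_single pvar_def mult_single algebra_simps)
  then show ?case using mrep_mult[OF assms] by (simp add: ri_lmult)
next
  case (add f g)
  from ri_add[OF this] show ?case by (simp add: arep_add algebra_simps)
qed

lemma arep_const_mult: "arep L (sconst c * f) = free_const c * arep L f"
  by (induction f rule: poly_mapping_add_induct)
    (simp_all add: arep_single arep_add sconst_def mult_single free_const_mult mult.assoc distrib_left)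

lemma arep_1 [simp]: "arep L 1 = 1"
proof -
  have "prod_list (map (\<lambda>v. 1 :: free_elt) vs) = 1" for vs :: "svar list"
    by (induction vs) simp_all
  then show ?thesis using arep_single[of L 0 1] by (simp add: mrep_def)
qed

lemma fa_arep:
  assumes "finite L"
  shows "arep L f \<in> FA L"
  unfolding arep_def linext_def mrep_def
  by (intro fa_sum fa_mult fa_const fa_prod_list fa_power fa_svar_rep) (simp add: svar_list assms)

section \<open>Wedges indexed by subsets, and their span over the scalars\<close>

definition vlist :: "bool \<times> nat set \<Rightarrow> vvar list" where
  "vlist x = (if fst x then [VX] else []) @ map VY (sorted_list_of_set (snd x))"

definition vset :: "bool \<times> nat set \<Rightarrow> vvar set" where
  "vset x = (if fst x then {VX} else {}) \<union> VY ` snd x"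

abbreviation wed :: "bool \<times> nat set \<Rightarrow> free_elt" where
  "wed x \<equiv> wedge (map gen (vlist x))"

text \<open>Pairs indexing all \<open>y\<^sub>I\<close> (first component false) and all \<open>x \<and> y\<^sub>I\<close> (first component
  true).\<close>

abbreviation BX :: "nat set \<Rightarrow> (bool \<times> nat set) set" where
  "BX L \<equiv> UNIV \<times> Pow L"

lemma vlist:
  assumes "finite L" "x \<in> BX L"
  shows "set (vlist x) = vset x" "distinct (vlist x)"
    "sorted_wrt (\<lambda>u v. vord u < vord v) (vlist x)" "vset x \<subseteq> VL L"
proof -
  obtain b I where x: "x = (b, I)" "I \<subseteq> L" using assms by auto
  then have I: "finite I" using assms finite_subset by blast
  then show "set (vlist x) = vset x" "distinct (vlist x)" "vset x \<subseteq> VL L"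
    using x by (auto simp: vlist_def vset_def distinct_map inj_on_def)
  have "sorted_wrt (\<lambda>u v. vord u < vord v) (map VY (sorted_list_of_set I))"
    using strict_sorted_list_of_set[of I] by (simp add: sorted_wrt_map)
  then show "sorted_wrt (\<lambda>u v. vord u < vord v) (vlist x)"
    using x by (auto simp: vlist_def)
qed

lemma vset_of: "vset (VX \<in> S, {i. VY i \<in> S}) = S"
proof (rule Set.set_eqI)
  fix v show "v \<in> vset (VX \<in> S, {i. VY i \<in> S}) \<longleftrightarrow> v \<in> S"
    by (cases v) (auto simp: vset_def)
qed

lemma vset_inj: "vset x = vset y \<Longrightarrow> x = y"
proof -
  assume eq: "vset x = vset y"
  have "fst x \<longleftrightarrow> VX \<in> vset x" "snd x = {i. VY i \<in> vset x}" for x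
    by (auto simp: vset_def)
  with eq show "x = y" by (simp add: prod_eq_iff)
qed

lemma fa_wed: "finite L \<Longrightarrow> x \<in> BX L \<Longrightarrow> wed x \<in> FA L"
  by (rule fa_wedge) (use vlist in auto)

lemma finite_BX: "finite L \<Longrightarrow> finite (BX L)"
  by (simp add: finite_cartesian_product)

definition lin_comb :: "nat set \<Rightarrow> (bool \<times> nat set \<Rightarrow> scalar) \<Rightarrow> free_elt" where
  "lin_comb L A = (\<Sum>x\<in>BX L. wed x * arep L (A x))"

text \<open>The preimage in the free algebra of the span of the wedges. Working with representatives
  keeps ordinary sums and words available.\<close>

definition wspan :: "nat set \<Rightarrow> free_elt set" where
  "wspan L = {f \<in> FA L. \<exists>A. A \<in> BX L \<rightarrow> polys_in (sv L) \<and> f - lin_comb L A \<in> radial_ideal (VL L)}"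

lemma wspanI:
  "f \<in> FA L \<Longrightarrow> A \<in> BX L \<rightarrow> polys_in (sv L) \<Longrightarrow> f - lin_comb L A \<in> radial_ideal (VL L) \<Longrightarrow> f \<in> wspan L"
  by (auto simp: wspan_def)

lemma wspanE:
  assumes "f \<in> wspan L"
  obtains A where "f \<in> FA L" "A \<in> BX L \<rightarrow> polys_in (sv L)" "f - lin_comb L A \<in> radial_ideal (VL L)"
  using assms by (auto simp: wspan_def)

lemma wspan_zero: "0 \<in> wspan L"
  by (auto simp: wspan_def lin_comb_def intro!: exI[of _ "\<lambda>_. 0"])

lemma wspan_ideal: "f \<in> radial_ideal (VL L) \<Longrightarrow> f \<in> wspan L"
  by (auto simp: wspan_def lin_comb_def ri_carrier intro!: exI[of _ "\<lambda>_. 0"])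

lemma wspan_add:
  assumes "f \<in> wspan L" "g \<in> wspan L"
  shows "f + g \<in> wspan L"
proof -
  obtain A where A: "f \<in> FA L" "A \<in> BX L \<rightarrow> polys_in (sv L)" "f - lin_comb L A \<in> radial_ideal (VL L)"
    using assms(1) by (rule wspanE)
  obtain B where B: "g \<in> FA L" "B \<in> BX L \<rightarrow> polys_in (sv L)" "g - lin_comb L B \<in> radial_ideal (VL L)"
    using assms(2) by (rule wspanE)
  have eq: "(f - lin_comb L A) + (g - lin_comb L B) = f + g - lin_comb L (\<lambda>x. A x + B x)"
    by (simp add: lin_comb_def arep_add algebra_simps sum.distrib)
  have "f + g - lin_comb L (\<lambda>x. A x + B x) \<in> radial_ideal (VL L)"
    unfolding eq[symmetric] by (rule ri_add[OF A(3) B(3)])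
  moreover have "(\<lambda>x. A x + B x) \<in> BX L \<rightarrow> polys_in (sv L)"
    using A B by (auto intro!: polys_in_add)
  ultimately show ?thesis
    by (rule wspanI[OF fa_add[OF A(1) B(1)], rotated])
qed

lemma wspan_const:
  assumes "f \<in> wspan L"
  shows "free_const c * f \<in> wspan L"
proof -
  obtain A where A: "f \<in> FA L" "A \<in> BX L \<rightarrow> polys_in (sv L)" "f - lin_comb L A \<in> radial_ideal (VL L)"
    using assms by (rule wspanE)
  have eq: "free_const c * (f - lin_comb L A) = free_const c * f - lin_comb L (\<lambda>x. sconst c * A x)"
  proof -
    have "free_const c * (wed x * arep L (A x)) = wed x * (free_const c * arep L (A x))" for x
      by (metis free_const_commute mult.assoc)
    then show ?thesis
      by (simp add: lin_comb_def arep_const_mult right_diff_distrib sum_distrib_left)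
  qed
  show ?thesis
  proof (rule wspanI)
    show "(\<lambda>x. sconst c * A x) \<in> BX L \<rightarrow> polys_in (sv L)"
      using A by (auto intro!: polys_in_mult)
    show "free_const c * f - lin_comb L (\<lambda>x. sconst c * A x) \<in> radial_ideal (VL L)"
      unfolding eq[symmetric] by (intro ri_lmult A fa_const)
  qed (intro fa_mult A fa_const)
qed

lemma wspan_uminus: "f \<in> wspan L \<Longrightarrow> - f \<in> wspan L"
proof -
  have "free_const (- 1) = - 1" by (simp add: free_const_def single_uminus)
  then show "f \<in> wspan L \<Longrightarrow> - f \<in> wspan L" using wspan_const[of f L "- 1"] by simp
qed

lemma wspan_svar_rep:
  assumes L: "finite L" and f: "f \<in> wspan L" and v: "v \<in> sv L"
  shows "f * svar_rep v \<in> wspan L"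
proof -
  obtain A where A: "f \<in> FA L" "A \<in> BX L \<rightarrow> polys_in (sv L)" "f - lin_comb L A \<in> radial_ideal (VL L)"
    using f by (rule wspanE)
  have eq: "(f - lin_comb L A) * svar_rep v + (\<Sum>x\<in>BX L. wed x * (arep L (A x) * svar_rep v - arep L (A x * pvar v)))
    = f * svar_rep v - lin_comb L (\<lambda>x. A x * pvar v)"
    by (simp add: lin_comb_def algebra_simps sum_subtractf sum_distrib_right)
  show ?thesis
  proof (rule wspanI)
    show "(\<lambda>x. A x * pvar v) \<in> BX L \<rightarrow> polys_in (sv L)"
      using A v by (auto intro!: polys_in_mult polys_in_pvar)
    show "f * svar_rep v - lin_comb L (\<lambda>x. A x * pvar v) \<in> radial_ideal (VL L)"
      unfolding eq[symmetric]
      by (intro ri_add ri_rmult A ri_sum ri_lmult arep_mult_pvar fa_svar_rep fa_wed L v)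
  qed (intro fa_mult A fa_svar_rep v)
qed

lemma wspan_wed:
  assumes L: "finite L" and x: "x \<in> BX L"
  shows "wed x \<in> wspan L"
proof -
  have "lin_comb L (\<lambda>y. if y = x then 1 else 0) = (\<Sum>y\<in>BX L. if y = x then wed x else 0)"
    unfolding lin_comb_def by (rule sum.cong) auto
  also have "\<dots> = wed x" using x finite_BX[OF L] by simp
  finally show ?thesis
    using fa_wed[OF L x] by (auto simp: wspan_def intro!: exI[of _ "\<lambda>y. if y = x then 1 else 0"])
qed

text \<open>The second alternative is for {x, x}, which is 2 r; every other anticommutator of
  generators is itself a scalar variable.\<close>

lemma acomm_svar_rep:
  assumes "u \<in> VL L" "v \<in> VL L"
  obtains w where "w \<in> sv L" "acomm (gen u) (gen v) = svar_rep w \<or> acomm (gen u) (gen v) = svar_rep w + svar_rep w"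
proof -
  have c: "acomm a b = acomm b a" for a b by (simp add: acomm_def add.commute)
  show thesis
  proof (cases u; cases v)
    assume "u = VX" "v = VX"
    then show thesis by (intro that[of SR]) (auto simp: sv_def acomm_def)
  next
    fix j assume "u = VX" "v = VY j"
    then show thesis using assms by (intro that[of "SS j"]) (auto simp: sv_def)
  next
    fix i assume "u = VY i" "v = VX"
    then show thesis using assms by (intro that[of "SS i"]) (auto simp: sv_def c)
  next
    fix i j assume "u = VY i" "v = VY j"
    then show thesis using assms
      by (intro that[of "SC (min i j) (max i j)"]) (auto simp: sv_def min_def max_def c)
  qed
qed

lemma wspan_acomm:
  assumes "finite L" "f \<in> wspan L" "u \<in> VL L" "v \<in> VL L"
  shows "f * acomm (gen u) (gen v) \<in> wspan L"
proof -
  obtain w where "w \<in> sv L"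
    "acomm (gen u) (gen v) = svar_rep w \<or> acomm (gen u) (gen v) = svar_rep w + svar_rep w"
    using acomm_svar_rep assms by blast
  then show ?thesis
    using wspan_svar_rep[of L f w] assms by (auto simp: distrib_left intro: wspan_add)
qed

lemma wspan_sum: "(\<And>i. i \<in> I \<Longrightarrow> f i \<in> wspan L) \<Longrightarrow> sum f I \<in> wspan L"
  by (induction I rule: infinite_finite_induct) (auto intro: wspan_add wspan_zero)

text \<open>Induction on the length. An adjacent swap costs a word with two letters fewer times a
  central anticommutator, so words of a given length alternate modulo the span. A word with a
  repeated letter is then in the span, and any other word is, up to sign, congruent to the sorted
  word and hence to its wedge.\<close>

lemma wspan_wmon:
  assumes L: "finite L"
  shows "set vs \<subseteq> VL L \<Longrightarrow> wmon vs \<in> wspan L"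
proof (induction "length vs" arbitrary: vs rule: less_induct)
  case (less vs)
  define n where "n = length vs"
  interpret alternating_mod wmon "wspan L" n "VL L"
  proof
    fix as bs u v
    assume *: "set as \<subseteq> VL L" "u \<in> VL L" "v \<in> VL L" "set bs \<subseteq> VL L" "length as + length bs + 2 = n"
    let ?c = "acomm (gen u) (gen v)"
    \<comment> \<open>The anticommutator created by the swap stands in the middle of the word;
      centrality moves it to the end, where the span is closed under multiplication by it.\<close>
    have "wmon (as @ bs) * ?c \<in> wspan L"
      using less.hyps[of "as @ bs"] * by (intro wspan_acomm L) (auto simp: n_def)
    moreover have "wmon as * (?c * wmon bs - wmon bs * ?c) \<in> wspan L"
      using * by (intro wspan_ideal ri_lmult acomm_gen_central fa_wmon)
    moreover have "wmon (as @ u # v # bs) + wmon (as @ v # u # bs)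
      = wmon (as @ bs) * ?c + wmon as * (?c * wmon bs - wmon bs * ?c)"
      by (simp add: wmon_append wmon_Cons acomm_def algebra_simps)
    ultimately show "wmon (as @ u # v # bs) + wmon (as @ v # u # bs) \<in> wspan L"
      by (simp only: wspan_add)
  qed (auto intro: wspan_zero wspan_add wspan_uminus)
  show "wmon vs \<in> wspan L"
  proof (cases "distinct vs")
    case False
    then obtain i j where ij: "i < n" "j < n" "i \<noteq> j" "vs ! i = vs ! j"
      by (auto simp: distinct_conv_nth n_def)
    \<comment> \<open>Exchanging two equal letters does not change the word, so twice the word lies
      in the span, and 2 is invertible.\<close>
    then have "wmon vs + wmon vs \<in> wspan L"
      using exchange_nth[of vs i j] less.prems by (simp add: n_def) (metis list_update_id)
    from wspan_const[OF this, of "real_coeff (1/2)"] show ?thesis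
      by (simp only: two_half_const)
  next
    case True
    define x where "x = (VX \<in> set vs, {i. VY i \<in> set vs})"
    have x: "x \<in> BX L" using less.prems by (auto simp: x_def)
    have "vset x = set vs" unfolding x_def by (rule vset_of)
    then have s: "set (vlist x) = set vs" using vlist(1)[OF L x] by simp
    then have "mset vs = mset (vlist x)"
      using True vlist(2)[OF L x] set_eq_iff_mset_eq_distinct by blast
    then have len: "length (vlist x) = n" using n_def mset_eq_length by metis
    obtain p where p: "p permutes {..<n}" "permute_list p (vlist x) = vs"
      using mset_eq_permutation[OF \<open>mset vs = mset (vlist x)\<close>] len by blast
    let ?us = "vlist x"
    have sgn: "of_int (sign p) * f \<in> wspan L" if "f \<in> wspan L" for p :: "nat \<Rightarrow> nat" and f
      using that by (simp add: sign_def wspan_uminus)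
    \<comment> \<open>Every signed rearrangement is congruent to the sorted word; averaging the
      congruences compares that word with its wedge.\<close>
    have "(\<Sum>p | p permutes {..<n}. of_int (sign p) * (wmon (permute_list p ?us) - of_int (sign p) * wmon ?us)) \<in> wspan L"
      using permute[of _ ?us] s less.prems len by (intro wspan_sum sgn) auto
    also have "(\<Sum>p | p permutes {..<n}. of_int (sign p) * (wmon (permute_list p ?us) - of_int (sign p) * wmon ?us))
      = (\<Sum>p | p permutes {..<n}. of_int (sign p) * wmon (permute_list p ?us) - wmon ?us)"
      by (rule sum.cong) (auto simp: sign_def)
    also have "\<dots> = (\<Sum>p | p permutes {..<n}. of_int (sign p) * wmon (permute_list p ?us)) - of_nat (fact n) * wmon ?us"
      by (simp add: sum_subtractf card_permutations[of _ n])
    finally have "free_const (real_coeff (1 / fact n)) *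
      ((\<Sum>p | p permutes {..<n}. of_int (sign p) * wmon (permute_list p ?us)) - of_nat (fact n) * wmon ?us) \<in> wspan L"
      by (rule wspan_const)
    moreover have "free_const (real_coeff (1 / fact n)) * (of_nat (fact n) * wmon ?us) = wmon ?us"
    proof -
      have "free_const (real_coeff (1 / fact n)) * of_nat (fact n) = free_const (real_coeff (1 / fact n) * of_nat (fact n))"
        by (simp add: free_const_mult) (simp add: free_const_def)
      then show ?thesis by (simp only: real_coeff_inv_fact free_const_1 mult_1 mult.assoc[symmetric])
    qed
    ultimately have "wed x - wmon ?us \<in> wspan L"
      by (simp add: wedge_gen len right_diff_distrib)
    from wspan_add[OF wspan_uminus[OF this] wspan_wed[OF L x]] have "wmon ?us \<in> wspan L" by simp
    from wspan_add[OF permute[OF p(1) len] sgn[OF this, of p]] show ?thesis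
      using p s less.prems by simp
  qed
qed

lemma wspan_eq: "finite L \<Longrightarrow> wspan L = FA L"
proof
  assume L: "finite L"
  show "FA L \<subseteq> wspan L"
  proof
    fix f assume "f \<in> FA L"
    then have "(\<Sum>w\<in>Poly_Mapping.keys f. free_const (Poly_Mapping.lookup f w) * wmon (letters w)) \<in> wspan L"
      by (intro wspan_sum wspan_const wspan_wmon[OF L]) (auto simp: mem_free_algebra)
    then show "f \<in> wspan L" by (simp add: free_elt_sum)
  qed
qed (auto simp: wspan_def)

subsection \<open>Freeness over the scalars\<close>

definition mvec :: "nat set \<Rightarrow> (bool \<times> nat set \<Rightarrow> scalar) \<Rightarrow> vvar set \<Rightarrow> scalar" where
  "mvec L A = (\<Sum>x\<in>BX L. scale (A x) (ev (vset x)))"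

lemma mvec_apply:
  assumes "finite L" "x \<in> BX L"
  shows "mvec L A (vset x) = A x"
proof -
  have "mvec L A (vset x) = (\<Sum>y\<in>BX L. if y = x then A x else 0)"
    unfolding mvec_def sum_fun_apply
    by (rule sum.cong) (auto simp: scale_def ev_def dest: vset_inj)
  then show ?thesis using assms finite_BX by simp
qed

lemma ract_lin_comb:
  assumes "finite M" "L \<subseteq> M" "A \<in> BX L \<rightarrow> polys_in (sv L)"
  shows "ract (VL M) (ev {}) (lin_comb L A) = mvec L A"
  unfolding lin_comb_def mvec_def ract_sum
proof (rule sum.cong)
  fix x assume x: "x \<in> BX L"
  have L: "finite L" using assms finite_subset by blast
  have "vset x \<subseteq> VL M" using vlist(4)[OF L x] assms(2) by blast
  then have "ract (VL M) (ev {}) (wed x) = ev (vset x)"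
    using ract_wedge[of "VL M" "vlist x"] vlist[OF L x] assms(1) by auto
  then show "ract (VL M) (ev {}) (wed x * arep L (A x)) = scale (A x) (ev (vset x))"
    using ract_arep[OF assms(1,2), of "A x"] assms(3) x by (auto simp: ract_mult)
qed simp

lemma fa_lin_comb: "finite L \<Longrightarrow> lin_comb L A \<in> FA L"
  unfolding lin_comb_def by (intro fa_sum fa_mult fa_wed fa_arep)

text \<open>The action on the vacuum separates classes: an element is congruent to a combination of
  wedges, and the vector obtained from the vacuum lists the coefficients of that
  combination.\<close>

theorem cls_eq_iff_ract:
  assumes M: "finite M" "L \<subseteq> M" and f: "f \<in> FA L" and g: "g \<in> FA L"
  shows "cls L f = cls L g \<longleftrightarrow> ract (VL M) (ev {}) f = ract (VL M) (ev {}) g"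
proof -
  have L: "finite L" using M finite_subset by blast
  have VL: "finite (VL M)" "VL L \<subseteq> VL M" using M by auto
  have ker: "h \<in> radial_ideal (VL L)" if h: "h \<in> FA L" "ract (VL M) (ev {}) h = 0" for h
  proof -
    have "h \<in> wspan L" using h wspan_eq[OF L] by simp
    then obtain A where A: "A \<in> BX L \<rightarrow> polys_in (sv L)" "h - lin_comb L A \<in> radial_ideal (VL L)"
      by (rule wspanE)
    from ract_radial_ideal[OF VL A(2), of "ev {}"] have "mvec L A = 0"
      using ract_lin_comb[OF M A(1)] h by (simp add: ract_diff)
    then have "A x = 0" if "x \<in> BX L" for x
      using mvec_apply[OF L that, of A] by simp
    then have "lin_comb L A = 0" by (simp add: lin_comb_def)
    with A show ?thesis by simp
  qed
  show ?thesis
    unfolding cls_eq_iff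
    using ker[of "f - g"] fa_diff[OF f g] ract_radial_ideal[OF VL, of "f - g" "ev {}"]
    by (auto simp: ract_diff)
qed

subsection \<open>Supports and degrees\<close>

text \<open>The s_i are restricted to J but the c_ij run over all of L, since the c_ij do not count
  for the x-support.\<close>

definition svJ :: "nat set \<Rightarrow> nat set \<Rightarrow> svar set" where
  "svJ J L = {SR} \<union> SS ` J \<union> {SC i j | i j. i \<in> L \<and> j \<in> L \<and> i \<le> j}"

lemma svJ_intros:
  "SR \<in> svJ J L" "i \<in> J \<Longrightarrow> SS i \<in> svJ J L" "i \<in> L \<Longrightarrow> j \<in> L \<Longrightarrow> SC (min i j) (max i j) \<in> svJ J L"
  by (auto simp: svJ_def min_def max_def)

lemma svJ_same: "svJ L L = sv L"
  by (simp add: svJ_def sv_def)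

definition VJ :: "nat set \<Rightarrow> nat set \<Rightarrow> (vvar set \<Rightarrow> scalar) set" where
  "VJ L J = {\<phi>. \<forall>S. \<forall>m\<in>Poly_Mapping.keys (\<phi> S). S \<subseteq> VL J \<and> Poly_Mapping.keys m \<subseteq> svJ J L}"

definition vdeg :: "vvar set \<Rightarrow> nat" where
  "vdeg S = (if VX \<in> S then 1 else 0)"

definition VH :: "nat \<Rightarrow> (vvar set \<Rightarrow> scalar) set" where
  "VH k = {\<phi>. \<forall>S. \<forall>m\<in>Poly_Mapping.keys (\<phi> S). vdeg S + mwt m = k}"

text \<open>The coordinate form of the filtered piece \<open>Filt L k J\<close>.\<close>

definition VG :: "nat set \<Rightarrow> nat \<Rightarrow> nat set \<Rightarrow> (vvar set \<Rightarrow> scalar) set" where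
  "VG L k J = VJ L J \<inter> VH k"

lemma VJ_I: "(\<And>S m. m \<in> Poly_Mapping.keys (\<phi> S) \<Longrightarrow> S \<subseteq> VL J \<and> Poly_Mapping.keys m \<subseteq> svJ J L) \<Longrightarrow> \<phi> \<in> VJ L J"
  by (simp add: VJ_def)

lemma VJ_D: "\<phi> \<in> VJ L J \<Longrightarrow> m \<in> Poly_Mapping.keys (\<phi> S) \<Longrightarrow> S \<subseteq> VL J \<and> Poly_Mapping.keys m \<subseteq> svJ J L"
  by (simp add: VJ_def)

lemma VJ_polys: "\<phi> \<in> VJ L J \<Longrightarrow> \<phi> S \<in> polys_in (svJ J L)"
  by (auto simp: VJ_def polys_in_def)

lemma VJ_outside: "\<phi> \<in> VJ L J \<Longrightarrow> \<not> S \<subseteq> VL J \<Longrightarrow> \<phi> S = 0"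
  using VJ_D[of \<phi> L J _ S] by (metis keys_eq_empty ex_in_conv)

lemma VH_I: "(\<And>S m. m \<in> Poly_Mapping.keys (\<phi> S) \<Longrightarrow> vdeg S + mwt m = k) \<Longrightarrow> \<phi> \<in> VH k"
  by (simp add: VH_def)

lemma VH_D: "\<phi> \<in> VH k \<Longrightarrow> m \<in> Poly_Mapping.keys (\<phi> S) \<Longrightarrow> vdeg S + mwt m = k"
  by (simp add: VH_def)

lemma VJ_0 [simp]: "0 \<in> VJ L J" and VH_0 [simp]: "0 \<in> VH k" and VG_0 [simp]: "0 \<in> VG L k J"
  by (simp_all add: VJ_def VH_def VG_def)

lemma keys_add_D: "m \<in> Poly_Mapping.keys (f + g) \<Longrightarrow> m \<in> Poly_Mapping.keys f \<or> m \<in> Poly_Mapping.keys g"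
  using keys_add[of f g] by blast

lemma VJ_add: "\<phi> \<in> VJ L J \<Longrightarrow> \<psi> \<in> VJ L J \<Longrightarrow> \<phi> + \<psi> \<in> VJ L J"
proof (rule VJ_I)
  fix S m
  assume \<phi>: "\<phi> \<in> VJ L J" and \<psi>: "\<psi> \<in> VJ L J" and "m \<in> Poly_Mapping.keys ((\<phi> + \<psi>) S)"
  then have "m \<in> Poly_Mapping.keys (\<phi> S) \<or> m \<in> Poly_Mapping.keys (\<psi> S)"
    by (simp add: keys_add_D)
  then show "S \<subseteq> VL J \<and> Poly_Mapping.keys m \<subseteq> svJ J L"
    using VJ_D[OF \<phi>] VJ_D[OF \<psi>] by blast
qed

lemma VH_add: "\<phi> \<in> VH k \<Longrightarrow> \<psi> \<in> VH k \<Longrightarrow> \<phi> + \<psi> \<in> VH k"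
proof (rule VH_I)
  fix S m
  assume \<phi>: "\<phi> \<in> VH k" and \<psi>: "\<psi> \<in> VH k" and "m \<in> Poly_Mapping.keys ((\<phi> + \<psi>) S)"
  then have "m \<in> Poly_Mapping.keys (\<phi> S) \<or> m \<in> Poly_Mapping.keys (\<psi> S)"
    by (simp add: keys_add_D)
  then show "vdeg S + mwt m = k"
    using VH_D[OF \<phi>] VH_D[OF \<psi>] by blast
qed

lemma VG_add: "\<phi> \<in> VG L k J \<Longrightarrow> \<psi> \<in> VG L k J \<Longrightarrow> \<phi> + \<psi> \<in> VG L k J"
  by (simp add: VG_def VJ_add VH_add)

lemmas VJ_sum = sum_in_closed[OF VJ_0 VJ_add]
lemmas VH_sum = sum_in_closed[OF VH_0 VH_add]
lemmas VG_sum = sum_in_closed[OF VG_0 VG_add]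

lemma VJ_scale: "\<phi> \<in> VJ L J \<Longrightarrow> t \<in> polys_in (svJ J L) \<Longrightarrow> scale t \<phi> \<in> VJ L J"
  by (rule VJ_I) (force simp: scale_def polys_in_def keys_add_nat elim!: keys_mult_polys dest: VJ_D)

definition wpoly :: "nat \<Rightarrow> scalar set" where
  "wpoly d = {f. \<forall>m\<in>Poly_Mapping.keys f. mwt m = d}"

lemma VH_scale: "\<phi> \<in> VH k \<Longrightarrow> t \<in> wpoly d \<Longrightarrow> scale t \<phi> \<in> VH (k + d)"
  by (rule VH_I) (fastforce simp: scale_def wpoly_def elim!: keys_mult_polys dest: VH_D)

lemma wpoly_sconst [simp]: "sconst c \<in> wpoly 0"
  by (simp add: wpoly_def sconst_def)

lemma wpoly_mult: "f \<in> wpoly a \<Longrightarrow> g \<in> wpoly b \<Longrightarrow> f * g \<in> wpoly (a + b)"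
  by (auto simp: wpoly_def elim!: keys_mult_polys)

lemma VG_scale:
  "\<phi> \<in> VG L k J \<Longrightarrow> t \<in> polys_in (svJ J L) \<Longrightarrow> t \<in> wpoly d \<Longrightarrow> scale t \<phi> \<in> VG L (k + d) J"
  by (simp add: VG_def VJ_scale VH_scale)

section \<open>Clifford operators add x-degrees and respect supports\<close>

fun vwt :: "vvar \<Rightarrow> nat" where "vwt VX = 1" | "vwt (VY i) = 0"

lemma keys_sg_mult: "Poly_Mapping.keys (sg U v S * f) = Poly_Mapping.keys f"
proof -
  have "sg U v S = 1 \<or> sg U v S = - 1"
    by (cases "even (card {w \<in> S \<inter> U. vord v < vord w})") (auto simp: sg_def)
  then show ?thesis by auto
qed

text \<open>This makes contraction homogeneous: deleting u loses the degree of u, while the form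
  restores it and adds the degree of v.\<close>

lemma bform_wpoly: "bform u v \<in> wpoly (vwt u + vwt v)"
proof -
  have pv: "pvar w \<in> wpoly (wt w)" for w by (simp add: wpoly_def pvar_def)
  have "ac_var u v \<in> wpoly (vwt u + vwt v)"
  proof -
    have "sconst 2 * pvar SR \<in> wpoly (Suc (Suc 0))"
      using wpoly_mult[OF wpoly_sconst pv, of 2 SR] by (simp add: numeral_2_eq_2)
    moreover have "pvar (SS i) \<in> wpoly (Suc 0)" "pvar (SC i j) \<in> wpoly 0" for i j
      using pv[of "SS i"] pv[of "SC i j"] by simp_all
    ultimately show ?thesis by (cases u; cases v) (simp_all add: numeral_2_eq_2)
  qed
  from wpoly_mult[OF wpoly_sconst this] show ?thesis by (simp add: bform_def)
qed

lemma bform_polys: "u \<in> VL J \<Longrightarrow> v \<in> VL J \<Longrightarrow> J \<subseteq> L \<Longrightarrow> bform u v \<in> polys_in (svJ J L)"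
  unfolding bform_def
  by (rule polys_in_mult, simp, cases u; cases v)
    (auto intro!: polys_in_mult polys_in_pvar svJ_intros)

lemma vdeg_insert: "v \<notin> S \<Longrightarrow> vdeg (insert v S) = vdeg S + vwt v"
  by (cases v) (auto simp: vdeg_def)

lemma VH_create: "\<phi> \<in> VH k \<Longrightarrow> create U v \<phi> \<in> VH (k + vwt v)"
proof (rule VH_I)
  fix S m assume \<phi>: "\<phi> \<in> VH k" and m: "m \<in> Poly_Mapping.keys (create U v \<phi> S)"
  then have v: "v \<in> S" and "m \<in> Poly_Mapping.keys (\<phi> (S - {v}))"
    by (auto simp: create_def keys_sg_mult split: if_splits)
  with \<phi> have "vdeg (S - {v}) + mwt m = k" using VH_D by blast
  moreover have "vdeg S = vdeg (S - {v}) + vwt v"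
    using vdeg_insert[of v "S - {v}"] v by (simp add: insert_absorb)
  ultimately show "vdeg S + mwt m = k + vwt v" by simp
qed

lemma VH_annih: "\<phi> \<in> VH (k + vwt u) \<Longrightarrow> annih U u \<phi> \<in> VH k"
proof (rule VH_I)
  fix S m assume \<phi>: "\<phi> \<in> VH (k + vwt u)" and m: "m \<in> Poly_Mapping.keys (annih U u \<phi> S)"
  then have u: "u \<notin> S" and "m \<in> Poly_Mapping.keys (\<phi> (insert u S))"
    by (auto simp: annih_def keys_sg_mult split: if_splits)
  with \<phi> have "vdeg (insert u S) + mwt m = k + vwt u" using VH_D by blast
  then show "vdeg S + mwt m = k" using vdeg_insert[OF u] by simp
qed

text \<open>Degrees are natural numbers, so the case in which an annihilation operator would make
  the degree negative is separate; the result is then zero.\<close>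

lemma VH_annih_0:
  assumes "\<phi> \<in> VH k" "k < vwt u" shows "annih U u \<phi> = 0"
proof
  fix S
  show "annih U u \<phi> S = 0 S"
  proof (rule ccontr)
    assume "annih U u \<phi> S \<noteq> 0 S"
    then have "u \<notin> S" "\<phi> (insert u S) \<noteq> 0" by (auto simp: annih_def split: if_splits)
    then obtain m where "m \<in> Poly_Mapping.keys (\<phi> (insert u S))" by fastforce
    from VH_D[OF assms(1) this] vdeg_insert[OF \<open>u \<notin> S\<close>] assms(2) show False by simp
  qed
qed

lemma VH_rho: "\<phi> \<in> VH k \<Longrightarrow> rho U v \<phi> \<in> VH (k + vwt v)"
  unfolding rho_def contract_eq
proof (intro VH_add VH_create VH_sum)
  fix u assume \<phi>: "\<phi> \<in> VH k"
  show "scale (bform u v) (annih U u \<phi>) \<in> VH (k + vwt v)"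
  proof (cases "k < vwt u")
    case True
    then show ?thesis using VH_annih_0[OF \<phi>] by simp
  next
    case False
    then have "annih U u \<phi> \<in> VH (k - vwt u)" using \<phi> by (intro VH_annih) simp
    from VH_scale[OF this bform_wpoly[of u v]] show ?thesis using False by simp
  qed
qed

lemma VJ_rho:
  assumes "\<phi> \<in> VJ L J" "v \<in> VL J" "J \<subseteq> L"
  shows "rho U v \<phi> \<in> VJ L J"
  unfolding rho_def contract_eq
proof (intro VJ_add VJ_sum)
  show "create U v \<phi> \<in> VJ L J"
  proof (rule VJ_I)
    fix S m assume "m \<in> Poly_Mapping.keys (create U v \<phi> S)"
    then have "v \<in> S" "m \<in> Poly_Mapping.keys (\<phi> (S - {v}))"
      by (auto simp: create_def keys_sg_mult split: if_splits)
    with VJ_D[OF assms(1)] assms(2) show "S \<subseteq> VL J \<and> Poly_Mapping.keys m \<subseteq> svJ J L" by blast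
  qed
  fix u
  have a: "annih U u \<phi> \<in> VJ L J"
  proof (rule VJ_I)
    fix S m assume "m \<in> Poly_Mapping.keys (annih U u \<phi> S)"
    then have "m \<in> Poly_Mapping.keys (\<phi> (insert u S))"
      by (auto simp: annih_def keys_sg_mult split: if_splits)
    with VJ_D[OF assms(1)] show "S \<subseteq> VL J \<and> Poly_Mapping.keys m \<subseteq> svJ J L" by blast
  qed
  show "scale (bform u v) (annih U u \<phi>) \<in> VJ L J"
  proof (cases "u \<in> VL J")
    case True
    then show ?thesis by (intro VJ_scale a bform_polys assms)
  next
    case False
    \<comment> \<open>A variable outside the support cannot be deleted, so the terms of the
      contraction belonging to the rest of U vanish.\<close>
    then have "annih U u \<phi> = 0" using VJ_outside[OF assms(1)] by (auto simp: annih_def)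
    then show ?thesis by simp
  qed
qed

lemma VG_rho:
  assumes "\<phi> \<in> VG L k J" "v \<in> VL J" "J \<subseteq> L"
  shows "rho U v \<phi> \<in> VG L (k + vwt v) J"
  using assms by (simp add: VG_def VJ_rho VH_rho)

lemma VG_ev: "S \<subseteq> VL J \<Longrightarrow> ev S \<in> VG L (vdeg S) J"
  by (auto simp: VG_def VJ_def VH_def ev_def)

subsection \<open>The operator in coordinates\<close>

lemma jack_polys: "f \<in> polys_in V \<Longrightarrow> jack P u f \<in> polys_in V"
  by (force simp: polys_in_def keys_add_nat elim!: keys_jack)

lemma jack_wpoly: "f \<in> wpoly (d + wt u) \<Longrightarrow> jack P u f \<in> wpoly d"
  by (fastforce simp: wpoly_def elim!: keys_jack)

lemma jack_eq_0: "(\<And>m. m \<in> Poly_Mapping.keys f \<Longrightarrow> u \<notin> Poly_Mapping.keys m) \<Longrightarrow> jack P u f = 0"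
proof (rule ccontr)
  assume *: "\<And>m. m \<in> Poly_Mapping.keys f \<Longrightarrow> u \<notin> Poly_Mapping.keys m" and "jack P u f \<noteq> 0"
  then obtain n where "n \<in> Poly_Mapping.keys (jack P u f)" by fastforce
  then obtain m where "m \<in> Poly_Mapping.keys f" "m = n + Poly_Mapping.single u 1" by (rule keys_jack)
  with *[of m] show False by (simp add: keys_add_nat)
qed

lemma T_op_polys: "f \<in> polys_in V \<Longrightarrow> T_op P u f \<in> polys_in V"
  using keys_T_op[of P u f] by (auto simp: polys_in_def)

lemma T_op_wpoly: "f \<in> wpoly d \<Longrightarrow> T_op P u f \<in> wpoly d"
  using keys_T_op[of P u f] by (auto simp: wpoly_def)

text \<open>In coordinates, \<open>Dsc M \<phi> A\<close> is \<open>F \<partial>\<^sup>s\<^sup>c A\<close> for the element \<open>F\<close> with coordinates \<open>\<phi>\<close>, \<open>Dx M I B\<close> is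
  the derivative of \<open>(x \<and> y\<^sub>I) B\<close>, \<open>Dop\<close> is the right derivative and \<open>Kop\<close> is the operator
  \<open>\<K>\<close>. The set \<open>M\<close> of all available variables may exceed the set \<open>L\<close> of the algebra at hand: the
  additional terms vanish on elements of the smaller algebra.\<close>

definition Dsc :: "nat set \<Rightarrow> (vvar set \<Rightarrow> scalar) \<Rightarrow> scalar \<Rightarrow> vvar set \<Rightarrow> scalar" where
  "Dsc M \<phi> A = scale (sconst (1 + q) * jack (q\<^sup>2) SR A) (rho (VL M) VX \<phi>)
     + (\<Sum>i\<in>M. scale (sconst 2 * T_op (q\<^sup>2) SR (jack q (SS i) A)) (rho (VL M) (VY i) \<phi>))"

definition Dx :: "nat set \<Rightarrow> nat set \<Rightarrow> scalar \<Rightarrow> vvar set \<Rightarrow> scalar" where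
  "Dx M I B = scale (sconst ((-1) ^ card I * qnum_m (- int (card I))) * B) (ev (vset (False, I)))
     + scale (sconst (qpow_m (- int (card I)))) (Dsc M (ev (vset (True, I))) B)"

definition Dop :: "nat set \<Rightarrow> (vvar set \<Rightarrow> scalar) \<Rightarrow> vvar set \<Rightarrow> scalar" where
  "Dop M \<psi> = (\<Sum>I\<in>Pow M. Dsc M (ev (vset (False, I))) (\<psi> (vset (False, I))))
     + (\<Sum>I\<in>Pow M. Dx M I (\<psi> (vset (True, I))))"

definition Kop :: "nat set \<Rightarrow> (vvar set \<Rightarrow> scalar) \<Rightarrow> vvar set \<Rightarrow> scalar" where
  "Kop M \<phi> = Dop M (rho (VL M) VX \<phi>)"

section \<open>Linearity of the operator over the polynomials in the c_ij\<close>

lemma Dsc_add: "Dsc M \<phi> (A + B) = Dsc M \<phi> A + Dsc M \<phi> B"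
  by (simp add: Dsc_def jack_add T_op_add distrib_left scale_add_left sum.distrib)

lemma Dsc_0 [simp]: "Dsc M \<phi> 0 = 0"
  by (simp add: Dsc_def jack_0)

lemma Dx_0 [simp]: "Dx M I 0 = 0"
  by (simp add: Dx_def)

lemma Dx_add: "Dx M I (A + B) = Dx M I A + Dx M I B"
  by (simp add: Dx_def Dsc_add distrib_left scale_add_left scale_add)

lemma Kop_add: "Kop M (\<phi> + \<psi>) = Kop M \<phi> + Kop M \<psi>"
  by (simp add: Kop_def Dop_def rho_add Dsc_add Dx_add sum.distrib)

definition cpolys :: "scalar set" where
  "cpolys = polys_in {SC i j | i j. True}"

lemma cpolys_D: "t \<in> cpolys \<Longrightarrow> m \<in> Poly_Mapping.keys t \<Longrightarrow> Poly_Mapping.lookup m SR = 0 \<and> Poly_Mapping.lookup m (SS i) = 0"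
  unfolding cpolys_def polys_in_def by (fastforce simp: in_keys_iff)

text \<open>The Jackson operators act in r and the s_i only, so polynomials in the c_ij are
  constants for them.\<close>

lemma Dsc_scale:
  assumes t: "t \<in> cpolys"
  shows "Dsc M \<phi> (t * A) = scale t (Dsc M \<phi> A)"
proof -
  have 1: "jack (q\<^sup>2) SR (t * A) = t * jack (q\<^sup>2) SR A"
    using cpolys_D[OF t] by (intro jack_mult_const q_sq_neq_1) blast
  have "jack q (SS i) (t * A) = t * jack q (SS i) A" for i
    using cpolys_D[OF t] by (intro jack_mult_const q_neq_1) blast
  moreover have "T_op (q\<^sup>2) SR t = t"
    using cpolys_D[OF t] by (intro T_op_id) blast
  ultimately show ?thesis
    by (simp add: Dsc_def 1 T_op_mult scale_add scale_sum mult.left_commute)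
qed

lemma Dx_scale: "t \<in> cpolys \<Longrightarrow> Dx M I (t * A) = scale t (Dx M I A)"
  unfolding Dx_def Dsc_scale by (simp add: scale_add mult_ac)

lemma Kop_scale:
  assumes "t \<in> cpolys"
  shows "Kop M (scale t \<phi>) = scale t (Kop M \<phi>)"
proof -
  have "scale t \<psi> S = t * \<psi> S" for \<psi> S by (simp add: scale_def)
  then show ?thesis
    using assms by (simp add: Kop_def Dop_def rho_scale Dsc_scale Dx_scale scale_add scale_sum)
qed

text \<open>The degree falls by one in both parts: r is lost and x gained, or s_i is lost and y_i,
  of degree 0, gained. A Jackson operator vanishes when the degree is too small, and also when i
  lies outside J since s_i then does not occur; so no new index enters the support.\<close>

lemma VG_Dsc:
  assumes S: "S \<subseteq> VL J" and J: "J \<subseteq> L" "A \<in> polys_in (svJ J L)" and A: "A \<in> wpoly d"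
    and d: "vdeg S + d = Suc k"
  shows "Dsc M (ev S) A \<in> VG L k J"
proof -
  have deg: "jack P u A \<in> wpoly (d - wt u)" if "wt u \<le> d" for P u
    using that A by (intro jack_wpoly) simp
  have zero: "jack P u A = 0" if "\<not> wt u \<le> d" for P u
  proof (rule jack_eq_0)
    fix m assume "m \<in> Poly_Mapping.keys A"
    then have m: "mwt m = d" using A by (simp add: wpoly_def)
    show "u \<notin> Poly_Mapping.keys m"
    proof
      assume "u \<in> Poly_Mapping.keys m"
      then have "Poly_Mapping.single u 1 + (m - Poly_Mapping.single u 1) = m"
        by (intro poly_mapping_eqI) (auto simp: lookup_add lookup_minus lookup_single when_def in_keys_iff)
      then have "mwt m = wt u + mwt (m - Poly_Mapping.single u 1)"
        by (metis mult_1 mwt_add mwt_single)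
      with m that show False by simp
    qed
  qed
  show ?thesis
    unfolding Dsc_def
  proof (intro VG_add VG_sum)
    show "scale (sconst (1 + q) * jack (q\<^sup>2) SR A) (rho (VL M) VX (ev S)) \<in> VG L k J"
    proof (cases "2 \<le> d")
      case True
      have "rho (VL M) VX (ev S) \<in> VG L (vdeg S + 1) J"
        using VG_rho[OF VG_ev[OF S], of VX] J by simp
      moreover have "sconst (1 + q) * jack (q\<^sup>2) SR A \<in> polys_in (svJ J L)"
        using J by (intro polys_in_mult jack_polys) auto
      moreover have "sconst (1 + q) * jack (q\<^sup>2) SR A \<in> wpoly (0 + (d - 2))"
        using deg[of SR] True by (intro wpoly_mult) auto
      ultimately have "scale (sconst (1 + q) * jack (q\<^sup>2) SR A) (rho (VL M) VX (ev S)) \<in> VG L (vdeg S + 1 + (0 + (d - 2))) J"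
        by (rule VG_scale)
      moreover have "vdeg S + 1 + (0 + (d - 2)) = k" using d True by simp
      ultimately show ?thesis by simp
    next
      case False
      then show ?thesis using zero[of SR] by simp
    qed
  next
    fix i
    let ?c = "sconst 2 * T_op (q\<^sup>2) SR (jack q (SS i) A)"
    show "scale ?c (rho (VL M) (VY i) (ev S)) \<in> VG L k J"
    proof (cases "i \<in> J \<and> 1 \<le> d")
      case True
      have "rho (VL M) (VY i) (ev S) \<in> VG L (vdeg S) J"
        using VG_rho[OF VG_ev[OF S], of "VY i"] J True by simp
      moreover have "?c \<in> polys_in (svJ J L)"
        using J by (intro polys_in_mult T_op_polys jack_polys) auto
      moreover have "?c \<in> wpoly (0 + (d - 1))"
        using deg[of "SS i"] True by (intro wpoly_mult T_op_wpoly) auto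
      ultimately have "scale ?c (rho (VL M) (VY i) (ev S)) \<in> VG L (vdeg S + (0 + (d - 1))) J"
        by (rule VG_scale)
      moreover have "vdeg S + (0 + (d - 1)) = k" using d True by simp
      ultimately show ?thesis by simp
    next
      case False
      have "jack q (SS i) A = 0"
      proof (cases "i \<in> J")
        case True
        then show ?thesis using False zero[of "SS i"] by simp
      next
        case False
        then have "SS i \<notin> svJ J L" by (auto simp: svJ_def)
        with J show ?thesis by (intro jack_eq_0) (auto simp: polys_in_def)
      qed
      then show ?thesis by simp
    qed
  qed
qed

lemma vset_subset_iff: "vset x \<subseteq> VL J \<longleftrightarrow> snd x \<subseteq> J"
  by (auto simp: vset_def)

lemma vdeg_vset: "vdeg (vset x) = (if fst x then 1 else 0)"
  by (auto simp: vdeg_def vset_def)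

text \<open>Right multiplication by x raises the degree by one and the derivative lowers it again.
  The variable x belongs to \<open>VL J\<close> for every J, so neither step enlarges the
  support.\<close>

lemma VG_Kop:
  assumes \<phi>: "\<phi> \<in> VG L k J" and J: "J \<subseteq> L"
  shows "Kop M \<phi> \<in> VG L k J"
proof -
  let ?\<psi> = "rho (VL M) VX \<phi>"
  have \<psi>: "?\<psi> \<in> VG L (Suc k) J"
    using VG_rho[OF \<phi>, of VX] J by simp
  then have p: "?\<psi> S \<in> polys_in (svJ J L)" and w: "\<exists>d. vdeg S + d = Suc k \<and> ?\<psi> S \<in> wpoly d"
    and o: "\<not> S \<subseteq> VL J \<Longrightarrow> ?\<psi> S = 0" for S
  proof -
    have "?\<psi> \<in> VJ L J" using \<psi> by (simp add: VG_def)
    then show "?\<psi> S \<in> polys_in (svJ J L)" "\<not> S \<subseteq> VL J \<Longrightarrow> ?\<psi> S = 0"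
      by (rule VJ_polys, rule VJ_outside)
    have "vdeg S \<le> Suc k" by (simp add: vdeg_def)
    moreover have "?\<psi> S \<in> wpoly (Suc k - vdeg S)"
      using \<psi> VH_D[of ?\<psi> "Suc k" _ S] by (fastforce simp: VG_def wpoly_def)
    ultimately show "\<exists>d. vdeg S + d = Suc k \<and> ?\<psi> S \<in> wpoly d"
      by (intro exI[of _ "Suc k - vdeg S"]) simp
  qed
  have D: "Dsc M (ev S) (?\<psi> S) \<in> VG L k J" for S
  proof (cases "S \<subseteq> VL J")
    case True
    then show ?thesis using w[of S] p[of S] J by (auto intro: VG_Dsc)
  next
    case False
    then show ?thesis using o by simp
  qed
  show ?thesis
    unfolding Kop_def Dop_def
  proof (intro VG_add VG_sum D)
    fix I
    let ?B = "?\<psi> (vset (True, I))"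
    show "Dx M I ?B \<in> VG L k J"
    proof (cases "I \<subseteq> J")
      case True
      obtain d where "vdeg (vset (True, I)) + d = Suc k" "?B \<in> wpoly d" using w by blast
      \<comment> \<open>The factor x takes one unit of the total degree k + 1, so B has degree k,
        which is also the degree of the term with y_I.\<close>
      then have B: "?B \<in> wpoly k" by (simp add: vdeg_vset)
      have "scale (sconst c * ?B) (ev (vset (False, I))) \<in> VG L (0 + (0 + k)) J" for c
        using True VG_ev[of "vset (False, I)" J L]
        by (intro VG_scale polys_in_mult wpoly_mult p B) (auto simp: vset_subset_iff vdeg_vset)
      moreover have "scale (sconst c) (Dsc M (ev (vset (True, I))) ?B) \<in> VG L (k + 0) J" for c
        by (intro VG_scale D) auto
      ultimately show ?thesis unfolding Dx_def by (intro VG_add) auto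
    next
      case False
      then show ?thesis using o[of "vset (True, I)"] by (simp add: vset_subset_iff)
    qed
  qed
qed

subsection \<open>Elements of the radial algebra by coordinates\<close>

text \<open>The inverse of taking coordinates: on \<open>VJ L L\<close> the vector is recovered by
  letting a representative act on the vacuum.\<close>

definition elt :: "nat set \<Rightarrow> (vvar set \<Rightarrow> scalar) \<Rightarrow> free_elt set" where
  "elt L \<phi> = cls L (lin_comb L (\<lambda>x. \<phi> (vset x)))"

lemma Dsc_scale_left: "Dsc M (scale c \<phi>) A = scale c (Dsc M \<phi> A)"
  by (simp add: Dsc_def rho_scale scale_add scale_sum mult.commute)

section \<open>Faithfulness of coordinates and the algebra operations in them\<close>

context
  fixes M L :: "nat set"
  assumes M: "finite M" and LM: "L \<subseteq> M"
begin

lemma finL: "finite L"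
  using M LM finite_subset by blast

lemma vset_ex:
  assumes "S \<subseteq> VL L"
  obtains x where "x \<in> BX L" "S = vset x"
proof
  show "(VX \<in> S, {i. VY i \<in> S}) \<in> BX L" using assms by auto
  show "S = vset (VX \<in> S, {i. VY i \<in> S})" by (rule vset_of[symmetric])
qed

lemma mvec_outside: "\<not> S \<subseteq> VL L \<Longrightarrow> mvec L A S = 0"
  unfolding mvec_def sum_fun_apply
  by (rule sum.neutral) (use vlist(4)[OF finL] in \<open>auto simp: scale_def ev_def\<close>)

lemma mvec_VJ:
  assumes "A \<in> BX L \<rightarrow> polys_in (sv L)"
  shows "mvec L A \<in> VJ L L"
proof (rule VJ_I)
  fix S m assume m: "m \<in> Poly_Mapping.keys (mvec L A S)"
  then have S: "S \<subseteq> VL L" using mvec_outside[of S A] by fastforce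
  then obtain x where x: "x \<in> BX L" "S = vset x" by (rule vset_ex)
  then have "mvec L A S \<in> polys_in (sv L)" using mvec_apply[OF finL x(1)] assms by auto
  then show "S \<subseteq> VL L \<and> Poly_Mapping.keys m \<subseteq> svJ L L"
    using S m by (auto simp: polys_in_def svJ_same)
qed

lemma mvec_coords:
  assumes "\<phi> \<in> VJ L L"
  shows "mvec L (\<lambda>x. \<phi> (vset x)) = \<phi>"
proof
  fix S
  show "mvec L (\<lambda>x. \<phi> (vset x)) S = \<phi> S"
  proof (cases "S \<subseteq> VL L")
    case True
    then obtain x where "x \<in> BX L" "S = vset x" by (rule vset_ex)
    then show ?thesis using mvec_apply[OF finL] by auto
  next
    case False
    then show ?thesis using mvec_outside VJ_outside[OF assms] by simp
  qed
qed

lemma VJ_coords: "\<phi> \<in> VJ L L \<Longrightarrow> (\<lambda>x. \<phi> (vset x)) \<in> BX L \<rightarrow> polys_in (sv L)"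
  using VJ_polys[of \<phi> L L] by (auto simp: svJ_same)

lemma cls_elt:
  assumes h: "h \<in> FA L"
  shows "ract (VL M) (ev {}) h \<in> VJ L L" "cls L h = elt L (ract (VL M) (ev {}) h)"
proof -
  have "h \<in> wspan L" using h wspan_eq[OF finL] by simp
  then obtain A where A: "A \<in> BX L \<rightarrow> polys_in (sv L)" "h - lin_comb L A \<in> radial_ideal (VL L)"
    by (rule wspanE)
  have "ract (VL M) (ev {}) h = ract (VL M) (ev {}) (lin_comb L A)"
    using cls_eq_iff_ract[OF M LM h fa_lin_comb[OF finL]] A(2) by (simp add: cls_eq_iff)
  also have "\<dots> = mvec L A" by (rule ract_lin_comb[OF M LM A(1)])
  finally have eq: "ract (VL M) (ev {}) h = mvec L A" .
  then show "ract (VL M) (ev {}) h \<in> VJ L L" by (simp add: mvec_VJ A)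
  have "lin_comb L (\<lambda>x. mvec L A (vset x)) = lin_comb L A"
    unfolding lin_comb_def by (rule sum.cong) (simp_all add: mvec_apply[OF finL])
  then show "cls L h = elt L (ract (VL M) (ev {}) h)"
    unfolding eq elt_def using A(2) by (simp add: cls_eq_iff)
qed

lemma elt_rep:
  assumes "\<phi> \<in> VJ L L"
  obtains h where "h \<in> FA L" "elt L \<phi> = cls L h" "ract (VL M) (ev {}) h = \<phi>"
proof
  show "lin_comb L (\<lambda>x. \<phi> (vset x)) \<in> FA L" by (rule fa_lin_comb[OF finL])
  show "elt L \<phi> = cls L (lin_comb L (\<lambda>x. \<phi> (vset x)))" by (simp add: elt_def)
  show "ract (VL M) (ev {}) (lin_comb L (\<lambda>x. \<phi> (vset x))) = \<phi>"
    using ract_lin_comb[OF M LM VJ_coords[OF assms]] mvec_coords[OF assms] by simp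
qed

lemma elt_eq_iff: "\<phi> \<in> VJ L L \<Longrightarrow> \<psi> \<in> VJ L L \<Longrightarrow> elt L \<phi> = elt L \<psi> \<longleftrightarrow> \<phi> = \<psi>"
  by (metis elt_rep cls_eq_iff_ract[OF M LM])

lemma elt_closed: "\<phi> \<in> VJ L L \<Longrightarrow> elt L \<phi> \<in> carrier (RA L)"
  by (metis elt_rep cls_closed)

lemma elt_zero: "\<zero>\<^bsub>RA L\<^esub> = elt L 0"
  using cls_elt(2)[of 0] by (simp add: cls_zero)

lemma elt_add:
  assumes "\<phi> \<in> VJ L L" "\<psi> \<in> VJ L L"
  shows "elt L \<phi> \<oplus>\<^bsub>RA L\<^esub> elt L \<psi> = elt L (\<phi> + \<psi>)"
proof -
  obtain f where f: "f \<in> FA L" "elt L \<phi> = cls L f" "ract (VL M) (ev {}) f = \<phi>"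
    using assms(1) by (rule elt_rep)
  obtain g where g: "g \<in> FA L" "elt L \<psi> = cls L g" "ract (VL M) (ev {}) g = \<psi>"
    using assms(2) by (rule elt_rep)
  show ?thesis
    using f g cls_elt(2)[OF fa_add[OF f(1) g(1)]] by (simp add: cls_add ract_add)
qed

lemma elt_mult_cls:
  assumes "\<phi> \<in> VJ L L" "g \<in> FA L"
  shows "ract (VL M) \<phi> g \<in> VJ L L" "elt L \<phi> \<otimes>\<^bsub>RA L\<^esub> cls L g = elt L (ract (VL M) \<phi> g)"
proof -
  obtain f where f: "f \<in> FA L" "elt L \<phi> = cls L f" "ract (VL M) (ev {}) f = \<phi>"
    using assms(1) by (rule elt_rep)
  from cls_elt[OF fa_mult[OF f(1) assms(2)]] f assms(2)
  show "ract (VL M) \<phi> g \<in> VJ L L" "elt L \<phi> \<otimes>\<^bsub>RA L\<^esub> cls L g = elt L (ract (VL M) \<phi> g)"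
    by (simp_all add: cls_mult ract_mult)
qed

lemma RA_elt_image: "add_image (RA L) (elt L) (VJ L L)"
  using cls_elt elt_closed
  by unfold_locales (force simp: carrier_RA VJ_add elt_add elt_zero)+

lemmas finsum_elt = add_image.finsum_image[OF RA_elt_image]

lemma ev_VJ: "x \<in> BX L \<Longrightarrow> ev (vset x) \<in> VJ L L"
  using VG_ev[of "vset x" L L] vlist(4)[OF finL] by (auto simp: VG_def)

lemma cls_wed:
  assumes x: "x \<in> BX L"
  shows "cls L (wed x) = elt L (ev (vset x))"
proof -
  have "vset x \<subseteq> VL M" using vlist(4)[OF finL x] LM by blast
  then have "ract (VL M) (ev {}) (wed x) = ev (vset x)"
    using ract_wedge[of "VL M" "vlist x"] vlist[OF finL x] M by auto
  then show ?thesis using cls_elt(2)[OF fa_wed[OF finL x]] by simp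
qed

lemma y_wedge_elt: "I \<subseteq> L \<Longrightarrow> y_wedge L I = elt L (ev (vset (False, I)))"
  and xy_wedge_elt: "I \<subseteq> L \<Longrightarrow> xy_wedge L I = elt L (ev (vset (True, I)))"
  using cls_wed[of "(False, I)"] cls_wed[of "(True, I)"]
  by (simp_all add: y_wedge_def xy_wedge_def vlist_def comp_def)

lemma elt_emb:
  assumes "\<phi> \<in> VJ L L" "t \<in> polys_in (sv L)"
  shows "elt L \<phi> \<otimes>\<^bsub>RA L\<^esub> emb L t = elt L (scale t \<phi>)" "scale t \<phi> \<in> VJ L L"
  using elt_mult_cls[OF assms(1) fa_arep[OF finL, of t]] ract_arep[OF M LM assms(2)]
  by (simp_all add: emb_eq)

lemma emb_sconst: "emb L (sconst c) = cls L (free_const c)"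
  using arep_const_mult[of L c 1] by (simp add: emb_eq)

lemma sconst_elt:
  assumes "\<phi> \<in> VJ L L"
  shows "emb L (sconst c) \<otimes>\<^bsub>RA L\<^esub> elt L \<phi> = elt L (scale (sconst c) \<phi>)" "scale (sconst c) \<phi> \<in> VJ L L"
proof -
  obtain f where f: "f \<in> FA L" "elt L \<phi> = cls L f" "ract (VL M) (ev {}) f = \<phi>"
    using assms by (rule elt_rep)
  from cls_elt[OF fa_mult[OF fa_const f(1)], of c] f
  show "emb L (sconst c) \<otimes>\<^bsub>RA L\<^esub> elt L \<phi> = elt L (scale (sconst c) \<phi>)" "scale (sconst c) \<phi> \<in> VJ L L"
    by (simp_all add: emb_sconst cls_mult ract_mult ract_scale_left)
qed

lemma sc_deriv_cls:
  "sc_deriv L A = cls L (free_const (1 + q) * gen VX * arep L (jack (q\<^sup>2) SR A)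
     + free_const 2 * (\<Sum>i\<in>L. gen (VY i) * arep L (T_op (q\<^sup>2) SR (jack q (SS i) A))))"
proof -
  interpret RA: ring "RA L" by (rule ring_RA)
  have "finsum (RA L) (\<lambda>i. cls L (gen (VY i)) \<otimes>\<^bsub>RA L\<^esub> emb L (T_op (q\<^sup>2) SR (jackson q (SS i) A))) L
    = finsum (RA L) (\<lambda>i. cls L (gen (VY i) * arep L (T_op (q\<^sup>2) SR (jack q (SS i) A)))) L"
    by (rule RA.finsum_cong')
      (auto simp: emb_eq jackson_eq_jack q_neq_1 cls_mult fa_gen fa_arep finL intro!: cls_closed fa_mult)
  also have "\<dots> = cls L (\<Sum>i\<in>L. gen (VY i) * arep L (T_op (q\<^sup>2) SR (jack q (SS i) A)))"
    by (rule finsum_RA_cls) (auto intro!: fa_mult fa_gen fa_arep finL)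
  finally show ?thesis
    unfolding sc_deriv_def emb_sconst
    by (simp add: emb_eq jackson_eq_jack q_sq_neq_1 cls_mult cls_add fa_mult fa_sum fa_gen fa_arep finL)
qed

lemma elt_sc_deriv:
  assumes \<phi>: "\<phi> \<in> VJ L L" and A: "A \<in> polys_in (sv L)"
  shows "elt L \<phi> \<otimes>\<^bsub>RA L\<^esub> sc_deriv L A = elt L (Dsc M \<phi> A)" "Dsc M \<phi> A \<in> VJ L L"
proof -
  let ?g = "free_const (1 + q) * gen VX * arep L (jack (q\<^sup>2) SR A)
     + free_const 2 * (\<Sum>i\<in>L. gen (VY i) * arep L (T_op (q\<^sup>2) SR (jack q (SS i) A)))"
  have g: "?g \<in> FA L"
    by (intro fa_add fa_mult fa_const fa_sum fa_gen fa_arep finL) auto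
  \<comment> \<open>\<open>Dsc M\<close> sums over M and \<open>sc_deriv L\<close> over L; for i
    outside L the variable s_i does not occur in A.\<close>
  have "jack q (SS i) A = 0" if "i \<notin> L" for i
    using A that by (intro jack_eq_0) (auto simp: polys_in_def sv_def)
  then have M_L: "(\<Sum>i\<in>M. scale (sconst 2 * T_op (q\<^sup>2) SR (jack q (SS i) A)) (rho (VL M) (VY i) \<phi>))
    = (\<Sum>i\<in>L. scale (sconst 2 * T_op (q\<^sup>2) SR (jack q (SS i) A)) (rho (VL M) (VY i) \<phi>))"
    by (intro sum.mono_neutral_right M LM) auto
  have "ract (VL M) \<phi> ?g = Dsc M \<phi> A"
    unfolding Dsc_def M_L
    by (simp add: ract_add ract_mult ract_sum ract_arep[OF M LM] A jack_polys T_op_polys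
        rho_scale mult.commute)
  with elt_mult_cls[OF \<phi> g]
  show "elt L \<phi> \<otimes>\<^bsub>RA L\<^esub> sc_deriv L A = elt L (Dsc M \<phi> A)" "Dsc M \<phi> A \<in> VJ L L"
    by (simp_all add: sc_deriv_cls)
qed

lemma combine_elt:
  assumes "\<And>I. I \<subseteq> L \<Longrightarrow> f I = elt L (\<phi> I)" "\<And>I. I \<subseteq> L \<Longrightarrow> \<phi> I \<in> VJ L L"
    "\<And>I. I \<subseteq> L \<Longrightarrow> g I = elt L (\<psi> I)" "\<And>I. I \<subseteq> L \<Longrightarrow> \<psi> I \<in> VJ L L"
  shows "combine L f g = elt L ((\<Sum>I\<in>Pow L. \<phi> I) + (\<Sum>I\<in>Pow L. \<psi> I))"
    "(\<Sum>I\<in>Pow L. \<phi> I) + (\<Sum>I\<in>Pow L. \<psi> I) \<in> VJ L L"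
proof -
  have "(\<Sum>I\<in>Pow L. \<phi> I) \<in> VJ L L" "(\<Sum>I\<in>Pow L. \<psi> I) \<in> VJ L L"
    by (intro VJ_sum; simp add: assms)+
  then show "combine L f g = elt L ((\<Sum>I\<in>Pow L. \<phi> I) + (\<Sum>I\<in>Pow L. \<psi> I))"
    "(\<Sum>I\<in>Pow L. \<phi> I) + (\<Sum>I\<in>Pow L. \<psi> I) \<in> VJ L L"
    unfolding combine_def
    using finsum_elt[of "Pow L" f \<phi>] finsum_elt[of "Pow L" g \<psi>] assms
    by (simp_all add: elt_add VJ_add)
qed

text \<open>The values of \<psi> provide one decomposition. By freeness every admissible
  decomposition has these same coefficient families on the subsets of L, so the definite description
  has exactly one solution. The summands of \<open>Dop M\<close> for sets not contained in L
  vanish.\<close>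

lemma right_deriv_elt:
  assumes \<psi>: "\<psi> \<in> VJ L L"
  shows "right_deriv L (elt L \<psi>) = elt L (Dop M \<psi>)"
proof -
  define F where "F A B = combine L
       (\<lambda>I. y_wedge L I \<otimes>\<^bsub>RA L\<^esub> emb L (A I))
       (\<lambda>I. xy_wedge L I \<otimes>\<^bsub>RA L\<^esub> emb L (B I))" for A B
  define G where "G A B = combine L
       (\<lambda>I. y_wedge L I \<otimes>\<^bsub>RA L\<^esub> sc_deriv L (A I))
       (\<lambda>I. (emb L (sconst ((-1) ^ card I * qnum_m (- int (card I))))
               \<otimes>\<^bsub>RA L\<^esub> y_wedge L I \<otimes>\<^bsub>RA L\<^esub> emb L (B I))
            \<oplus>\<^bsub>RA L\<^esub>
            (emb L (sconst (qpow_m (- int (card I))))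
               \<otimes>\<^bsub>RA L\<^esub> xy_wedge L I \<otimes>\<^bsub>RA L\<^esub> sc_deriv L (B I)))" for A B
  define T where "T A B = (\<Sum>I\<in>Pow L. scale (A I) (ev (vset (False, I))))
      + (\<Sum>I\<in>Pow L. scale (B I) (ev (vset (True, I))))" for A B
  have AL: "A_set L = polys_in (sv L)" by (rule A_set_eq[OF finL])
  have ev: "ev (vset (b, I)) \<in> VJ L L" if "I \<subseteq> L" for b I
    using that by (intro ev_VJ) auto
  have FT: "F A B = elt L (T A B)" "T A B \<in> VJ L L"
    if "A \<in> Pow L \<rightarrow> A_set L" "B \<in> Pow L \<rightarrow> A_set L" for A B
  proof -
    have "A I \<in> polys_in (sv L)" "B I \<in> polys_in (sv L)" if "I \<subseteq> L" for I
      using that \<open>A \<in> _\<close> \<open>B \<in> _\<close> AL by auto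
    then show "F A B = elt L (T A B)" "T A B \<in> VJ L L"
      unfolding F_def T_def
      by (intro combine_elt; simp add: y_wedge_elt xy_wedge_elt ev elt_emb)+
  qed
  have T_at: "T A B (vset (False, I)) = A I" "T A B (vset (True, I)) = B I" if "I \<subseteq> L" for A B I
  proof -
    have e: "ev (vset y) (vset x) = (if x = y then 1 else 0)" for x y
      by (auto simp: ev_def dest: vset_inj)
    have fP: "finite (Pow L)" using finL by simp
    have "(\<Sum>J\<in>Pow L. C J * (if I = J then 1 else 0)) = C I" for C :: "nat set \<Rightarrow> scalar"
      using that fP by (simp add: if_distrib[of "(*) _"] cong: if_cong)
    then show "T A B (vset (False, I)) = A I" "T A B (vset (True, I)) = B I"
      by (simp_all add: T_def sum_fun_apply scale_def e)
  qed
  have GD: "G A B = elt L (Dop M \<psi>)"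
    if "A \<in> Pow L \<rightarrow> A_set L" "B \<in> Pow L \<rightarrow> A_set L"
      "\<And>I. I \<subseteq> L \<Longrightarrow> A I = \<psi> (vset (False, I))" "\<And>I. I \<subseteq> L \<Longrightarrow> B I = \<psi> (vset (True, I))" for A B
  proof -
    have AB: "A I \<in> polys_in (sv L)" "B I \<in> polys_in (sv L)" if "I \<subseteq> L" for I
      using that \<open>A \<in> _\<close> \<open>B \<in> _\<close> AL by auto
    have "G A B = elt L ((\<Sum>I\<in>Pow L. Dsc M (ev (vset (False, I))) (A I)) + (\<Sum>I\<in>Pow L. Dx M I (B I)))"
      unfolding G_def
    proof (rule combine_elt)
      fix I assume I: "I \<subseteq> L"
      show "y_wedge L I \<otimes>\<^bsub>RA L\<^esub> sc_deriv L (A I) = elt L (Dsc M (ev (vset (False, I))) (A I))"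
        "Dsc M (ev (vset (False, I))) (A I) \<in> VJ L L"
        using I by (simp_all add: y_wedge_elt elt_sc_deriv ev AB)
      let ?c = "sconst ((-1) ^ card I * qnum_m (- int (card I)))"
      let ?d = "sconst (qpow_m (- int (card I)))"
      have 1: "emb L ?c \<otimes>\<^bsub>RA L\<^esub> y_wedge L I \<otimes>\<^bsub>RA L\<^esub> emb L (B I) = elt L (scale (?c * B I) (ev (vset (False, I))))"
        "scale (?c * B I) (ev (vset (False, I))) \<in> VJ L L"
        using elt_emb[OF sconst_elt(2)[OF ev[OF I]] AB(2)[OF I], of "(-1) ^ card I * qnum_m (- int (card I))" False] I
        by (simp_all add: y_wedge_elt sconst_elt ev mult.commute[of "B I"])
      have 2: "emb L ?d \<otimes>\<^bsub>RA L\<^esub> xy_wedge L I \<otimes>\<^bsub>RA L\<^esub> sc_deriv L (B I) = elt L (scale ?d (Dsc M (ev (vset (True, I))) (B I)))"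
        "scale ?d (Dsc M (ev (vset (True, I))) (B I)) \<in> VJ L L"
        using elt_sc_deriv[OF sconst_elt(2)[OF ev[OF I]] AB(2)[OF I], of "qpow_m (- int (card I))" True] I
        by (simp_all add: xy_wedge_elt sconst_elt ev Dsc_scale_left)
      show "(emb L ?c \<otimes>\<^bsub>RA L\<^esub> y_wedge L I \<otimes>\<^bsub>RA L\<^esub> emb L (B I)) \<oplus>\<^bsub>RA L\<^esub>
        (emb L ?d \<otimes>\<^bsub>RA L\<^esub> xy_wedge L I \<otimes>\<^bsub>RA L\<^esub> sc_deriv L (B I)) = elt L (Dx M I (B I))"
        "Dx M I (B I) \<in> VJ L L"
        unfolding Dx_def using 1 2 by (simp_all add: elt_add VJ_add)
    qed
    also have "(\<Sum>I\<in>Pow L. Dsc M (ev (vset (False, I))) (A I)) + (\<Sum>I\<in>Pow L. Dx M I (B I)) = Dop M \<psi>"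
      unfolding Dop_def
    proof (intro arg_cong2[where f = "(+)"] sum.mono_neutral_cong_left)
      show "finite (Pow M)" "Pow L \<subseteq> Pow M" "finite (Pow M)" "Pow L \<subseteq> Pow M" using M LM by auto
      have "\<psi> (vset (b, I)) = 0" if "I \<in> Pow M - Pow L" for b I
        using that by (intro VJ_outside[OF \<psi>]) (auto simp: vset_subset_iff)
      then show "\<forall>I\<in>Pow M - Pow L. Dsc M (ev (vset (False, I))) (\<psi> (vset (False, I))) = 0"
        "\<forall>I\<in>Pow M - Pow L. Dx M I (\<psi> (vset (True, I))) = 0"
        by simp_all
    qed (use that in auto)
    finally show ?thesis .
  qed
  show ?thesis
    unfolding right_deriv_def F_def[symmetric] G_def[symmetric]
  proof (rule the_equality)
    let ?A = "\<lambda>I. \<psi> (vset (False, I))" and ?B = "\<lambda>I. \<psi> (vset (True, I))"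
    have AB: "?A \<in> Pow L \<rightarrow> A_set L" "?B \<in> Pow L \<rightarrow> A_set L"
      using VJ_polys[OF \<psi>] by (auto simp: AL svJ_same)
    have "T ?A ?B = \<psi>"
    proof
      fix S
      show "T ?A ?B S = \<psi> S"
      proof (cases "S \<subseteq> VL L")
        case True
        then obtain x where x: "x \<in> BX L" "S = vset x" by (rule vset_ex)
        then show ?thesis using T_at[of "snd x" ?A ?B] by (cases x; cases "fst x") auto
      next
        case False
        then show ?thesis using VJ_outside[OF \<psi>] VJ_outside[OF FT(2)[OF AB]] by simp
      qed
    qed
    with FT(1)[OF AB] GD[OF AB] AB
    show "\<exists>A B. A \<in> Pow L \<rightarrow> A_set L \<and> B \<in> Pow L \<rightarrow> A_set L \<and> elt L \<psi> = F A B \<and> elt L (Dop M \<psi>) = G A B"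
      by (intro exI[of _ ?A] exI[of _ ?B]) simp
  next
    fix H
    assume "\<exists>A B. A \<in> Pow L \<rightarrow> A_set L \<and> B \<in> Pow L \<rightarrow> A_set L \<and> elt L \<psi> = F A B \<and> H = G A B"
    then obtain A B where AB: "A \<in> Pow L \<rightarrow> A_set L" "B \<in> Pow L \<rightarrow> A_set L" "elt L \<psi> = F A B" "H = G A B"
      by blast
    from AB(3) have "\<psi> = T A B" using FT[OF AB(1,2)] elt_eq_iff[OF \<psi>] by simp
    then have "A I = \<psi> (vset (False, I))" "B I = \<psi> (vset (True, I))" if "I \<subseteq> L" for I
      using T_at[OF that, of A B] by simp_all
    from GD[OF AB(1,2) this] AB(4) show "H = elt L (Dop M \<psi>)" by simp
  qed
qed

lemma K_op_elt:
  assumes "\<phi> \<in> VJ L L"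
  shows "K_op L (elt L \<phi>) = elt L (Kop M \<phi>)"
  using elt_mult_cls[OF assms, of "gen VX"] right_deriv_elt
  by (simp add: K_op_def Kop_def fa_gen)

end

subsection \<open>Coordinates over the ring of the \<open>c\<^sub>i\<^sub>j\<close>\<close>

fun cvar :: "svar \<Rightarrow> bool" where
  "cvar (SC i j) = True" | "cvar _ = False"

text \<open>Used to split a monomial into its part in the c_ij, which belongs to the coefficient,
  and its part in r and the s_i, which belongs to the basis monomial.\<close>

definition mpart :: "(svar \<Rightarrow> bool) \<Rightarrow> (svar \<Rightarrow>\<^sub>0 nat) \<Rightarrow> svar \<Rightarrow>\<^sub>0 nat" where
  "mpart P m = Poly_Mapping.mapp (\<lambda>v n. if P v then n else 0) m"

abbreviation "mc \<equiv> mpart cvar"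
abbreviation "mn \<equiv> mpart (\<lambda>v. \<not> cvar v)"

lemma lookup_mpart: "Poly_Mapping.lookup (mpart P m) v = (if P v then Poly_Mapping.lookup m v else 0)"
  by (simp add: mpart_def lookup_mapp when_def in_keys_iff)

lemma keys_mpart: "Poly_Mapping.keys (mpart P m) = {v \<in> Poly_Mapping.keys m. P v}"
  by (auto simp: in_keys_iff lookup_mpart split: if_splits)

lemma mc_add_mn: "mc m + mn m = m"
  by (rule poly_mapping_eqI) (simp add: lookup_add lookup_mpart)

lemma mpart_add: "mpart P (m + n) = mpart P m + mpart P n"
  by (rule poly_mapping_eqI) (simp add: lookup_add lookup_mpart)

lemma mpart_id: "(\<And>v. v \<in> Poly_Mapping.keys m \<Longrightarrow> P v) \<Longrightarrow> mpart P m = m"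
  by (rule poly_mapping_eqI) (auto simp: lookup_mpart in_keys_iff)

lemma mpart_0: "(\<And>v. v \<in> Poly_Mapping.keys m \<Longrightarrow> \<not> P v) \<Longrightarrow> mpart P m = 0"
  by (rule poly_mapping_eqI) (auto simp: lookup_mpart in_keys_iff)

lemma mwt_mc [simp]: "mwt (mc m) = 0"
  unfolding mwt_def linext_def by (rule sum.neutral) (auto simp: keys_mpart elim: cvar.elims)

lemma mwt_mn: "mwt (mn m) = mwt m"
  using mwt_add[of "mc m" "mn m"] by (simp add: mc_add_mn)

text \<open>\<open>extr m0 f\<close> is the coefficient of the monomial \<open>m0\<close> in the \<open>r\<close> and \<open>s\<^sub>i\<close>, a polynomial in the
  \<open>c\<^sub>i\<^sub>j\<close>.\<close>

definition extr :: "(svar \<Rightarrow>\<^sub>0 nat) \<Rightarrow> scalar \<Rightarrow> scalar" where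
  "extr m0 = linext (\<lambda>m c. if mn m = m0 then Poly_Mapping.single (mc m) c else 0)"

lemma extr_add: "extr m0 (f + g) = extr m0 f + extr m0 g"
  unfolding extr_def by (rule linext_add) (simp_all add: single_add)

lemma extr_0 [simp]: "extr m0 0 = 0"
  by (simp add: extr_def)

lemma extr_sum: "extr m0 (\<Sum>i\<in>I. f i) = (\<Sum>i\<in>I. extr m0 (f i))"
  by (rule additive_sum[of "extr m0"]) (simp_all add: extr_add)

lemma extr_single: "extr m0 (Poly_Mapping.single m c) = (if mn m = m0 then Poly_Mapping.single (mc m) c else 0)"
  unfolding extr_def by (rule linext_single) simp

lemma extr_mult_single:
  assumes t: "t \<in> cpolys" and m1: "\<And>v. v \<in> Poly_Mapping.keys m1 \<Longrightarrow> \<not> cvar v"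
  shows "extr m0 (t * Poly_Mapping.single m1 1) = (if m0 = m1 then t else 0)"
proof -
  have n: "mn (n + m1) = m1" "mc (n + m1) = n" if "n \<in> Poly_Mapping.keys t" for n
  proof -
    have "cvar v" if "v \<in> Poly_Mapping.keys n" for v
    proof -
      have "v \<in> {SC i j | i j. True}"
        using t \<open>n \<in> _\<close> that unfolding cpolys_def polys_in_def by blast
      then show ?thesis by auto
    qed
    then show "mn (n + m1) = m1" "mc (n + m1) = n"
      using m1 mpart_id[of n cvar] mpart_0[of n "\<lambda>v. \<not> cvar v"]
        mpart_id[of m1 "\<lambda>v. \<not> cvar v"] mpart_0[of m1 cvar] by (simp_all add: mpart_add)
  qed
  have "t * Poly_Mapping.single m1 1
      = (\<Sum>n\<in>Poly_Mapping.keys t. Poly_Mapping.single n (Poly_Mapping.lookup t n)) * Poly_Mapping.single m1 1"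
    by (simp only: poly_mapping_sum_single)
  also have "\<dots> = (\<Sum>n\<in>Poly_Mapping.keys t. Poly_Mapping.single (n + m1) (Poly_Mapping.lookup t n))"
    by (simp add: sum_distrib_right mult_single)
  finally have "extr m0 (t * Poly_Mapping.single m1 1)
      = (\<Sum>n\<in>Poly_Mapping.keys t. if m0 = m1 then Poly_Mapping.single n (Poly_Mapping.lookup t n) else 0)"
    by (simp only: extr_sum extr_single) (rule sum.cong, auto simp: n)
  then show ?thesis by (simp add: poly_mapping_sum_single)
qed

lemma extr_expand:
  assumes X: "finite X" "mn ` Poly_Mapping.keys f \<subseteq> X"
  shows "(\<Sum>m0\<in>X. extr m0 f * Poly_Mapping.single m0 1) = f"
proof -
  have "(\<Sum>m0\<in>X. extr m0 f * Poly_Mapping.single m0 1)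
    = (\<Sum>m0\<in>X. \<Sum>m\<in>Poly_Mapping.keys f. if mn m = m0 then Poly_Mapping.single m (Poly_Mapping.lookup f m) else 0)"
    unfolding extr_def linext_def sum_distrib_right
    by (intro sum.cong refl) (auto simp: mult_single mc_add_mn)
  also have "\<dots> = (\<Sum>m\<in>Poly_Mapping.keys f. \<Sum>m0\<in>X. if mn m = m0 then Poly_Mapping.single m (Poly_Mapping.lookup f m) else 0)"
    by (rule sum.swap)
  also have "\<dots> = (\<Sum>m\<in>Poly_Mapping.keys f. Poly_Mapping.single m (Poly_Mapping.lookup f m))"
    by (rule sum.cong) (use X in auto)
  finally show ?thesis by (simp add: poly_mapping_sum_single)
qed

lemma keys_extr:
  assumes "n \<in> Poly_Mapping.keys (extr m0 f)"
  obtains m where "m \<in> Poly_Mapping.keys f" "mn m = m0" "n = mc m"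
proof -
  have "n \<in> (\<Union>m\<in>Poly_Mapping.keys f. Poly_Mapping.keys
      (if mn m = m0 then Poly_Mapping.single (mc m) (Poly_Mapping.lookup f m) else 0))"
    using assms[unfolded extr_def linext_def] by (rule subsetD[OF keys_sum])
  then show thesis using that by (auto split: if_splits)
qed

section \<open>Basis monomials and their coefficient functionals\<close>

definition rs_exp :: "nat \<Rightarrow> (nat \<Rightarrow>\<^sub>0 nat) \<Rightarrow> svar \<Rightarrow>\<^sub>0 nat" where
  "rs_exp a \<beta> = Poly_Mapping.single SR a
     + (\<Sum>i\<in>Poly_Mapping.keys \<beta>. Poly_Mapping.single (SS i) (Poly_Mapping.lookup \<beta> i))"

lemma lookup_rs_exp:
  "Poly_Mapping.lookup (rs_exp a \<beta>) SR = a"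
  "Poly_Mapping.lookup (rs_exp a \<beta>) (SS i) = Poly_Mapping.lookup \<beta> i"
  "Poly_Mapping.lookup (rs_exp a \<beta>) (SC i j) = 0"
  by (simp_all add: rs_exp_def lookup_add lookup_sum lookup_single when_def in_keys_iff)

lemma rs_monom_eq: "rs_monom a \<beta> = Poly_Mapping.single (rs_exp a \<beta>) 1"
proof -
  have "(\<Prod>i\<in>I. Poly_Mapping.single (f i) 1) = Poly_Mapping.single (\<Sum>i\<in>I. f i) (1 :: coeff)"
    if "finite I" for I :: "nat set" and f :: "nat \<Rightarrow> svar \<Rightarrow>\<^sub>0 nat"
    using that by induction (simp_all add: mult_single)
  then show ?thesis
    by (simp add: rs_monom_def rs_exp_def pvar_power mult_single)
qed

lemma mwt_rs_exp: "mwt (rs_exp a \<beta>) = 2 * a + mdeg \<beta>"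
proof -
  have "mwt (\<Sum>i\<in>I. f i) = (\<Sum>i\<in>I. mwt (f i))" for I :: "nat set" and f
    by (rule additive_sum[of mwt]) simp_all
  then show ?thesis by (simp add: rs_exp_def mdeg_def)
qed

fun bset :: "bmon \<Rightarrow> vvar set" where
  "bset (BY I a \<beta>) = vset (False, I)" | "bset (BXY I a \<beta>) = vset (True, I)"

fun bexp :: "bmon \<Rightarrow> svar \<Rightarrow>\<^sub>0 nat" where
  "bexp (BY I a \<beta>) = rs_exp a \<beta>" | "bexp (BXY I a \<beta>) = rs_exp a \<beta>"

definition bvec :: "bmon \<Rightarrow> vvar set \<Rightarrow> scalar" where
  "bvec b = scale (Poly_Mapping.single (bexp b) 1) (ev (bset b))"

definition bcoord :: "(vvar set \<Rightarrow> scalar) \<Rightarrow> bmon \<Rightarrow> scalar" where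
  "bcoord \<phi> b = extr (bexp b) (\<phi> (bset b))"

lemma rs_exp_inj: "rs_exp a \<beta> = rs_exp a' \<beta>' \<Longrightarrow> a = a' \<and> \<beta> = \<beta>'"
  using lookup_rs_exp by (metis poly_mapping_eqI)

lemma b_inj: "bset b = bset c \<Longrightarrow> bexp b = bexp c \<Longrightarrow> b = c"
  by (cases b; cases c) (auto dest!: vset_inj rs_exp_inj)

lemma bexp_cvar: "v \<in> Poly_Mapping.keys (bexp b) \<Longrightarrow> \<not> cvar v"
  by (cases b; cases v) (auto simp: in_keys_iff lookup_rs_exp)

lemma xdeg_eq: "xdeg b = vdeg (bset b) + mwt (bexp b)"
  by (cases b) (simp_all add: vdeg_vset mwt_rs_exp)

text \<open>The exponent of a basis monomial involves r and the s_i only, so membership in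
  \<open>svJ J L\<close> is a condition on the indices of the s_i, for any L.\<close>

lemma xsupp_subset_iff: "xsupp b \<subseteq> J \<longleftrightarrow> bset b \<subseteq> VL J \<and> Poly_Mapping.keys (bexp b) \<subseteq> svJ J L"
proof -
  have k: "Poly_Mapping.keys (rs_exp a \<beta>) \<subseteq> svJ J L \<longleftrightarrow> Poly_Mapping.keys \<beta> \<subseteq> J" for a \<beta>
  proof
    assume *: "Poly_Mapping.keys (rs_exp a \<beta>) \<subseteq> svJ J L"
    show "Poly_Mapping.keys \<beta> \<subseteq> J"
    proof
      fix i assume "i \<in> Poly_Mapping.keys \<beta>"
      then have "SS i \<in> Poly_Mapping.keys (rs_exp a \<beta>)" by (simp add: in_keys_iff lookup_rs_exp)
      with * have "SS i \<in> svJ J L" by blast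
      then show "i \<in> J" by (auto simp: svJ_def)
    qed
  next
    assume *: "Poly_Mapping.keys \<beta> \<subseteq> J"
    show "Poly_Mapping.keys (rs_exp a \<beta>) \<subseteq> svJ J L"
    proof
      fix v assume v: "v \<in> Poly_Mapping.keys (rs_exp a \<beta>)"
      show "v \<in> svJ J L"
      proof (cases v)
        case (SS i)
        then have "i \<in> Poly_Mapping.keys \<beta>" using v by (simp add: in_keys_iff lookup_rs_exp)
        then show ?thesis using * SS by (auto simp: svJ_def)
      qed (use v in \<open>auto simp: in_keys_iff lookup_rs_exp svJ_def\<close>)
    qed
  qed
  show ?thesis by (cases b) (simp_all add: vset_subset_iff k)
qed

lemma bcoord_add: "bcoord (\<phi> + \<psi>) b = bcoord \<phi> b + bcoord \<psi> b"
  by (simp add: bcoord_def extr_add)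

lemma bcoord_sum: "bcoord (\<Sum>i\<in>I. f i) b = (\<Sum>i\<in>I. bcoord (f i) b)"
  by (rule additive_sum[of "\<lambda>\<phi>. bcoord \<phi> b"]) (simp_all add: bcoord_add, simp add: bcoord_def)

lemma bcoord_bvec:
  assumes "t \<in> cpolys"
  shows "bcoord (scale t (bvec b)) c = (if b = c then t else 0)"
proof -
  have "bcoord (scale t (bvec b)) c = (if bset c = bset b then extr (bexp c) (t * Poly_Mapping.single (bexp b) 1) else 0)"
    by (simp add: bcoord_def bvec_def scale_def ev_def)
  also have "\<dots> = (if bset c = bset b \<and> bexp c = bexp b then t else 0)"
    by (simp add: extr_mult_single[OF assms bexp_cvar])
  finally show ?thesis using b_inj[of b c] by auto
qed

lemma bcoord_comb:
  assumes "finite B" "\<And>b. b \<in> B \<Longrightarrow> t b \<in> cpolys" "c \<in> B"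
  shows "bcoord (\<Sum>b\<in>B. scale (t b) (bvec b)) c = t c"
proof -
  have "bcoord (\<Sum>b\<in>B. scale (t b) (bvec b)) c = (\<Sum>b\<in>B. if b = c then t c else 0)"
    unfolding bcoord_sum by (rule sum.cong) (auto simp: bcoord_bvec assms)
  then show ?thesis using assms by simp
qed

lemma VG_D:
  assumes "\<phi> \<in> VG L k J" "m \<in> Poly_Mapping.keys (\<phi> S)"
  shows "S \<subseteq> VL J" "Poly_Mapping.keys m \<subseteq> svJ J L" "vdeg S + mwt m = k"
  using VJ_D[of \<phi> L J m S] VH_D[of \<phi> k m S] assms by (simp_all add: VG_def)

lemma T_ring_carrier: "carrier (T_ring L) = polys_in {SC i j | i j. i \<in> L \<and> j \<in> L \<and> i \<le> j}"
  by (simp add: T_ring_def)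

lemma T_ring_mono: "J \<subseteq> L \<Longrightarrow> carrier (T_ring J) \<subseteq> carrier (T_ring L)"
  unfolding T_ring_carrier by (rule polys_in_mono) auto

lemma T_ring_cpolys: "t \<in> carrier (T_ring L) \<Longrightarrow> t \<in> cpolys"
  unfolding T_ring_carrier cpolys_def by (rule subsetD[OF polys_in_mono]) auto

lemma T_ring_svJ: "t \<in> carrier (T_ring L) \<Longrightarrow> t \<in> polys_in (svJ J L)"
  unfolding T_ring_carrier by (rule subsetD[OF polys_in_mono]) (auto simp: svJ_def)

lemma T_ring_wpoly: "t \<in> carrier (T_ring L) \<Longrightarrow> t \<in> wpoly 0"
  unfolding wpoly_def
proof safe
  fix m assume t: "t \<in> carrier (T_ring L)" and m: "m \<in> Poly_Mapping.keys t"
  then have "Poly_Mapping.keys m \<subseteq> {SC i j | i j. i \<in> L \<and> j \<in> L \<and> i \<le> j}"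
    by (auto simp: T_ring_carrier polys_in_def)
  then show "mwt m = 0" unfolding mwt_def linext_def by (intro sum.neutral) auto
qed

lemma VG_T_scale: "\<phi> \<in> VG L k J \<Longrightarrow> t \<in> carrier (T_ring L) \<Longrightarrow> scale t \<phi> \<in> VG L k J"
  using VG_scale[OF _ T_ring_svJ T_ring_wpoly, of \<phi> L k J t] by simp

lemma bvec_VG:
  assumes "xdeg b = k" "xsupp b \<subseteq> J"
  shows "bvec b \<in> VG L k J"
proof -
  have *: "bset b \<subseteq> VL J" "Poly_Mapping.keys (bexp b) \<subseteq> svJ J L"
    using assms(2) xsupp_subset_iff by blast+
  have "scale (Poly_Mapping.single (bexp b) 1) (ev (bset b)) \<in> VG L (vdeg (bset b) + mwt (bexp b)) J"
    by (intro VG_scale VG_ev *) (use * in \<open>auto simp: polys_in_def wpoly_def\<close>)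
  then show ?thesis using assms(1) by (simp add: bvec_def xdeg_eq)
qed

lemma bcoord_T:
  assumes "\<phi> \<in> VG L k J"
  shows "bcoord \<phi> b \<in> carrier (T_ring L)"
  unfolding T_ring_carrier polys_in_def
proof safe
  fix n v assume "n \<in> Poly_Mapping.keys (bcoord \<phi> b)" and v: "v \<in> Poly_Mapping.keys n"
  then obtain m where "m \<in> Poly_Mapping.keys (\<phi> (bset b))" "n = mc m"
    unfolding bcoord_def by (auto elim: keys_extr)
  then have "v \<in> svJ J L" "cvar v"
    using v VG_D(2)[OF assms, of m "bset b"] by (auto simp: keys_mpart)
  then show "\<exists>i j. v = SC i j \<and> i \<in> L \<and> j \<in> L \<and> i \<le> j" by (auto simp: svJ_def)
qed

lemma bcoord_support:
  assumes "\<phi> \<in> VG L k J" "bcoord \<phi> b \<noteq> 0"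
  shows "xsupp b \<subseteq> J"
proof -
  obtain n where "n \<in> Poly_Mapping.keys (bcoord \<phi> b)" using assms(2) by fastforce
  then obtain m where m: "m \<in> Poly_Mapping.keys (\<phi> (bset b))" "mn m = bexp b"
    unfolding bcoord_def by (auto elim: keys_extr)
  note VG_D[OF assms(1) m(1)]
  moreover have "Poly_Mapping.keys (bexp b) \<subseteq> Poly_Mapping.keys m"
    using m(2) by (auto simp: keys_mpart simp flip: m(2))
  ultimately show ?thesis using xsupp_subset_iff by blast
qed

lemma finite_bmons_within:
  assumes J: "finite J"
  shows "finite (bmons_within k J)"
proof -
  let ?E = "{\<beta> :: nat \<Rightarrow>\<^sub>0 nat. \<forall>i. (i \<in> J \<longrightarrow> Poly_Mapping.lookup \<beta> i \<in> {..k})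
      \<and> (i \<notin> J \<longrightarrow> Poly_Mapping.lookup \<beta> i = 0)}"
  have "finite (Poly_Mapping.lookup ` ?E)"
    by (rule finite_subset[OF _ finite_set_of_finite_funs[OF J, of "{..k}" 0]]) auto
  then have E: "finite ?E"
    by (rule finite_imageD) (rule inj_onI, erule poly_mapping_eq_iff[THEN iffD2])
  have in_E: "\<beta> \<in> ?E" if "Poly_Mapping.keys \<beta> \<subseteq> J" "mdeg \<beta> \<le> k" for \<beta>
  proof -
    have "Poly_Mapping.lookup \<beta> i \<le> k" for i
    proof (cases "i \<in> Poly_Mapping.keys \<beta>")
      case True
      then have "Poly_Mapping.lookup \<beta> i \<le> mdeg \<beta>"
        unfolding mdeg_def by (intro member_le_sum) auto
      then show ?thesis using that by simp
    qed (simp add: in_keys_iff)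
    then show ?thesis using that by (auto simp: in_keys_iff)
  qed
  let ?S = "Pow J \<times> {..k} \<times> ?E"
  have "b \<in> (\<lambda>(I, a, \<beta>). BY I a \<beta>) ` ?S \<union> (\<lambda>(I, a, \<beta>). BXY I a \<beta>) ` ?S"
    if "b \<in> bmons_within k J" for b
  proof (cases b)
    case (BY I a \<beta>)
    then have "(I, a, \<beta>) \<in> ?S" using that in_E[of \<beta>] by (auto simp: bmons_within_def)
    then show ?thesis using BY by (auto intro!: image_eqI[of _ _ "(I, a, \<beta>)"])
  next
    case (BXY I a \<beta>)
    then have "(I, a, \<beta>) \<in> ?S" using that in_E[of \<beta>] by (auto simp: bmons_within_def)
    then show ?thesis using BXY by (auto intro!: image_eqI[of _ _ "(I, a, \<beta>)"])
  qed
  then have "bmons_within k J \<subseteq> (\<lambda>(I, a, \<beta>). BY I a \<beta>) ` ?S \<union> (\<lambda>(I, a, \<beta>). BXY I a \<beta>) ` ?S" by blast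
  moreover have "finite ?S" using E J by simp
  ultimately show ?thesis by (meson finite_UnI finite_imageI finite_subset)
qed

lemma mn_rs_exp:
  obtains a \<beta> where "mn m = rs_exp a \<beta>"
proof
  have inj: "inj SS" by (simp add: inj_def)
  show "mn m = rs_exp (Poly_Mapping.lookup m SR) (Poly_Mapping.map_key SS m)"
  proof (rule poly_mapping_eqI)
    fix v
    show "Poly_Mapping.lookup (mn m) v
        = Poly_Mapping.lookup (rs_exp (Poly_Mapping.lookup m SR) (Poly_Mapping.map_key SS m)) v"
      by (cases v) (simp_all add: lookup_mpart lookup_rs_exp map_key.rep_eq inj)
  qed
qed

text \<open>Monomials of \<phi> at S are grouped by their part in r and the s_i. Each such part,
  together with S, is a basis monomial, and it inherits degree k and support in J because the
  removed c_ij have degree 0.\<close>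

lemma VG_expand:
  assumes J: "finite J" and \<phi>: "\<phi> \<in> VG L k J"
  shows "(\<Sum>b\<in>bmons_within k J. scale (bcoord \<phi> b) (bvec b)) = \<phi>"
proof
  fix S
  let ?B = "{b \<in> bmons_within k J. bset b = S}"
  have fin: "finite (bmons_within k J)" by (rule finite_bmons_within[OF J])
  have "(\<Sum>b\<in>bmons_within k J. scale (bcoord \<phi> b) (bvec b)) S
      = (\<Sum>b\<in>bmons_within k J. if bset b = S then extr (bexp b) (\<phi> S) * Poly_Mapping.single (bexp b) 1 else 0)"
    unfolding sum_fun_apply by (rule sum.cong) (auto simp: scale_def bvec_def ev_def bcoord_def)
  also have "\<dots> = (\<Sum>b\<in>?B. extr (bexp b) (\<phi> S) * Poly_Mapping.single (bexp b) 1)"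
    using fin by (simp add: sum.inter_filter)
  also have "\<dots> = (\<Sum>m0\<in>bexp ` ?B. extr m0 (\<phi> S) * Poly_Mapping.single m0 1)"
  proof -
    have "inj_on bexp ?B" by (rule inj_onI, rule b_inj) auto
    then show ?thesis by (simp add: sum.reindex)
  qed
  also have "\<dots> = \<phi> S"
  proof (rule extr_expand)
    show "mn ` Poly_Mapping.keys (\<phi> S) \<subseteq> bexp ` ?B"
    proof safe
      fix m assume m: "m \<in> Poly_Mapping.keys (\<phi> S)"
      note d = VG_D(3,1,2)[OF \<phi> m]
      obtain a \<beta> where ab: "mn m = rs_exp a \<beta>" by (rule mn_rs_exp)
      have "S = vset (VX \<in> S, {i. VY i \<in> S})" by (rule vset_of[symmetric])
      then obtain b where b: "bset b = S" "bexp b = mn m"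
      proof (cases "VX \<in> S")
        case True
        then show ?thesis using \<open>S = _\<close> ab that[of "BXY {i. VY i \<in> S} a \<beta>"] by simp
      next
        case False
        then show ?thesis using \<open>S = _\<close> ab that[of "BY {i. VY i \<in> S} a \<beta>"] by simp
      qed
      have "Poly_Mapping.keys (bexp b) \<subseteq> svJ J L"
        using d(3) b by (auto simp: keys_mpart)
      then have "xsupp b \<subseteq> J" using xsupp_subset_iff b d(2) by blast
      moreover have "xdeg b = k" using b d(1) by (simp add: xdeg_eq mwt_mn)
      ultimately show "mn m \<in> bexp ` ?B" using b by (force simp: bmons_within_def)
    qed
  qed (use fin in simp)
  finally show "(\<Sum>b\<in>bmons_within k J. scale (bcoord \<phi> b) (bvec b)) S = \<phi> S" .
qed

subsection \<open>Filtered pieces and their quotients\<close>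

text \<open>Common frame for a filtered piece and for its quotient. Equality of images under
  \<open>e\<close> is tested by the coordinates in \<open>B\<close>: all of them for the filtered
  piece, those of exact support for the quotient.\<close>

locale coord_module = add_image G e W
  for G :: "(scalar, 'c) module" and e :: "(vvar set \<Rightarrow> scalar) \<Rightarrow> 'c" and W +
  fixes L :: "nat set" and B :: "bmon set" and u :: "bmon \<Rightarrow> 'c"
  assumes smult: "t \<in> carrier (T_ring L) \<Longrightarrow> \<phi> \<in> W \<Longrightarrow> t \<odot>\<^bsub>G\<^esub> e \<phi> = e (scale t \<phi>)"
    and W_scale: "t \<in> carrier (T_ring L) \<Longrightarrow> \<phi> \<in> W \<Longrightarrow> scale t \<phi> \<in> W"
    and fin_B: "finite B" and bvec_W: "b \<in> B \<Longrightarrow> bvec b \<in> W"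
    and u: "b \<in> B \<Longrightarrow> u b = e (bvec b)"
    and e_eq_iff: "\<phi> \<in> W \<Longrightarrow> \<psi> \<in> W \<Longrightarrow> e \<phi> = e \<psi> \<longleftrightarrow> (\<forall>b\<in>B. bcoord \<phi> b = bcoord \<psi> b)"
    and bcoord_carrier: "\<phi> \<in> W \<Longrightarrow> bcoord \<phi> b \<in> carrier (T_ring L)"
begin

lemma coords_e:
  assumes \<phi>: "\<phi> \<in> W"
  shows "coords (T_ring L) G u B (e \<phi>) = restrict (bcoord \<phi>) B"
proof -
  have fs: "finsum G (\<lambda>b. c b \<odot>\<^bsub>G\<^esub> u b) B = e (\<Sum>b\<in>B. scale (c b) (bvec b))"
    "(\<Sum>b\<in>B. scale (c b) (bvec b)) \<in> W"
    if "c \<in> B \<rightarrow>\<^sub>E carrier (T_ring L)" for c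
  proof -
    have c: "c b \<in> carrier (T_ring L)" if "b \<in> B" for b using that \<open>c \<in> _\<close> by auto
    show "finsum G (\<lambda>b. c b \<odot>\<^bsub>G\<^esub> u b) B = e (\<Sum>b\<in>B. scale (c b) (bvec b))"
      by (rule finsum_image) (simp_all add: u smult c bvec_W W_scale)
    show "(\<Sum>b\<in>B. scale (c b) (bvec b)) \<in> W"
      by (intro sum_in_closed W_0 W_add W_scale c bvec_W)
  qed
  have iff: "e \<phi> = finsum G (\<lambda>b. c b \<odot>\<^bsub>G\<^esub> u b) B \<longleftrightarrow> (\<forall>b\<in>B. bcoord \<phi> b = c b)"
    if "c \<in> B \<rightarrow>\<^sub>E carrier (T_ring L)" for c
  proof -
    have "c b \<in> cpolys" if "b \<in> B" for b using that \<open>c \<in> _\<close> T_ring_cpolys by blast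
    then show ?thesis
      using fs[OF that] e_eq_iff[OF \<phi> fs(2)[OF that]] by (simp add: bcoord_comb[OF fin_B])
  qed
  show ?thesis
    unfolding coords_def
  proof (rule the_equality)
    show "restrict (bcoord \<phi>) B \<in> B \<rightarrow>\<^sub>E carrier (T_ring L) \<and>
      e \<phi> = finsum G (\<lambda>b. restrict (bcoord \<phi>) B b \<odot>\<^bsub>G\<^esub> u b) B"
      using iff[of "restrict (bcoord \<phi>) B"] bcoord_carrier[OF \<phi>] by auto
  next
    fix c assume "c \<in> B \<rightarrow>\<^sub>E carrier (T_ring L) \<and> e \<phi> = finsum G (\<lambda>b. c b \<odot>\<^bsub>G\<^esub> u b) B"
    then show "c = restrict (bcoord \<phi>) B"
      using iff[of c] by (auto simp: fun_eq_iff PiE_def extensional_def)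
  qed
qed

text \<open>The chosen enumeration of \<open>B\<close> is the same on both sides, so only the
  entries have to be compared.\<close>

lemma endo_det_e:
  assumes "\<And>\<phi>. \<phi> \<in> W \<Longrightarrow> f (e \<phi>) = e (h \<phi>)" "\<And>\<phi>. \<phi> \<in> W \<Longrightarrow> h \<phi> \<in> W"
  shows "endo_det (T_ring L) G u B f = set_det (\<lambda>c b. bcoord (h (bvec b)) c) B"
proof -
  define bs where "bs = (SOME bs. distinct bs \<and> set bs = B)"
  have "\<exists>bs. distinct bs \<and> set bs = B" using finite_distinct_list[OF fin_B] by blast
  then have "distinct bs \<and> set bs = B" unfolding bs_def by (rule someI_ex)
  then have B: "bs ! i \<in> B" if "i < length bs" for i using that by auto
  have "coords (T_ring L) G u B (f (u b)) c = bcoord (h (bvec b)) c" if "b \<in> B" "c \<in> B" for b c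
    using that coords_e[of "h (bvec b)"] by (simp add: u assms bvec_W)
  then have "mat (length bs) (length bs) (\<lambda>(i, j). coords (T_ring L) G u B (f (u (bs ! j))) (bs ! i))
    = mat (length bs) (length bs) (\<lambda>(i, j). bcoord (h (bvec (bs ! j))) (bs ! i))"
    by (intro cong_mat) (auto simp: B)
  then show ?thesis
    unfolding endo_det_def set_det_def list_det_def Let_def bs_def[symmetric] by simp
qed

end

section \<open>The sum of the smaller filtered pieces in coordinates\<close>

lemma VG_mono: "J' \<subseteq> J \<Longrightarrow> VG L k J' \<subseteq> VG L k J"
proof
  fix \<phi> assume J': "J' \<subseteq> J" and \<phi>: "\<phi> \<in> VG L k J'"
  have sub: "svJ J' L \<subseteq> svJ J L" "VL J' \<subseteq> VL J" using J' by (auto simp: svJ_def)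
  have "\<phi> \<in> VJ L J"
  proof (rule VJ_I)
    fix S m assume "m \<in> Poly_Mapping.keys (\<phi> S)"
    from VG_D(1,2)[OF \<phi> this] sub show "S \<subseteq> VL J \<and> Poly_Mapping.keys m \<subseteq> svJ J L" by blast
  qed
  with \<phi> show "\<phi> \<in> VG L k J" by (simp add: VG_def)
qed

lemma VG_VJ: "\<phi> \<in> VG L k J \<Longrightarrow> J \<subseteq> L \<Longrightarrow> \<phi> \<in> VJ L L"
  using VG_mono[of J L L k] by (auto simp: VG_def)

lemma VG_uminus: "\<phi> \<in> VG L k J \<Longrightarrow> - \<phi> \<in> VG L k J"
  by (simp add: VG_def VJ_def VH_def)

lemma VG_diff: "\<phi> \<in> VG L k J \<Longrightarrow> \<psi> \<in> VG L k J \<Longrightarrow> \<phi> - \<psi> \<in> VG L k J"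
  using VG_add[of \<phi> L k J "- \<psi>"] VG_uminus by simp

lemma bcoord_diff: "bcoord (\<phi> - \<psi>) b = bcoord \<phi> b - bcoord \<psi> b"
  using bcoord_add[of "\<phi> - \<psi>" \<psi> b] by simp

definition VB :: "nat set \<Rightarrow> nat \<Rightarrow> nat set \<Rightarrow> (vvar set \<Rightarrow> scalar) set" where
  "VB L k J = {\<Sum>J' | J' \<subset> J. g J' | g. \<forall>J'. J' \<subset> J \<longrightarrow> g J' \<in> VG L k J'}"

lemma VB_I: "(\<And>J'. J' \<subset> J \<Longrightarrow> g J' \<in> VG L k J') \<Longrightarrow> (\<Sum>J' | J' \<subset> J. g J') \<in> VB L k J"
  by (auto simp: VB_def)

text \<open>Pieces of smaller support have no coordinates of support J. Conversely, if these vanish,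
  sorting the basis expansion by exact support writes the vector as a sum over the proper
  subsets.\<close>

lemma VB_iff:
  assumes J: "finite J"
  shows "\<phi> \<in> VB L k J \<longleftrightarrow> \<phi> \<in> VG L k J \<and> (\<forall>b\<in>bmons_exact k J. bcoord \<phi> b = 0)"
proof safe
  assume "\<phi> \<in> VB L k J"
  then obtain g where g: "\<phi> = (\<Sum>J' | J' \<subset> J. g J')" "\<And>J'. J' \<subset> J \<Longrightarrow> g J' \<in> VG L k J'"
    by (auto simp: VB_def)
  show "\<phi> \<in> VG L k J"
    unfolding g(1)
  proof (rule VG_sum)
    fix J' assume "J' \<in> {J'. J' \<subset> J}"
    then show "g J' \<in> VG L k J" using g(2)[of J'] VG_mono[of J' J L k] by auto
  qed
  fix b assume b: "b \<in> bmons_exact k J"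
  show "bcoord \<phi> b = 0"
    unfolding g(1) bcoord_sum
  proof (rule sum.neutral, rule ballI)
    fix J' assume "J' \<in> {J'. J' \<subset> J}"
    then have J': "J' \<subset> J" by simp
    show "bcoord (g J') b = 0"
      using bcoord_support[OF g(2)[OF J'], of b] b J' by (auto simp: bmons_exact_def)
  qed
next
  assume \<phi>: "\<phi> \<in> VG L k J" and 0: "\<forall>b\<in>bmons_exact k J. bcoord \<phi> b = 0"
  define g where "g J' = (\<Sum>b\<in>bmons_exact k J'. scale (bcoord \<phi> b) (bvec b))" for J'
  have fin: "finite (bmons_within k J)" by (rule finite_bmons_within[OF J])
  have "\<phi> = (\<Sum>b\<in>bmons_within k J. scale (bcoord \<phi> b) (bvec b))"
    by (rule VG_expand[OF J \<phi>, symmetric])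
  also have "\<dots> = (\<Sum>b\<in>bmons_within k J - bmons_exact k J. scale (bcoord \<phi> b) (bvec b))"
    using 0 by (intro sum.mono_neutral_right fin) auto
  also have "bmons_within k J - bmons_exact k J = (\<Union>J'\<in>{J'. J' \<subset> J}. bmons_exact k J')"
    by (auto simp: bmons_within_def bmons_exact_def)
  also have "(\<Sum>b\<in>\<dots>. scale (bcoord \<phi> b) (bvec b)) = (\<Sum>J' | J' \<subset> J. g J')"
    unfolding g_def
  proof (rule sum.UNION_disjoint)
    show "finite {J'. J' \<subset> J}" by (rule finite_subset[of _ "Pow J"]) (use J in auto)
    show "\<forall>J'\<in>{J'. J' \<subset> J}. finite (bmons_exact k J')"
      by (auto intro!: finite_subset[OF _ fin] simp: bmons_within_def bmons_exact_def)
  qed (auto simp: bmons_exact_def)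
  finally have "\<phi> = (\<Sum>J' | J' \<subset> J. g J')" .
  moreover have "g J' \<in> VG L k J'" for J'
    unfolding g_def
    by (intro VG_sum VG_T_scale bvec_VG bcoord_T[OF \<phi>]) (auto simp: bmons_exact_def)
  ultimately show "\<phi> \<in> VB L k J" by (auto simp: VB_def)
qed

lemma Kop_0 [simp]: "Kop M 0 = 0"
  using Kop_add[of M 0 0] by simp

lemma VB_Kop:
  assumes "\<phi> \<in> VB L k J" "J \<subseteq> L"
  shows "Kop M \<phi> \<in> VB L k J"
proof -
  obtain g where g: "\<phi> = (\<Sum>J' | J' \<subset> J. g J')" "\<And>J'. J' \<subset> J \<Longrightarrow> g J' \<in> VG L k J'"
    using assms(1) by (auto simp: VB_def)
  have "Kop M \<phi> = (\<Sum>J' | J' \<subset> J. Kop M (g J'))"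
    unfolding g(1) by (rule additive_sum[of "Kop M"]) (simp_all add: Kop_add)
  moreover have "Kop M (g J') \<in> VG L k J'" if "J' \<subset> J" for J'
    using that assms(2) by (intro VG_Kop g) auto
  ultimately show ?thesis by (auto simp: VB_def)
qed

lemma finite_bmons_exact: "finite J \<Longrightarrow> finite (bmons_exact k J)"
  by (rule finite_subset[OF _ finite_bmons_within[of J k]])
    (auto simp: bmons_within_def bmons_exact_def)

text \<open>The algebra \<open>L\<close> does not occur here, which is why the exact-support determinants are
  obtained from the smaller algebra by coefficient extension.\<close>

definition K_entry :: "nat set \<Rightarrow> bmon \<Rightarrow> bmon \<Rightarrow> scalar" where
  "K_entry M c b = bcoord (Kop M (bvec b)) c"

section \<open>Passage from coordinates to the filtered pieces and their quotients\<close>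

context
  fixes M L J :: "nat set" and k :: nat
  assumes M: "finite M" and LM: "L \<subseteq> M" and JL: "J \<subseteq> L"
begin

lemma finJ: "finite J"
  using M LM JL by (meson finite_subset)

lemma bas_elt: "xsupp b \<subseteq> L \<Longrightarrow> bas L b = elt L (bvec b)"
proof (cases b)
  case (BY I a \<beta>)
  assume "xsupp b \<subseteq> L"
  then have "I \<subseteq> L" "Poly_Mapping.single (bexp b) 1 \<in> polys_in (sv L)"
    using xsupp_subset_iff[of b L L] BY by (auto simp: polys_in_def svJ_same)
  then show ?thesis
    using BY elt_emb[OF M LM ev_VJ[OF M LM]] by (simp add: y_wedge_elt[OF M LM] rs_monom_eq bvec_def)
next
  case (BXY I a \<beta>)
  assume "xsupp b \<subseteq> L"
  then have "I \<subseteq> L" "Poly_Mapping.single (bexp b) 1 \<in> polys_in (sv L)"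
    using xsupp_subset_iff[of b L L] BXY by (auto simp: polys_in_def svJ_same)
  then show ?thesis
    using BXY elt_emb[OF M LM ev_VJ[OF M LM]] by (simp add: xy_wedge_elt[OF M LM] rs_monom_eq bvec_def)
qed

lemma VGJ: "\<phi> \<in> VG L k J' \<Longrightarrow> J' \<subseteq> J \<Longrightarrow> \<phi> \<in> VJ L L"
  using VG_VJ[of \<phi> L k J'] JL by auto

lemma T_sv: "t \<in> carrier (T_ring L) \<Longrightarrow> t \<in> polys_in (sv L)"
  using T_ring_svJ[of t L L] by (simp add: svJ_same)

lemma elt_smult: "t \<in> carrier (T_ring L) \<Longrightarrow> \<phi> \<in> VJ L L \<Longrightarrow> elt L \<phi> \<otimes>\<^bsub>RA L\<^esub> emb L t = elt L (scale t \<phi>)"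
  using elt_emb(1)[OF M LM _ T_sv] by blast

lemma RA_module_image: "add_image (RA_module L) (elt L) (VJ L L)"
  using RA_elt_image[OF M LM] by (simp add: add_image_def RA_module_def)

lemma Filt_eq: "J' \<subseteq> J \<Longrightarrow> Filt L k J' = elt L ` VG L k J'"
proof -
  assume J': "J' \<subseteq> J"
  interpret add_image "RA_module L" "elt L" "VJ L L" by (rule RA_module_image)
  have fs: "finsum (RA_module L) (\<lambda>b. t b \<odot>\<^bsub>RA_module L\<^esub> bas L b) (bmons_within k J')
      = elt L (\<Sum>b\<in>bmons_within k J'. scale (t b) (bvec b))"
    "(\<Sum>b\<in>bmons_within k J'. scale (t b) (bvec b)) \<in> VG L k J'"
    if t: "t \<in> bmons_within k J' \<rightarrow> carrier (T_ring L)" for t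
  proof -
    have b: "bas L b = elt L (bvec b)" "bvec b \<in> VG L k J'" "bvec b \<in> VJ L L"
      if "b \<in> bmons_within k J'" for b
      using that J' JL bas_elt[of b] bvec_VG[of b k J' L] VGJ[of "bvec b" J']
      by (auto simp: bmons_within_def)
    show "finsum (RA_module L) (\<lambda>b. t b \<odot>\<^bsub>RA_module L\<^esub> bas L b) (bmons_within k J')
      = elt L (\<Sum>b\<in>bmons_within k J'. scale (t b) (bvec b))"
    proof (rule finsum_image)
      fix i assume i: "i \<in> bmons_within k J'"
      with t have "t i \<in> carrier (T_ring L)" by auto
      with i show "t i \<odot>\<^bsub>RA_module L\<^esub> bas L i = elt L (scale (t i) (bvec i))"
        "scale (t i) (bvec i) \<in> VJ L L"
        using elt_smult[of "t i" "bvec i"] VGJ[OF VG_T_scale[OF b(2)[OF i]] J'] b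
        by (simp_all add: RA_module_def)
    qed
    show "(\<Sum>b\<in>bmons_within k J'. scale (t b) (bvec b)) \<in> VG L k J'"
      using t b by (intro VG_sum VG_T_scale) auto
  qed
  show ?thesis
  proof safe
    fix F assume "F \<in> Filt L k J'"
    then show "F \<in> elt L ` VG L k J'" unfolding Filt_def using fs by auto
  next
    fix \<phi> assume \<phi>: "\<phi> \<in> VG L k J'"
    have t: "bcoord \<phi> \<in> bmons_within k J' \<rightarrow> carrier (T_ring L)"
      using bcoord_T[OF \<phi>] by auto
    have "finite J'" using finJ J' finite_subset by blast
    from fs(1)[OF t] VG_expand[OF this \<phi>] t show "elt L \<phi> \<in> Filt L k J'"
      unfolding Filt_def by auto
  qed
qed

lemma Filt_below_eq: "Filt_below L k J = elt L ` VB L k J"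
proof -
  interpret add_image "RA_module L" "elt L" "VJ L L" by (rule RA_module_image)
  have fs: "finsum (RA_module L) f {J'. J' \<subset> J} = elt L (\<Sum>J' | J' \<subset> J. g J')"
    if "\<And>J'. J' \<subset> J \<Longrightarrow> f J' = elt L (g J')" "\<And>J'. J' \<subset> J \<Longrightarrow> g J' \<in> VG L k J'" for f g
  proof (rule finsum_image)
    fix J' assume "J' \<in> {J'. J' \<subset> J}"
    then show "f J' = elt L (g J')" "g J' \<in> VJ L L" using that[of J'] VGJ[of "g J'" J'] by auto
  qed
  show ?thesis
  proof safe
    fix F assume "F \<in> Filt_below L k J"
    then obtain f where f: "F = finsum (RA_module L) f {J'. J' \<subset> J}" "f \<in> Pi {J'. J' \<subset> J} (Filt L k)"
      by (auto simp: Filt_below_def)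
    have "\<exists>g. J' \<subset> J \<longrightarrow> f J' = elt L g \<and> g \<in> VG L k J'" for J'
    proof (cases "J' \<subset> J")
      case True
      then have "f J' \<in> elt L ` VG L k J'" using f(2) Filt_eq[of J'] by auto
      then show ?thesis by auto
    qed auto
    then obtain g where "\<And>J'. J' \<subset> J \<Longrightarrow> f J' = elt L (g J')" "\<And>J'. J' \<subset> J \<Longrightarrow> g J' \<in> VG L k J'"
      by metis
    with fs[of f g] f(1) show "F \<in> elt L ` VB L k J" by (auto simp: VB_def)
  next
    fix \<phi> assume "\<phi> \<in> VB L k J"
    then obtain g where g: "\<phi> = (\<Sum>J' | J' \<subset> J. g J')" "\<And>J'. J' \<subset> J \<Longrightarrow> g J' \<in> VG L k J'"
      by (auto simp: VB_def)
    have "elt L \<phi> = finsum (RA_module L) (\<lambda>J'. elt L (g J')) {J'. J' \<subset> J}"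
      using fs[of "\<lambda>J'. elt L (g J')" g] g by simp
    moreover have "(\<lambda>J'. elt L (g J')) \<in> Pi {J'. J' \<subset> J} (Filt L k)"
      using g(2) Filt_eq by auto
    ultimately show "elt L \<phi> \<in> Filt_below L k J" unfolding Filt_below_def by blast
  qed
qed

lemma Filt_module_simps:
  "carrier (Filt_module L k J) = elt L ` VG L k J" "x \<oplus>\<^bsub>Filt_module L k J\<^esub> y = x \<oplus>\<^bsub>RA L\<^esub> y"
  "\<zero>\<^bsub>Filt_module L k J\<^esub> = \<zero>\<^bsub>RA L\<^esub>" "t \<odot>\<^bsub>Filt_module L k J\<^esub> x = x \<otimes>\<^bsub>RA L\<^esub> emb L t"
  by (simp_all add: Filt_module_def RA_module_def Filt_eq)

lemma VG_elt_eq_iff: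
  assumes "\<phi> \<in> VG L k J" "\<psi> \<in> VG L k J"
  shows "elt L \<phi> = elt L \<psi> \<longleftrightarrow> (\<forall>b\<in>bmons_within k J. bcoord \<phi> b = bcoord \<psi> b)"
proof -
  have "elt L \<phi> = elt L \<psi> \<longleftrightarrow> \<phi> = \<psi>"
    using elt_eq_iff[OF M LM] VGJ assms by blast
  also have "\<dots> \<longleftrightarrow> (\<forall>b\<in>bmons_within k J. bcoord \<phi> b = bcoord \<psi> b)"
  proof
    assume "\<forall>b\<in>bmons_within k J. bcoord \<phi> b = bcoord \<psi> b"
    then have "(\<Sum>b\<in>bmons_within k J. scale (bcoord \<phi> b) (bvec b))
        = (\<Sum>b\<in>bmons_within k J. scale (bcoord \<psi> b) (bvec b))" by (intro sum.cong) auto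
    then show "\<phi> = \<psi>" using VG_expand[OF finJ] assms by metis
  qed simp
  finally show ?thesis .
qed

lemma Filt_coord_module:
  "coord_module (Filt_module L k J) (elt L) (VG L k J) L (bmons_within k J) (bas L)"
proof
  show "bas L b = elt L (bvec b)" "bvec b \<in> VG L k J" if "b \<in> bmons_within k J" for b
    using that JL bas_elt[of b] bvec_VG[of b k J L] by (auto simp: bmons_within_def)
qed (auto simp: Filt_module_simps VG_add VG_T_scale elt_add[OF M LM] elt_zero[OF M LM] VGJ elt_smult
    finite_bmons_within finJ VG_elt_eq_iff intro: bcoord_T)

lemma K_op_VG: "\<phi> \<in> VG L k J \<Longrightarrow> K_op L (elt L \<phi>) = elt L (Kop M \<phi>)"
  by (rule K_op_elt[OF M LM VGJ]) auto

lemma VB_add: "\<phi> \<in> VB L k J \<Longrightarrow> \<psi> \<in> VB L k J \<Longrightarrow> \<phi> + \<psi> \<in> VB L k J"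
  and VB_0: "0 \<in> VB L k J"
  and VB_diff: "\<phi> \<in> VB L k J \<Longrightarrow> \<psi> \<in> VB L k J \<Longrightarrow> \<phi> - \<psi> \<in> VB L k J"
  and VB_VG: "\<phi> \<in> VB L k J \<Longrightarrow> \<phi> \<in> VG L k J"
  by (simp_all add: VB_iff[OF finJ] VG_add VG_diff bcoord_add bcoord_diff)
    (simp add: bcoord_def)

lemma VB_scale: "\<phi> \<in> VB L k J \<Longrightarrow> t \<in> carrier (T_ring L) \<Longrightarrow> scale t \<phi> \<in> VB L k J"
proof -
  assume \<phi>: "\<phi> \<in> VB L k J" and t: "t \<in> carrier (T_ring L)"
  obtain g where g: "\<phi> = (\<Sum>J' | J' \<subset> J. g J')" "\<And>J'. J' \<subset> J \<Longrightarrow> g J' \<in> VG L k J'"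
    using \<phi> by (auto simp: VB_def)
  show ?thesis unfolding g(1) scale_sum by (rule VB_I) (rule VG_T_scale[OF g(2) t])
qed

lemma gr_cls_elt:
  assumes "\<phi> \<in> VG L k J"
  shows "gr_cls L k J (elt L \<phi>) = (\<lambda>\<chi>. elt L (\<chi> + \<phi>)) ` VB L k J"
proof -
  have "elt L \<chi> \<oplus>\<^bsub>RA L\<^esub> elt L \<phi> = elt L (\<chi> + \<phi>)" if "\<chi> \<in> VB L k J" for \<chi>
    using elt_add[OF M LM] VGJ VB_VG that assms by blast
  then show ?thesis
    unfolding gr_cls_def a_r_coset_def' Filt_below_eq by (auto simp: Filt_module_simps)
qed

lemma gr_cls_eq_iff:
  assumes "\<phi> \<in> VG L k J" "\<psi> \<in> VG L k J"
  shows "gr_cls L k J (elt L \<phi>) = gr_cls L k J (elt L \<psi>) \<longleftrightarrow> \<phi> - \<psi> \<in> VB L k J"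
proof
  assume "gr_cls L k J (elt L \<phi>) = gr_cls L k J (elt L \<psi>)"
  moreover have "elt L \<phi> \<in> gr_cls L k J (elt L \<phi>)"
    using VB_0 assms by (auto simp: gr_cls_elt intro!: image_eqI[of _ _ 0])
  ultimately obtain \<chi> where \<chi>: "\<chi> \<in> VB L k J" "elt L \<phi> = elt L (\<chi> + \<psi>)"
    using assms by (auto simp: gr_cls_elt)
  then have "\<phi> = \<chi> + \<psi>"
    using elt_eq_iff[OF M LM] VGJ VG_add VB_VG assms by blast
  with \<chi> show "\<phi> - \<psi> \<in> VB L k J" by simp
next
  assume d: "\<phi> - \<psi> \<in> VB L k J"
  have "(\<lambda>\<chi>. \<chi> + \<phi>) ` VB L k J = (\<lambda>\<chi>. \<chi> + \<psi>) ` VB L k J"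
  proof safe
    fix \<chi> assume \<chi>: "\<chi> \<in> VB L k J"
    show "\<chi> + \<phi> \<in> (\<lambda>\<chi>. \<chi> + \<psi>) ` VB L k J"
      by (rule image_eqI[of _ _ "\<chi> + (\<phi> - \<psi>)"]) (use VB_add[OF \<chi> d] in simp_all)
    show "\<chi> + \<psi> \<in> (\<lambda>\<chi>. \<chi> + \<phi>) ` VB L k J"
      by (rule image_eqI[of _ _ "\<chi> - (\<phi> - \<psi>)"]) (use VB_diff[OF \<chi> d] in simp_all)
  qed
  from arg_cong[OF this, of "image (elt L)"] assms
  show "gr_cls L k J (elt L \<phi>) = gr_cls L k J (elt L \<psi>)"
    by (simp add: gr_cls_elt image_image)
qed

lemma gr_cls_add:
  assumes "\<phi> \<in> VG L k J" "\<psi> \<in> VG L k J"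
  shows "gr_cls L k J (elt L \<phi>) \<oplus>\<^bsub>gr_module L k J\<^esub> gr_cls L k J (elt L \<psi>) = gr_cls L k J (elt L (\<phi> + \<psi>))"
proof -
  have e: "elt L (\<chi> + \<phi>) \<oplus>\<^bsub>RA L\<^esub> elt L (\<chi>' + \<psi>) = elt L ((\<chi> + \<chi>') + (\<phi> + \<psi>))"
    if "\<chi> \<in> VB L k J" "\<chi>' \<in> VB L k J" for \<chi> \<chi>'
  proof -
    have "\<chi> + \<phi> \<in> VJ L L" "\<chi>' + \<psi> \<in> VJ L L"
      using that assms VGJ VG_add VB_VG by blast+
    then show ?thesis by (simp add: elt_add[OF M LM] algebra_simps)
  qed
  have "set_add (Filt_module L k J) (gr_cls L k J (elt L \<phi>)) (gr_cls L k J (elt L \<psi>))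
      = gr_cls L k J (elt L (\<phi> + \<psi>))"
  proof safe
    fix F assume "F \<in> set_add (Filt_module L k J) (gr_cls L k J (elt L \<phi>)) (gr_cls L k J (elt L \<psi>))"
    then obtain \<chi> \<chi>' where "\<chi> \<in> VB L k J" "\<chi>' \<in> VB L k J" "F = elt L (\<chi> + \<phi>) \<oplus>\<^bsub>RA L\<^esub> elt L (\<chi>' + \<psi>)"
      using assms by (auto simp: set_add_def' gr_cls_elt Filt_module_simps)
    then show "F \<in> gr_cls L k J (elt L (\<phi> + \<psi>))"
      using e VB_add assms by (auto simp: gr_cls_elt VG_add)
  next
    fix F assume "F \<in> gr_cls L k J (elt L (\<phi> + \<psi>))"
    then obtain \<chi> where \<chi>: "\<chi> \<in> VB L k J" "F = elt L (\<chi> + (\<phi> + \<psi>))"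
      using assms by (auto simp: gr_cls_elt VG_add)
    then have "F = elt L (\<chi> + \<phi>) \<oplus>\<^bsub>RA L\<^esub> elt L (0 + \<psi>)" using e[OF \<chi>(1) VB_0] by simp
    then have "\<exists>x\<in>VB L k J. \<exists>y\<in>VB L k J. F = elt L (x + \<phi>) \<oplus>\<^bsub>RA L\<^esub> elt L (y + \<psi>)"
      using \<chi>(1) VB_0 by blast
    then show "F \<in> set_add (Filt_module L k J) (gr_cls L k J (elt L \<phi>)) (gr_cls L k J (elt L \<psi>))"
      using assms by (auto simp: set_add_def' gr_cls_elt Filt_module_simps)
  qed
  then show ?thesis by (simp add: gr_module_def quotient_module_def)
qed

text \<open>Operations on the quotient are unions over all representatives of a coset. A map that is
  additive and preserves the smaller pieces sends all representatives to one coset, so the union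
  collapses.\<close>

lemma UN_gr_cls:
  assumes \<phi>: "\<phi> \<in> VG L k J"
    and f: "\<And>\<psi>. \<psi> \<in> VG L k J \<Longrightarrow> f (elt L \<psi>) = elt L (h \<psi>)"
    and h: "\<And>\<psi>. \<psi> \<in> VG L k J \<Longrightarrow> h \<psi> \<in> VG L k J" "\<And>\<psi>. \<psi> \<in> VB L k J \<Longrightarrow> h \<psi> \<in> VB L k J"
      "\<And>\<psi> \<chi>. h (\<psi> + \<chi>) = h \<psi> + h \<chi>"
  shows "(\<Union>F\<in>gr_cls L k J (elt L \<phi>). gr_cls L k J (f F)) = gr_cls L k J (elt L (h \<phi>))"
proof -
  have "gr_cls L k J (f (elt L (\<chi> + \<phi>))) = gr_cls L k J (elt L (h \<phi>))" if \<chi>: "\<chi> \<in> VB L k J" for \<chi>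
  proof -
    have c: "\<chi> + \<phi> \<in> VG L k J" using VG_add VB_VG \<chi> \<phi> by blast
    show ?thesis
      using gr_cls_eq_iff[OF h(1)[OF c] h(1)[OF \<phi>]] h(2)[OF \<chi>] f[OF c] by (simp add: h(3))
  qed
  then show ?thesis using VB_0 \<phi> by (auto simp: gr_cls_elt)
qed

lemma gr_smult:
  assumes t: "t \<in> carrier (T_ring L)" and \<phi>: "\<phi> \<in> VG L k J"
  shows "t \<odot>\<^bsub>gr_module L k J\<^esub> gr_cls L k J (elt L \<phi>) = gr_cls L k J (elt L (scale t \<phi>))"
  using UN_gr_cls[OF \<phi>, of "\<lambda>F. F \<otimes>\<^bsub>RA L\<^esub> emb L t" "scale t"] t
  by (simp add: gr_module_def quotient_module_def gr_cls_def[symmetric] Filt_module_simps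
      elt_smult VGJ VG_T_scale VB_scale scale_add)

lemma gr_K_elt:
  assumes \<phi>: "\<phi> \<in> VG L k J"
  shows "gr_K L k J (gr_cls L k J (elt L \<phi>)) = gr_cls L k J (elt L (Kop M \<phi>))"
  using UN_gr_cls[OF \<phi>, of "K_op L" "Kop M"]
  by (simp add: gr_K_def induced_map_def gr_cls_def[symmetric] K_op_VG VG_Kop VB_Kop JL Kop_add)

lemma gr_carrier: "carrier (gr_module L k J) = (\<lambda>\<phi>. gr_cls L k J (elt L \<phi>)) ` VG L k J"
  by (auto simp: gr_module_def quotient_module_def A_RCOSETS_def' gr_cls_def Filt_module_simps)

lemma gr_zero: "\<zero>\<^bsub>gr_module L k J\<^esub> = gr_cls L k J (elt L 0)"
  using gr_cls_elt[OF VG_0] by (simp add: gr_module_def quotient_module_def Filt_below_eq)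

text \<open>The map to cosets is not injective on \<open>VG L k J\<close>; by \<open>VB_iff\<close>
  its fibres are described exactly by the coordinates of support J.\<close>

lemma gr_coord_module:
  "coord_module (gr_module L k J) (\<lambda>\<phi>. gr_cls L k J (elt L \<phi>)) (VG L k J) L
     (bmons_exact k J) (\<lambda>b. gr_cls L k J (bas L b))"
proof
  show "gr_cls L k J (bas L b) = gr_cls L k J (elt L (bvec b))" "bvec b \<in> VG L k J"
    if "b \<in> bmons_exact k J" for b
    using that JL bas_elt[of b] bvec_VG[of b k J L] by (auto simp: bmons_exact_def)
  show "finite (bmons_exact k J)" by (rule finite_bmons_exact[OF finJ])
  show "gr_cls L k J (elt L \<phi>) = gr_cls L k J (elt L \<psi>) \<longleftrightarrow> (\<forall>b\<in>bmons_exact k J. bcoord \<phi> b = bcoord \<psi> b)"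
    if "\<phi> \<in> VG L k J" "\<psi> \<in> VG L k J" for \<phi> \<psi>
    using that by (simp add: gr_cls_eq_iff VB_iff[OF finJ] VG_diff bcoord_diff)
qed (auto simp: gr_carrier gr_cls_add gr_zero gr_smult VG_add VG_T_scale intro: bcoord_T)

lemma endo_det_Filt:
  "endo_det (T_ring L) (Filt_module L k J) (bas L) (bmons_within k J) (K_op L) = set_det (K_entry M) (bmons_within k J)"
  using coord_module.endo_det_e[OF Filt_coord_module, of "K_op L" "Kop M"]
  by (simp add: K_op_VG VG_Kop JL K_entry_def[abs_def])

lemma D_gr_eq: "D_gr L k J = set_det (K_entry M) (bmons_exact k J)"
  using coord_module.endo_det_e[OF gr_coord_module, of "gr_K L k J" "Kop M"]
  by (simp add: D_gr_def gr_K_elt VG_Kop JL K_entry_def[abs_def])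

end

section \<open>Invariance, triangularity and coefficient extension for the index set 1 to N\<close>

theorem proposition6p3:
  fixes N k :: nat
  shows
    "(\<forall>J \<subseteq> {1..N}. K_op {1..N} ` Filt {1..N} k J \<subseteq> Filt {1..N} k J)
     \<and> (\<forall>J \<subseteq> {1..N}.
          gr_K {1..N} k J \<in> module_endos (T_ring {1..N}) (gr_module {1..N} k J) \<and>
          (\<forall>F \<in> Filt {1..N} k J.
             gr_K {1..N} k J (gr_cls {1..N} k J F) = gr_cls {1..N} k J (K_op {1..N} F)))
     \<and> D_det {1..N} k = (\<Prod>J \<in> Pow {1..N}. D_gr {1..N} k J)
     \<and> (\<forall>J \<subseteq> {1..N}.
          D_gr J k J \<in> carrier (T_ring J) \<and>
          carrier (T_ring J) \<subseteq> carrier (T_ring {1..N}) \<and>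
          D_gr {1..N} k J = D_gr J k J)"
proof -
  define L where "L = {1..N}"
  have M: "finite L" and LL: "L \<subseteq> L" by (auto simp: L_def)
  have Filt: "Filt L k J = elt L ` VG L k J" if "J \<subseteq> L" for J
    by (rule Filt_eq[OF M LL that order_refl])
  have K: "K_op L (elt L \<phi>) = elt L (Kop L \<phi>)" if "J \<subseteq> L" "\<phi> \<in> VG L k J" for J \<phi>
    by (rule K_op_VG[OF M LL that])
  have 1: "K_op L ` Filt L k J \<subseteq> Filt L k J" if J: "J \<subseteq> L" for J
    using VG_Kop[OF _ J] K[OF J] Filt[OF J] by auto
  have 2: "gr_K L k J \<in> module_endos (T_ring L) (gr_module L k J)"
    if J: "J \<subseteq> L" for J
    unfolding module_endos_def gr_carrier[OF M LL J]
    using VG_Kop[OF _ J]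
    by (auto simp: gr_K_elt[OF M LL J] gr_cls_add[OF M LL J] gr_smult[OF M LL J]
        VG_add VG_T_scale Kop_add Kop_scale T_ring_cpolys)
  have 3: "gr_K L k J (gr_cls L k J F) = gr_cls L k J (K_op L F)"
    if J: "J \<subseteq> L" and F: "F \<in> Filt L k J" for J F
    using F Filt[OF J] K[OF J] gr_K_elt[OF M LL J] by auto
  \<comment> \<open>Both algebras, for L and for the subset J, are read in the model over L, so the
    same matrix entries appear.\<close>
  have gr: "D_gr L' k J = set_det (K_entry L) (bmons_exact k J)" if "L' \<subseteq> L" "J \<subseteq> L'" for L' J
    by (rule D_gr_eq[OF M that])
  have 4: "D_det L k = (\<Prod>J \<in> Pow L. D_gr L k J)"
  proof -
    \<comment> \<open>A basis vector lies in the piece of its own support, which the operator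
      preserves.\<close>
    have tri: "xsupp c \<subseteq> xsupp b"
      if "b \<in> bmons_within k L" "K_entry L c b \<noteq> 0" for b c
    proof -
      have "bvec b \<in> VG L k (xsupp b)" "xsupp b \<subseteq> L"
        using that(1) by (auto simp: bmons_within_def intro: bvec_VG)
      then have "Kop L (bvec b) \<in> VG L k (xsupp b)" by (rule VG_Kop)
      with that(2) show ?thesis unfolding K_entry_def by (intro bcoord_support)
    qed
    have B: "{b \<in> bmons_within k L. xsupp b \<in> Pow L} = bmons_within k L"
      by (auto simp: bmons_within_def)
    have E: "{b \<in> bmons_within k L. xsupp b = J} = bmons_exact k J" if "J \<subseteq> L" for J
      using that by (auto simp: bmons_within_def bmons_exact_def)
    have "D_det L k = set_det (K_entry L) (bmons_within k L)"
      unfolding D_det_def H_module_def by (rule endo_det_Filt[OF M LL LL])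
    also have "\<dots> = set_det (K_entry L) {b \<in> bmons_within k L. xsupp b \<in> Pow L}"
      by (simp only: B)
    also have "\<dots> = (\<Prod>J \<in> Pow L. set_det (K_entry L) {b \<in> bmons_within k L. xsupp b = J})"
    proof (rule set_det_block_triangular)
      show "finite (Pow L)" using M by simp
      show "finite J" if "J \<in> Pow L" for J using that M finite_subset by blast
      show "finite {b \<in> bmons_within k L. xsupp b = J}" for J using finite_bmons_within[OF M] by simp
      show "xsupp c \<subseteq> xsupp b" if "b \<in> bmons_within k L" "K_entry L c b \<noteq> 0" for b c
        using that by (rule tri)
    qed
    also have "\<dots> = (\<Prod>J \<in> Pow L. D_gr L k J)"
      by (rule prod.cong) (auto simp: E gr)
    finally show ?thesis .
  qed
  have 5: "D_gr J k J \<in> carrier (T_ring J)" if J: "J \<subseteq> L" for J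
  proof -
    have fin: "finite (bmons_exact k J)"
      by (rule finite_bmons_exact[OF finite_subset[OF J M]])
    then obtain bs where bs: "distinct bs" "set bs = bmons_exact k J"
      using finite_distinct_list by blast
    \<comment> \<open>Since b has support J, its image lies in the piece of the algebra with index
      set J itself, whose coefficients contain only c_ij with both indices in J.\<close>
    have e: "K_entry L c b \<in> carrier (T_ring J)" if "b \<in> bmons_exact k J" for b c
      unfolding K_entry_def
      by (rule bcoord_T[OF VG_Kop[OF bvec_VG]]) (use that in \<open>auto simp: bmons_exact_def\<close>)
    have "D_gr J k J = list_det (K_entry L) bs"
      using gr[OF J, of J] set_det_set[OF bs(1), of "K_entry L"] bs(2) by simp
    also have "\<dots> \<in> carrier (T_ring J)"
      unfolding list_det_def T_ring_carrier
    proof (rule polys_in_det)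
      fix i j assume "i < length bs" "j < length bs"
      then show "mat (length bs) (length bs) (\<lambda>(i, j). K_entry L (bs ! i) (bs ! j)) $$ (i, j)
          \<in> polys_in {SC i j | i j. i \<in> J \<and> j \<in> J \<and> i \<le> j}"
        using e[of "bs ! j" "bs ! i"] bs(2) nth_mem[of j bs] by (simp add: T_ring_carrier)
    qed simp
    finally show ?thesis .
  qed
  have 6: "D_gr L k J = D_gr J k J" if "J \<subseteq> L" for J
    using gr[OF LL that] gr[OF that, of J] by simp
  show ?thesis
    unfolding L_def[symmetric] 
    by (intro conjI allI impI ballI) (rule 1 2 3 4 5 6 T_ring_mono; assumption)+
qed

end
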